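(* Let $J$ be a matroidal ideal of $R=K[x_1,\dots,x_n]$ generated in degree $2$ with $\gcd(J)=1$. Then $J$ is sequentially Cohen-Macaulay (SCM) if and only if there exists a permutation $y_1,\dots,y_n$ of the variables $x_1,\dots,x_n$ such that one of the following holds: (a) $J=y_1\mathfrak{p}+J'$, where $\mathfrak{p}$ is a monomial prime ideal with $y_1\notin\mathfrak{p}$ and $\operatorname{height}(\mathfrak{p})=n-1$, and $J'$ is an SCM matroidal ideal with $\operatorname{supp}(J')=\{y_2,\dots,y_n\}$ and $\gcd(J')=1$; or (b) $J=y_1\mathfrak{p}+y_2\mathfrak{q}$, where $\mathfrak{p}$ and $\mathfrak{q}$ are monomial prime ideals with $y_1\notin\mathfrak{p}$ and $y_1,y_2\notin\mathfrak{q}$ such that $\operatorname{height}(\mathfrak{p})=n-1$ and $\operatorname{height}(\mathfrak{q})=n-2$.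
   Context: $K$ is a field and $R=K[x_1,\dots,x_n]$ with the standard grading. For a monomial ideal $I$, $G(I)$ is its unique minimal set of monomial generators, $\gcd(I)$ is the greatest common divisor of the elements of $G(I)$, and $\operatorname{supp}(I)$ is the set of variables dividing some element of $G(I)$. A monomial ideal $I$ generated in one degree is polymatroidal if for all $u,v\in G(I)$ and every $i$ with $\deg_{x_i}(v)<\deg_{x_i}(u)$ there is $j$ with $\deg_{x_j}(u)<\deg_{x_j}(v)$ and $x_j(u/x_i)\in G(I)$; it is matroidal if moreover it is generated by square-free monomials. Standing assumption: the given matroidal ideal of $R$ is fully supported, i.e. $\operatorname{supp}(J)=\{x_1,\dots,x_n\}$. A monomial prime ideal is an ideal generated by a subset of the variables. Ideals of polynomial subrings of $R$ are identified with their extensions to $R$. A graded module $M$ is sequentially Cohen-Macaulay if there is a finite filtration by graded submodules $0=M_0\subset M_1\subset\dots\subset M_r=M$ with each $M_i/M_{i-1}$ Cohen-Macaulay and $\dim(M_1/M_0)<\dots<\dim(M_r/M_{r-1})$; an ideal $I\subset R$ is called SCM if $R/I$ is sequentially Cohen-Macaulay. *)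

theory Defs
  imports
    "HOL-Library.Poly_Mapping"
    "HOL-Library.Extended_Nat"
    "HOL-Library.Cardinality"
    "HOL-Algebra.Algebraic_Closure_Type"
    "HOL-Algebra.Module"
begin

section \<open>Modules over a commutative ring\<close>

definition regular_module :: "'a ring \<Rightarrow> ('a, 'a) module" where
  "regular_module R =
    \<lparr>carrier = carrier R, monoid.mult = monoid.mult R, one = one R, zero = zero R, add = add R,
     module.smult = monoid.mult R\<rparr>"

text \<open>The fields \<open>mult\<close> and \<open>one\<close>, which module records inherit from ring records,
  carry no information in a module.\<close>

definition quotient_module ::
  "('a, 'm) module \<Rightarrow> 'm set \<Rightarrow> ('a, 'm set) module"  (infixl \<open>QuotM\<close> 65)
  where
  "M QuotM N =
    \<lparr>carrier = a_rcosets\<^bsub>M\<^esub> N, monoid.mult = undefined, one = undefined,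
     zero = N, add = set_add M,
     module.smult = (\<lambda>r C. ((\<lambda>x. r \<odot>\<^bsub>M\<^esub> x) ` C) <+>\<^bsub>M\<^esub> N)\<rparr>"

definition annihilator :: "'a ring \<Rightarrow> ('a, 'm) module \<Rightarrow> 'a set" where
  "annihilator R M = {r \<in> carrier R. \<forall>x\<in>carrier M. r \<odot>\<^bsub>M\<^esub> x = \<zero>\<^bsub>M\<^esub>}"

text \<open>The supremum of the lengths \<open>k\<close> of the chains \<open>P 0 \<subset> \<dots> \<subset> P k\<close> in a set of ideals.\<close>

definition chain_length_sup :: "'a set set \<Rightarrow> enat" where
  "chain_length_sup S =
    Sup {enat k | k. \<exists>P. (\<forall>i\<le>k. P i \<in> S) \<and> (\<forall>i<k. P i \<subset> P (Suc i))}"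

text \<open>The height of a prime ideal.\<close>

definition height :: "'a ring \<Rightarrow> 'a set \<Rightarrow> enat" where
  "height R P = chain_length_sup {Q. primeideal Q R \<and> Q \<subseteq> P}"

text \<open>The Krull dimension of \<open>R / Ann M\<close>, read off in \<open>R\<close>. The zero module gets the
  value 0.\<close>

definition module_dim :: "'a ring \<Rightarrow> ('a, 'm) module \<Rightarrow> enat" where
  "module_dim R M = chain_length_sup {Q. primeideal Q R \<and> annihilator R M \<subseteq> Q}"

text \<open>The submodule \<open>(f\<^sub>1, \<dots>, f\<^sub>k) M\<close>.\<close>

primrec multiples :: "('a, 'm) module \<Rightarrow> 'a list \<Rightarrow> 'm set" where
  "multiples M [] = {\<zero>\<^bsub>M\<^esub>}"
| "multiples M (f # fs) = ((\<lambda>x. f \<odot>\<^bsub>M\<^esub> x) ` carrier M) <+>\<^bsub>M\<^esub> multiples M fs"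

definition regular_sequence :: "('a, 'm) module \<Rightarrow> 'a list \<Rightarrow> bool" where
  "regular_sequence M fs \<longleftrightarrow>
    (\<forall>i<length fs. \<forall>x\<in>carrier M.
       fs ! i \<odot>\<^bsub>M\<^esub> x \<in> multiples M (take i fs) \<longrightarrow> x \<in> multiples M (take i fs)) \<and>
    multiples M fs \<noteq> carrier M"

text \<open>\<open>gr d\<close> is the homogeneous component of degree \<open>d\<close> of \<open>M\<close>; a submodule is graded if
  it is the sum of its intersections with these components.\<close>

definition graded_submodule ::
  "'a ring \<Rightarrow> ('a, 'm) module \<Rightarrow> ('i \<Rightarrow> 'm set) \<Rightarrow> 'm set \<Rightarrow> bool" where
  "graded_submodule R M gr N \<longleftrightarrow>
    submodule N R M \<and>
    (\<forall>x\<in>N. \<exists>D c. finite D \<and> (\<forall>d\<in>D. c d \<in> N \<inter> gr d) \<and> x = finsum M c D)"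


section \<open>Polynomials and monomials\<close>

text \<open>The variables of the polynomial ring are indexed by the finite type \<open>'v\<close>, so that
  their number is \<open>CARD('v)\<close>. A monomial is represented by its exponent vector, an element
  of \<open>'v \<Rightarrow>\<^sub>0 nat\<close>. The order \<open>\<le>\<close> which the library puts on that type is lexicographic
  and is not used; divisibility is that of the polynomial ring.\<close>

type_synonym ('v, 'k) mpoly = "('v \<Rightarrow>\<^sub>0 nat) \<Rightarrow>\<^sub>0 'k"

abbreviation mpoly_ring :: "('v::finite, 'k::field) mpoly ring" where
  "mpoly_ring \<equiv> ring_of_type_algebra"

definition mon :: "('v::finite \<Rightarrow>\<^sub>0 nat) \<Rightarrow> ('v, 'k::field) mpoly" where
  "mon u = Poly_Mapping.single u 1"

definition Var :: "'v::finite \<Rightarrow> ('v, 'k::field) mpoly" where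
  "Var v = mon (Poly_Mapping.single v 1)"

definition mono_degree :: "('v::finite \<Rightarrow>\<^sub>0 nat) \<Rightarrow> nat" where
  "mono_degree u = (\<Sum>v\<in>UNIV. Poly_Mapping.lookup u v)"

definition homogeneous :: "nat \<Rightarrow> ('v::finite, 'k::field) mpoly set" where
  "homogeneous d = {f. \<forall>u\<in>Poly_Mapping.keys f. mono_degree u = d}"


section \<open>Sequentially Cohen-Macaulay modules\<close>

text \<open>As usual for finitely generated graded modules, the depth is measured by regular
  sequences of homogeneous elements of positive degree, and a module is Cohen-Macaulay
  if its depth equals its dimension.\<close>

definition depth :: "(('v::finite, 'k::field) mpoly, 'm) module \<Rightarrow> enat" where
  "depth M =
    Sup {enat (length fs) | fs.
      (\<forall>f\<in>set fs. \<exists>d>0. f \<in> homogeneous d) \<and> regular_sequence M fs}"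

definition cohen_macaulay :: "(('v::finite, 'k::field) mpoly, 'm) module \<Rightarrow> bool" where
  "cohen_macaulay M \<longleftrightarrow> depth M = module_dim mpoly_ring M"

definition sequentially_cohen_macaulay ::
  "(('v::finite, 'k::field) mpoly, 'm) module \<Rightarrow> (nat \<Rightarrow> 'm set) \<Rightarrow> bool" where
  "sequentially_cohen_macaulay M gr \<longleftrightarrow>
    (\<exists>r F.
      (let Q = (\<lambda>i. (M\<lparr>carrier := F (Suc i)\<rparr>) QuotM F i) in
        F 0 = {\<zero>\<^bsub>M\<^esub>} \<and> F r = carrier M \<and>
        (\<forall>i\<le>r. graded_submodule mpoly_ring M gr (F i)) \<and>
        (\<forall>i<r. F i \<subset> F (Suc i) \<and> cohen_macaulay (Q i)) \<and>
        (\<forall>i. Suc i < r \<longrightarrow> module_dim mpoly_ring (Q i) < module_dim mpoly_ring (Q (Suc i)))))"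

text \<open>An ideal \<open>I\<close> is SCM if \<open>R / I\<close>, with the grading induced by the standard grading
  of \<open>R\<close>, is sequentially Cohen-Macaulay.\<close>

definition SCM :: "('v::finite, 'k::field) mpoly set \<Rightarrow> bool" where
  "SCM I \<longleftrightarrow>
    sequentially_cohen_macaulay (regular_module mpoly_ring QuotM I)
      (\<lambda>d. (\<lambda>f. I +>\<^bsub>mpoly_ring\<^esub> f) ` homogeneous d)"


section \<open>Monomial, polymatroidal and matroidal ideals\<close>

definition mono_gen :: "('v::finite \<Rightarrow>\<^sub>0 nat) set \<Rightarrow> ('v, 'k::field) mpoly set" where
  "mono_gen S = Idl\<^bsub>mpoly_ring\<^esub> (mon ` S)"

definition monomial_ideal :: "('v::finite, 'k::field) mpoly set \<Rightarrow> bool" where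
  "monomial_ideal I \<longleftrightarrow> (\<exists>S. I = mono_gen S)"

text \<open>The exponent vectors of the unique minimal set of monomial generators.\<close>

definition min_gens :: "('v::finite, 'k::field) mpoly set \<Rightarrow> ('v \<Rightarrow>\<^sub>0 nat) set" where
  "min_gens I = (THE S. I = mono_gen S \<and> (\<forall>T. T \<subset> S \<longrightarrow> I \<noteq> mono_gen T))"

definition generated_in_degree :: "('v::finite, 'k::field) mpoly set \<Rightarrow> nat \<Rightarrow> bool" where
  "generated_in_degree I d \<longleftrightarrow> (\<forall>u\<in>min_gens I. mono_degree u = d)"

text \<open>A predicate, because the empty set of monomials has no greatest common divisor among
  the monomials: \<open>is_gcd I 1\<close> excludes the zero ideal.\<close>

definition is_gcd :: "('v::finite, 'k::field) mpoly set \<Rightarrow> ('v, 'k) mpoly \<Rightarrow> bool" where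
  "is_gcd I m \<longleftrightarrow>
    m \<in> range mon \<and> (\<forall>u\<in>min_gens I. m dvd mon u) \<and>
    (\<forall>m'\<in>range mon. (\<forall>u\<in>min_gens I. m' dvd mon u) \<longrightarrow> m' dvd m)"

definition supp :: "('v::finite, 'k::field) mpoly set \<Rightarrow> ('v, 'k) mpoly set" where
  "supp I = {Var v | v. \<exists>u\<in>min_gens I. (Var v :: ('v, 'k) mpoly) dvd mon u}"

text \<open>In the exchange property, \<open>u - single i 1 + single j 1\<close> is the exponent vector of
  \<open>x\<^sub>j (u / x\<^sub>i)\<close>; the truncated subtraction is harmless since \<open>x\<^sub>i\<close> divides \<open>u\<close>.\<close>

definition polymatroidal :: "('v::finite, 'k::field) mpoly set \<Rightarrow> bool" where
  "polymatroidal I \<longleftrightarrow>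
    monomial_ideal I \<and> (\<exists>d. generated_in_degree I d) \<and>
    (\<forall>u\<in>min_gens I. \<forall>v\<in>min_gens I. \<forall>i.
       Poly_Mapping.lookup v i < Poly_Mapping.lookup u i \<longrightarrow>
       (\<exists>j. Poly_Mapping.lookup u j < Poly_Mapping.lookup v j \<and>
            u - Poly_Mapping.single i 1 + Poly_Mapping.single j 1 \<in> min_gens I))"

definition matroidal :: "('v::finite, 'k::field) mpoly set \<Rightarrow> bool" where
  "matroidal I \<longleftrightarrow>
    polymatroidal I \<and> (\<forall>u\<in>min_gens I. \<forall>v. Poly_Mapping.lookup u v \<le> 1)"

definition monomial_prime :: "('v::finite, 'k::field) mpoly set \<Rightarrow> bool" where
  "monomial_prime P \<longleftrightarrow> (\<exists>A. P = Idl\<^bsub>mpoly_ring\<^esub> (Var ` A))"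

end

theory Submission
  imports Defs
begin

text \<open>
  A matroidal ideal of degree \<open>2\<close> with full support is a loopless matroid of rank \<open>2\<close>, that is, a
  partition of the variables into at least two parts: \<open>x\<^sub>a x\<^sub>b\<close> is a generator iff \<open>a\<close> and \<open>b\<close> lie in
  different parts (\<open>matroidal_is_multipartite\<close>). So \<open>J\<close> is the edge ideal of a complete
  multipartite graph, and it is the intersection of the primes \<open>P\<^sub>k\<close> generated by the variables
  outside the \<open>k\<close>-th part; geometrically, its zero set is a union of coordinate subspaces which meet
  pairwise only in the origin. The main point is that such a ring is sequentially
  Cohen-Macaulay iff at most one part has two or more elements
  (\<open>SCM_multipartite_imp\<close> and \<open>SCM_multipartiteI\<close>). Two large subspaces that meet in a point cannot
  occur, because a module built from Cohen-Macaulay modules of dimension at least \<open>2\<close> is not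
  disconnected by removing a point. Conversely, if one part is large and all others are singletons, then
  \<open>0 \<subset> P/J \<subset> R/J\<close>, with \<open>P\<close> the prime of the large part, is a filtration as required: \<open>R/P\<close> is a
  polynomial ring, and \<open>P/J\<close> is Cohen-Macaulay of dimension \<open>1\<close> because the sum of the variables
  of the singleton parts is a nonzerodivisor on it; without a large part, \<open>R/J\<close> itself is
  Cohen-Macaulay for the same reason.

  Granted this, the theorem is combinatorial. A singleton part is a variable \<open>y\<^sub>1\<close> adjacent to all
  the others, and it splits off: \<open>J = y\<^sub>1 (y\<^sub>2, \<dots>, y\<^sub>n) + J'\<close>, where \<open>J'\<close> belongs to the remaining
  parts (\<open>multipartite_split\<close>). As \<open>gcd(J) = 1\<close> forces at least three parts, there are two
  singletons \<open>y\<^sub>1\<close>, \<open>y\<^sub>2\<close>. If \<open>gcd(J') = 1\<close>, this is (a); otherwise there are exactly three parts and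
  splitting off \<open>y\<^sub>2\<close> as well gives (b). In the other direction, the large parts of \<open>J\<close> are
  those of \<open>J'\<close>, because \<open>y\<^sub>1\<close> is a part of its own.

  The ideal \<open>J'\<close> is an ideal of \<open>R\<close> although \<open>y\<^sub>1\<close> does not occur in it. The two results on
  multipartite ideals therefore admit one variable outside all parts. All dimensions then
  increase by one, and for necessity a regular sequence of length \<open>3\<close> has to be replaced by one
  of length \<open>2\<close> which avoids that variable (\<open>regular_pair_in_var_ideal\<close>).

  Dimension theory enters only through \<open>chain_length_le\<close>, a counting argument which bounds chains
  of ideals linked by nonzerodivisors. Chains of primes and the colon ideals of a regular
  sequence are both of this kind, so it bounds dimension, depth and height alike.
\<close>

abbreviation "keys \<equiv> Poly_Mapping.keys"
abbreviation "lookup \<equiv> Poly_Mapping.lookup"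
abbreviation "single \<equiv> Poly_Mapping.single"

section \<open>Ideals of the polynomial ring\<close>

abbreviation is_ideal :: "'a::comm_ring_1 set \<Rightarrow> bool" where
  "is_ideal I \<equiv> ideal I ring_of_type_algebra"

lemma rta_simps [simp]:
  "carrier ring_of_type_algebra = UNIV"
  "monoid.mult ring_of_type_algebra = (*)"
  "one ring_of_type_algebra = 1"
  "zero ring_of_type_algebra = 0"
  "add ring_of_type_algebra = (+)"
  by (simp_all add: ring_of_type_algebra_def)

lemma cring_rta [simp]: "cring (ring_of_type_algebra :: 'a::comm_ring_1 ring)"
  by (rule cring_from_type_algebra)

lemma ring_rta [simp]: "ring (ring_of_type_algebra :: 'a::comm_ring_1 ring)"
  using cring_rta cring_def by blast

lemma a_inv_rta [simp]: "a_inv ring_of_type_algebra x = - (x :: 'a::comm_ring_1)"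
proof -
  interpret ring "ring_of_type_algebra :: 'a ring" by simp
  have "- x \<oplus>\<^bsub>ring_of_type_algebra\<^esub> x = \<zero>\<^bsub>ring_of_type_algebra\<^esub>" by simp
  from minus_equality[OF this] show ?thesis by simp
qed

text \<open>The ring of a type has as its carrier the whole type, so its ideals are described with the
  operations of the type alone.\<close>

lemma is_ideal_iff:
  fixes I :: "'a::comm_ring_1 set"
  shows "is_ideal I \<longleftrightarrow> 0 \<in> I \<and> (\<forall>a\<in>I. \<forall>b\<in>I. a + b \<in> I) \<and> (\<forall>r. \<forall>a\<in>I. r * a \<in> I)"
proof
  assume I: "is_ideal I"
  then interpret ideal I "ring_of_type_algebra :: 'a ring" .
  show "0 \<in> I \<and> (\<forall>a\<in>I. \<forall>b\<in>I. a + b \<in> I) \<and> (\<forall>r. \<forall>a\<in>I. r * a \<in> I)"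
    using additive_subgroup.zero_closed[OF is_additive_subgroup]
      additive_subgroup.a_closed[OF is_additive_subgroup] I_l_closed by auto
next
  assume *: "0 \<in> I \<and> (\<forall>a\<in>I. \<forall>b\<in>I. a + b \<in> I) \<and> (\<forall>r. \<forall>a\<in>I. r * a \<in> I)"
  have neg: "- a \<in> I" if "a \<in> I" for a
    using * that by (metis mult_minus1)
  interpret R: ring "ring_of_type_algebra :: 'a ring" by simp
  have "subgroup I (add_monoid (ring_of_type_algebra :: 'a ring))"
  proof (unfold_locales)
    fix x assume "x \<in> I"
    then show "inv\<^bsub>add_monoid ring_of_type_algebra\<^esub> x \<in> I"
      using neg a_inv_def a_inv_rta by metis
  qed (use * in auto)
  then show "is_ideal I"
    using * by (intro idealI) (auto, metis mult.commute)
qed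

lemma is_idealI:
  fixes I :: "'a::comm_ring_1 set"
  assumes "0 \<in> I" "\<And>a b. a \<in> I \<Longrightarrow> b \<in> I \<Longrightarrow> a + b \<in> I" "\<And>r a. a \<in> I \<Longrightarrow> r * a \<in> I"
  shows "is_ideal I"
  using assms by (simp add: is_ideal_iff)

lemma ideal_zero: "is_ideal I \<Longrightarrow> 0 \<in> I"
  and ideal_add: "is_ideal I \<Longrightarrow> a \<in> I \<Longrightarrow> b \<in> I \<Longrightarrow> a + b \<in> I"
  and ideal_mult: "is_ideal I \<Longrightarrow> a \<in> I \<Longrightarrow> r * a \<in> I"
  by (simp_all add: is_ideal_iff)

lemma ideal_mult2: "is_ideal I \<Longrightarrow> a \<in> I \<Longrightarrow> a * r \<in> I"
  using ideal_mult[of I a r] by (simp add: mult.commute)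

lemma ideal_minus: "is_ideal I \<Longrightarrow> a \<in> I \<Longrightarrow> - a \<in> I"
  using ideal_mult[of I a "-1"] by simp

lemma ideal_diff: "is_ideal I \<Longrightarrow> a \<in> I \<Longrightarrow> b \<in> I \<Longrightarrow> a - b \<in> I"
  using ideal_add[of I a "- b"] ideal_minus[of I b] by simp

lemma ideal_sum: "is_ideal I \<Longrightarrow> (\<And>x. x \<in> S \<Longrightarrow> f x \<in> I) \<Longrightarrow> sum f S \<in> I"
  by (induction S rule: infinite_finite_induct) (auto intro: ideal_zero ideal_add)

lemma ideal_UNIV: "is_ideal UNIV"
  by (rule is_idealI) auto

lemma ideal_zero_ideal: "is_ideal {0}"
  by (rule is_idealI) auto

lemma primeideal_iff:
  fixes P :: "'a::comm_ring_1 set"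
  shows "primeideal P ring_of_type_algebra \<longleftrightarrow>
    is_ideal P \<and> 1 \<notin> P \<and> (\<forall>a b. a * b \<in> P \<longrightarrow> a \<in> P \<or> b \<in> P)"
proof
  assume "primeideal P ring_of_type_algebra"
  then interpret primeideal P "ring_of_type_algebra :: 'a ring" .
  show "is_ideal P \<and> 1 \<notin> P \<and> (\<forall>a b. a * b \<in> P \<longrightarrow> a \<in> P \<or> b \<in> P)"
    using is_ideal I_notcarr one_imp_carrier I_prime by (auto)
next
  assume *: "is_ideal P \<and> 1 \<notin> P \<and> (\<forall>a b. a * b \<in> P \<longrightarrow> a \<in> P \<or> b \<in> P)"
  show "primeideal P ring_of_type_algebra"
    by (rule primeidealI) (use * in auto)
qed

section \<open>Ideals described by the monomials of their elements\<close>

text \<open>For an upward closed set \<open>E\<close> these are exactly the monomial ideals; membership is then decided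
  monomial by monomial.\<close>

definition supported :: "('v::finite \<Rightarrow>\<^sub>0 nat) set \<Rightarrow> ('v, 'k::field) mpoly set" where
  "supported E = {f. keys f \<subseteq> E}"

definition upclosed :: "('v::finite \<Rightarrow>\<^sub>0 nat) set \<Rightarrow> bool" where
  "upclosed E \<longleftrightarrow> (\<forall>u\<in>E. \<forall>w. u + w \<in> E)"

lemma supportedI: "(\<And>u. u \<in> keys f \<Longrightarrow> u \<in> E) \<Longrightarrow> f \<in> supported E"
  by (auto simp: supported_def)

lemma mult_in_supported:
  assumes "\<And>u w. u \<in> keys f \<Longrightarrow> w \<in> keys g \<Longrightarrow> u + w \<in> E"
  shows "f * g \<in> supported E"
  using keys_mult[of f g] assms by (fastforce simp: supported_def)

lemma ideal_supported:
  assumes "upclosed E"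
  shows "is_ideal (supported E :: ('v::finite, 'k::field) mpoly set)"
proof (rule is_idealI)
  fix r a :: "('v, 'k) mpoly" assume a: "a \<in> supported E"
  show "r * a \<in> supported E"
  proof (rule mult_in_supported)
    fix u w assume "u \<in> keys r" "w \<in> keys a"
    then show "u + w \<in> E" using a assms
      by (metis supported_def mem_Collect_eq subsetD upclosed_def add.commute)
  qed
qed (use Poly_Mapping.keys_add in \<open>fastforce simp: supported_def\<close>)+

lemma mon_in_supported [simp]: "mon u \<in> supported E \<longleftrightarrow> u \<in> E"
  by (simp add: supported_def mon_def)

lemma mon_mult: "mon u * mon w = mon (u + w)"
  by (simp add: mon_def mult_single)

lemma mon_0: "mon 0 = 1"
  by (simp add: mon_def)

lemma supported_subset_iff:
  "(supported E :: ('v::finite, 'k::field) mpoly set) \<subseteq> supported F \<longleftrightarrow> E \<subseteq> F"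
proof
  assume *: "(supported E :: ('v, 'k) mpoly set) \<subseteq> supported F"
  show "E \<subseteq> F"
  proof
    fix u assume "u \<in> E"
    then have "(mon u :: ('v, 'k) mpoly) \<in> supported E" by simp
    with * have "(mon u :: ('v, 'k) mpoly) \<in> supported F" by blast
    then show "u \<in> F" by simp
  qed
qed (auto simp: supported_def)

text \<open>The expansion into terms reduces statements on polynomials to statements on monomials.\<close>

lemma mpoly_as_sum:
  "f = (\<Sum>u\<in>keys f. single 0 (lookup f u) * mon u)"
  (is "f = ?s") for f :: "('v::finite, 'k::field) mpoly"
proof (rule poly_mapping_eqI)
  fix w
  have "lookup ?s w = (\<Sum>u\<in>keys f. if u = w then lookup f u else 0)"
    by (simp add: lookup_sum mon_def mult_single lookup_single when_def)
  also have "\<dots> = lookup f w"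
    by (simp add: sum.delta in_keys_iff)
  finally show "lookup f w = lookup ?s w" by simp
qed

lemma supported_subset_ideal:
  assumes "is_ideal I" "\<And>u. u \<in> E \<Longrightarrow> mon u \<in> I"
  shows "supported E \<subseteq> (I :: ('v::finite, 'k::field) mpoly set)"
proof
  fix f :: "('v, 'k) mpoly" assume "f \<in> supported E"
  then have "(\<Sum>u\<in>keys f. single 0 (lookup f u) * mon u) \<in> I"
    using assms by (intro ideal_sum ideal_mult) (auto simp: supported_def)
  then show "f \<in> I" using mpoly_as_sum[of f] by simp
qed

lemma genideal_least:
  "is_ideal I \<Longrightarrow> S \<subseteq> I \<Longrightarrow> Idl\<^bsub>ring_of_type_algebra\<^esub> S \<subseteq> (I :: 'a::comm_ring_1 set)"
  by (rule ring.genideal_minimal) auto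

lemma genideal_rta: "is_ideal (Idl\<^bsub>ring_of_type_algebra\<^esub> (S :: 'a::comm_ring_1 set))"
  "S \<subseteq> Idl\<^bsub>ring_of_type_algebra\<^esub> S"
  using ring.genideal_ideal[OF ring_rta] ring.genideal_self[OF ring_rta] by auto

lemma mono_gen_eq:
  "mono_gen S = (supported {u. \<exists>s\<in>S. \<exists>w. u = s + w} :: ('v::finite, 'k::field) mpoly set)"
  (is "_ = supported ?E")
proof
  have "upclosed ?E"
    by (auto simp: upclosed_def) (metis add.assoc)
  moreover have "mon ` S \<subseteq> (supported ?E :: ('v, 'k) mpoly set)"
    by (auto intro!: bexI exI[of _ 0])
  ultimately show "mono_gen S \<subseteq> (supported ?E :: ('v, 'k) mpoly set)"
    unfolding mono_gen_def by (intro genideal_least ideal_supported)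
  show "supported ?E \<subseteq> (mono_gen S :: ('v, 'k) mpoly set)"
  proof (rule supported_subset_ideal)
    show I: "is_ideal (mono_gen S :: ('v, 'k) mpoly set)"
      by (simp add: mono_gen_def genideal_rta)
    fix u assume "u \<in> ?E"
    then obtain s w where "s \<in> S" "u = s + w" by auto
    then have "mon u = mon w * (mon s :: ('v, 'k) mpoly)" "(mon s :: ('v, 'k) mpoly) \<in> mono_gen S"
      using genideal_rta(2)[of "mon ` S :: ('v, 'k) mpoly set"]
      by (auto simp: mon_mult add.commute mono_gen_def)
    then show "mon u \<in> (mono_gen S :: ('v, 'k) mpoly set)"
      using ideal_mult[OF I] by simp
  qed
qed

subsection \<open>Ideals generated by variables\<close>

definition var_ideal :: "'v::finite set \<Rightarrow> ('v, 'k::field) mpoly set" where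
  "var_ideal A = supported {u. keys u \<inter> A \<noteq> {}}"

lemma keys_add_nat: "keys (u + w) = keys u \<union> keys w"
  for u w :: "'v \<Rightarrow>\<^sub>0 nat"
  by (auto simp: in_keys_iff lookup_add)

lemma upclosed_var: "upclosed {u. keys u \<inter> A \<noteq> {}}"
  by (auto simp: upclosed_def keys_add_nat)

lemma ideal_var_ideal: "is_ideal (var_ideal A)"
  unfolding var_ideal_def by (intro ideal_supported upclosed_var)

lemma single_le_split:
  "v \<in> keys u \<Longrightarrow> \<exists>w. u = single v 1 + w" for u :: "'v \<Rightarrow>\<^sub>0 nat"
  by (rule exI[of _ "u - single v 1"], rule poly_mapping_eqI)
     (auto simp: lookup_add lookup_minus lookup_single in_keys_iff when_def)

lemma genideal_Var: "Idl\<^bsub>mpoly_ring\<^esub> (Var ` A) = (var_ideal A :: ('v::finite, 'k::field) mpoly set)"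
proof -
  have "Idl\<^bsub>mpoly_ring\<^esub> (Var ` A) = (mono_gen ((\<lambda>v. single v 1) ` A) :: ('v, 'k) mpoly set)"
    by (simp add: mono_gen_def Var_def image_image)
  moreover have "{u. \<exists>s\<in>(\<lambda>v. single v (1::nat)) ` A. \<exists>w. u = s + w} = {u. keys u \<inter> A \<noteq> {}}"
    using single_le_split by (fastforce simp: keys_add_nat)
  ultimately show ?thesis by (simp add: mono_gen_eq var_ideal_def)
qed

lemma Var_in_var_ideal [simp]: "Var v \<in> var_ideal A \<longleftrightarrow> v \<in> A"
  by (simp add: Var_def var_ideal_def)

lemma one_notin_var_ideal [simp]: "1 \<notin> var_ideal A"
  unfolding mon_0[symmetric] var_ideal_def by simp

lemma var_ideal_subset_iff [simp]:
  "(var_ideal A :: ('v::finite, 'k::field) mpoly set) \<subseteq> var_ideal B \<longleftrightarrow> A \<subseteq> B"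
proof
  assume *: "(var_ideal A :: ('v, 'k) mpoly set) \<subseteq> var_ideal B"
  show "A \<subseteq> B"
  proof
    fix v assume "v \<in> A"
    then have "(Var v :: ('v, 'k) mpoly) \<in> var_ideal A" by simp
    then show "v \<in> B" using * Var_in_var_ideal by blast
  qed
next
  assume "A \<subseteq> B" then show "(var_ideal A :: ('v, 'k) mpoly set) \<subseteq> var_ideal B"
    unfolding var_ideal_def supported_subset_iff by auto
qed

lemma lookup_mult_unique:
  fixes f g :: "('v::finite, 'k::field) mpoly"
  assumes "\<And>s t. s \<in> keys f \<Longrightarrow> t \<in> keys g \<Longrightarrow> s + t = u + w \<Longrightarrow> s = u \<and> t = w"
  shows "lookup (f * g) (u + w) = lookup f u * lookup g w"
proof -
  have "f * g = (\<Sum>s\<in>keys f. single 0 (lookup f s) * mon s) *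
    (\<Sum>t\<in>keys g. single 0 (lookup g t) * mon t)"
    using mpoly_as_sum[of f] mpoly_as_sum[of g] by simp
  also have "\<dots> = (\<Sum>s\<in>keys f. \<Sum>t\<in>keys g.
      single (s + t) (lookup f s * lookup g t))"
    unfolding sum_product by (simp add: mon_def mult_single)
  finally have "lookup (f * g) (u + w) = (\<Sum>s\<in>keys f. \<Sum>t\<in>keys g.
      (if s + t = u + w then lookup f s * lookup g t else 0))"
    by (simp add: lookup_sum lookup_single when_def)
  also have "\<dots> = (\<Sum>s\<in>keys f. \<Sum>t\<in>keys g.
      (if t = w then (if s = u then lookup f s * lookup g t else 0) else 0))"
    using assms by (intro sum.cong refl) auto
  also have "\<dots> = lookup f u * lookup g w"
    by (cases "lookup g w = 0") (auto simp: sum.delta in_keys_iff)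
  finally show ?thesis .
qed

text \<open>Exponent vectors indexed by \<open>nat\<close> are linearly ordered, compatibly with addition. An enumeration
  of the variables transports this order, so that leading monomials make sense.\<close>

lemma monomial_order_exists:
  "\<exists>\<Phi> :: ('v::finite \<Rightarrow>\<^sub>0 nat) \<Rightarrow> (nat \<Rightarrow>\<^sub>0 nat). inj \<Phi> \<and> (\<forall>u w. \<Phi> (u + w) = \<Phi> u + \<Phi> w)"
proof -
  obtain e :: "'v \<Rightarrow> nat" where e: "inj e"
    using finite_imp_inj_to_nat_seg[of "UNIV :: 'v set"] by auto
  define \<Phi> where "\<Phi> = (\<lambda>u :: 'v \<Rightarrow>\<^sub>0 nat. \<Sum>v\<in>UNIV. single (e v) (lookup u v))"
  have "lookup (\<Phi> u) (e v) = lookup u v" for u v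
    unfolding \<Phi>_def using e by (simp add: lookup_sum lookup_single when_def inj_eq)
  then have "inj \<Phi>" by (metis injI poly_mapping_eqI)
  moreover have "\<Phi> (u + w) = \<Phi> u + \<Phi> w" for u w
    by (simp add: \<Phi>_def lookup_add single_add sum.distrib)
  ultimately show ?thesis by blast
qed

text \<open>Given two polynomials outside the ideal, the product of the leading terms of their parts free
  of the variables in \<open>A\<close> cannot cancel, and it is again free of these variables.\<close>

lemma prime_var_ideal: "primeideal (var_ideal A :: ('v::finite, 'k::field) mpoly set) mpoly_ring"
  unfolding primeideal_iff
proof (intro conjI allI impI ideal_var_ideal one_notin_var_ideal, rule ccontr)
  fix f g :: "('v, 'k) mpoly"
  assume fg: "f * g \<in> var_ideal A" and "\<not> (f \<in> var_ideal A \<or> g \<in> var_ideal A)"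
  \<comment> \<open>The leading monomials are taken among the monomials free of \<open>A\<close>.\<close>
  define S where "S h = {u \<in> keys h. keys u \<inter> A = {}}" for h :: "('v, 'k) mpoly"
  have ne: "S f \<noteq> {}" "S g \<noteq> {}"
    using \<open>\<not> _\<close> by (auto simp: S_def var_ideal_def supported_def)
  have fin: "finite (S h)" for h by (simp add: S_def)
  obtain \<Phi> :: "('v \<Rightarrow>\<^sub>0 nat) \<Rightarrow> (nat \<Rightarrow>\<^sub>0 nat)" where
    \<Phi>: "inj \<Phi>" "\<And>u w. \<Phi> (u + w) = \<Phi> u + \<Phi> w"
    using monomial_order_exists by blast
  have ex: "\<exists>u\<in>S h. \<forall>s\<in>S h. \<Phi> s \<le> \<Phi> u" if "S h \<noteq> {}" for h
    using Max_in[of "\<Phi> ` S h"] Max_ge[of "\<Phi> ` S h"] fin[of h] that by fastforce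
  obtain u where u: "u \<in> S f" "\<And>s. s \<in> S f \<Longrightarrow> \<Phi> s \<le> \<Phi> u" using ex[OF ne(1)] by blast
  obtain w where w: "w \<in> S g" "\<And>s. s \<in> S g \<Longrightarrow> \<Phi> s \<le> \<Phi> w" using ex[OF ne(2)] by blast
  have "lookup (f * g) (u + w) = lookup f u * lookup g w"
  proof (rule lookup_mult_unique)
    fix s t assume st: "s \<in> keys f" "t \<in> keys g" "s + t = u + w"
    have "keys s \<union> keys t = keys u \<union> keys w"
      using st(3) by (metis keys_add_nat)
    then have "s \<in> S f" "t \<in> S g" using st u(1) w(1) by (auto simp: S_def)
    then have "\<Phi> s \<le> \<Phi> u" "\<Phi> t \<le> \<Phi> w" "\<Phi> s + \<Phi> t = \<Phi> u + \<Phi> w"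
      using u w \<Phi>(2) st(3) by metis+
    then have "\<Phi> s = \<Phi> u"
      by (metis add_less_le_mono order_le_less order_less_irrefl)
    then have "s = u" using \<Phi>(1) by (simp add: inj_eq)
    then show "s = u \<and> t = w" using st(3) by simp
  qed
  then have "u + w \<in> keys (f * g)"
    using u(1) w(1) by (simp add: S_def in_keys_iff)
  moreover have "keys (u + w) \<inter> A = {}"
    using u(1) w(1) by (auto simp: S_def keys_add_nat)
  ultimately show False using fg by (auto simp: var_ideal_def supported_def)
qed

lemma var_ideal_primeD: "f * g \<in> var_ideal A \<Longrightarrow> f \<in> var_ideal A \<or> g \<in> var_ideal A"
  using prime_var_ideal[of A] by (auto simp: primeideal_iff)

lemma var_ideal_cancel: "g * f \<in> var_ideal A \<Longrightarrow> g \<notin> var_ideal A \<Longrightarrow> f \<in> var_ideal A"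
  using var_ideal_primeD by blast

lemma var_ideal_cancel_Var: "Var v * f \<in> var_ideal A \<Longrightarrow> v \<notin> A \<Longrightarrow> f \<in> var_ideal A"
  by (erule var_ideal_cancel) simp

section \<open>Bounding chains of ideals by counting monomials\<close>

abbreviation const :: "'k::field \<Rightarrow> ('v::finite, 'k) mpoly" where
  "const c \<equiv> single 0 c"

lemma lookup_const_mult [simp]:
  "lookup (const c * f) u = c * lookup f u"
  for f :: "('v::finite, 'k::field) mpoly"
  using lookup_mult_unique[of "const c" f 0 u] by (cases "c = 0") auto

text \<open>Gaussian elimination: one equation is solved for a pivot unknown \<open>p\<close> and removed.\<close>

lemma underdetermined_system:
  fixes a :: "'i \<Rightarrow> 'e \<Rightarrow> 'k::field"
  assumes "finite E" "finite S" "card E < card S"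
  shows "\<exists>c. (\<exists>i\<in>S. c i \<noteq> 0) \<and> (\<forall>e\<in>E. (\<Sum>i\<in>S. c i * a i e) = 0)"
  using assms
proof (induction E arbitrary: S a rule: finite_induct)
  case empty
  then have "S \<noteq> {}" by auto
  then show ?case by (intro exI[of _ "\<lambda>_. 1"]) auto
next
  case (insert e E)
  show ?case
  proof (cases "\<forall>i\<in>S. a i e = 0")
    case True
    obtain c where "\<exists>i\<in>S. c i \<noteq> 0" "\<forall>e\<in>E. (\<Sum>i\<in>S. c i * a i e) = 0"
      using insert.IH[of S a] insert.prems insert.hyps by auto
    then show ?thesis using True by (intro exI[of _ c]) auto
  next
    case False
    then obtain p where p: "p \<in> S" "a p e \<noteq> 0" by auto
    define a' where "a' i x = a i x - a i e / a p e * a p x" for i x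
    have "card E < card (S - {p})" using insert p by simp
    then obtain c where c: "\<exists>i\<in>S-{p}. c i \<noteq> 0"
      "\<And>x. x \<in> E \<Longrightarrow> (\<Sum>i\<in>S-{p}. c i * a' i x) = 0"
      using insert.IH[of "S - {p}" a'] insert.prems by auto
    define d where "d i = (if i = p then - (\<Sum>i\<in>S-{p}. c i * (a i e / a p e)) else c i)" for i
    have split: "(\<Sum>i\<in>S. d i * a i x) = (\<Sum>i\<in>S-{p}. c i * a' i x)" for x
    proof -
      have "(\<Sum>i\<in>S. d i * a i x) = d p * a p x + (\<Sum>i\<in>S-{p}. d i * a i x)"
        using p insert.prems by (simp add: sum.remove)
      also have "(\<Sum>i\<in>S-{p}. d i * a i x) = (\<Sum>i\<in>S-{p}. c i * a i x)"
        by (rule sum.cong) (auto simp: d_def)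
      also have "d p * a p x = - (\<Sum>i\<in>S-{p}. c i * (a i e / a p e * a p x))"
        by (simp add: d_def sum_distrib_right mult.assoc)
      finally show ?thesis
        by (simp add: a'_def right_diff_distrib sum_subtractf)
    qed
    have "(\<Sum>i\<in>S. d i * a i x) = 0" if "x \<in> insert e E" for x
    proof (cases "x = e")
      case True
      have "a' i e = 0" for i using p by (simp add: a'_def)
      then show ?thesis using True split by simp
    next
      case False
      then show ?thesis using that split c(2) by simp
    qed
    moreover have "\<exists>i\<in>S. d i \<noteq> 0" using c(1) by (auto simp: d_def)
    ultimately show ?thesis by blast
  qed
qed

text \<open>The residue classes of \<open>b 0, \<dots>, b (M - 1)\<close> modulo \<open>I\<close> are linearly independent over \<open>K\<close>.\<close>

definition indep_mod :: "('v::finite, 'k::field) mpoly set \<Rightarrow> nat \<Rightarrow> (nat \<Rightarrow> ('v, 'k) mpoly) \<Rightarrow> bool" where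
  "indep_mod I M b \<longleftrightarrow> (\<forall>c. (\<Sum>i<M. const (c i) * b i) \<in> I \<longrightarrow> (\<forall>i<M. c i = 0))"

definition exps_le :: "nat \<Rightarrow> ('v::finite, 'k::field) mpoly \<Rightarrow> bool" where
  "exps_le T f \<longleftrightarrow> (\<forall>u\<in>keys f. \<forall>v. lookup u v \<le> T)"

lemma exps_le_mono: "exps_le T f \<Longrightarrow> T \<le> T' \<Longrightarrow> exps_le T' f"
  unfolding exps_le_def by (meson le_trans)

lemma exps_le_mult:
  assumes "exps_le S f" "exps_le T g" shows "exps_le (S + T) (f * g)"
  unfolding exps_le_def
proof (intro ballI allI)
  fix u v assume "u \<in> keys (f * g)"
  then obtain s t where "s \<in> keys f" "t \<in> keys g" "u = s + t"
    using keys_mult by blast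
  then show "lookup u v \<le> S + T"
    using assms by (auto simp: exps_le_def lookup_add add_mono)
qed

lemma exps_le_1: "exps_le 0 1"
  by (simp add: exps_le_def)

lemma exps_le_power: "exps_le T f \<Longrightarrow> exps_le (n * T) (f ^ n)"
  by (induction n) (auto simp: exps_le_1 exps_le_mult)

lemma exps_le_exists: "\<exists>T. exps_le T f"
proof -
  define T where "T = (\<Sum>u\<in>keys f. \<Sum>v\<in>UNIV. lookup u v)"
  have "lookup u v \<le> T" if "u \<in> keys f" for u v
  proof -
    have "lookup u v \<le> (\<Sum>v\<in>UNIV. lookup u v)"
      by (rule member_le_sum) auto
    also have "\<dots> \<le> T" unfolding T_def using that
      by (intro member_le_sum[of u _ "\<lambda>u. \<Sum>v\<in>UNIV. lookup u v"]) auto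
    finally show ?thesis .
  qed
  then show ?thesis by (auto simp: exps_le_def)
qed

text \<open>Modulo \<open>J\<close> only the constant term in \<open>g\<close> survives, hence it is zero; then a factor \<open>g\<close> can be
  cancelled modulo \<open>I\<close>, and the argument repeats.\<close>

lemma powers_indep_aux:
  assumes I: "is_ideal I" and J: "is_ideal J" "I \<subseteq> J" and g: "g \<in> J"
    and nzd: "\<And>r. g * r \<in> I \<Longrightarrow> r \<in> I"
    and l: "\<And>j. j < N \<Longrightarrow> l j \<in> J \<Longrightarrow> l j = 0"
    and s: "(\<Sum>j<N. g ^ j * l j) \<in> I"
  shows "\<forall>j<N. l j = (0 :: ('v::finite, 'k::field) mpoly)"
  using l s
proof (induction N arbitrary: l)
  case (Suc N)
  let ?r = "\<Sum>j<N. g ^ j * l (Suc j)"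
  have *: "(\<Sum>j<Suc N. g ^ j * l j) = l 0 + g * ?r"
    by (simp only: sum.lessThan_Suc_shift) (simp add: sum_distrib_left mult.assoc)
  then have "l 0 + g * ?r \<in> J" using Suc.prems J by auto
  then have "l 0 + g * ?r - g * ?r \<in> J" using J(1) g by (intro ideal_diff ideal_mult2)
  then have 0: "l 0 = 0" using Suc.prems(1)[of 0] by simp
  then have "g * ?r \<in> I" using * Suc.prems(2) by simp
  then have "?r \<in> I" by (rule nzd)
  then have "\<forall>j<N. l (Suc j) = 0" using Suc.prems(1) by (intro Suc.IH) auto
  then show ?case using 0 by (auto simp: less_Suc_eq_0_disj)
qed simp

text \<open>One step down in a chain of ideals multiplies the size of an independent family by any
  chosen \<open>N\<close>, the new members being the products with \<open>g ^ 0, \<dots>, g ^ (N - 1)\<close>. The pairs of an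
  exponent and an old index are encoded by division with remainder by \<open>M\<close>.\<close>

lemma powers_indep:
  fixes b :: "nat \<Rightarrow> ('v::finite, 'k::field) mpoly"
  assumes I: "is_ideal I" and J: "is_ideal J" "I \<subseteq> J" and g: "g \<in> J"
    and nzd: "\<And>r. g * r \<in> I \<Longrightarrow> r \<in> I"
    and ind: "indep_mod J M b"
  shows "indep_mod I (N * M) (\<lambda>i. g ^ (i div M) * b (i mod M))"
  unfolding indep_mod_def
proof (intro allI impI)
  fix c i assume c: "(\<Sum>i<N * M. const (c i) * (g ^ (i div M) * b (i mod M))) \<in> I" and i: "i < N * M"
  then have M: "0 < M" by (cases M) auto
  define l where "l j = (\<Sum>i<M. const (c (j * M + i)) * b i)" for j
  have "(\<Sum>i<N * M. const (c i) * (g ^ (i div M) * b (i mod M))) =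
    (\<Sum>j<N. \<Sum>i\<in>{j*M..<j*M+M}. const (c i) * (g ^ (i div M) * b (i mod M)))"
    by (rule sum.nat_group[symmetric])
  also have "\<dots> = (\<Sum>j<N. g ^ j * l j)"
  proof (rule sum.cong[OF refl])
    fix j
    have "(\<Sum>i\<in>{j*M..<j*M+M}. const (c i) * (g ^ (i div M) * b (i mod M))) =
       (\<Sum>i<M. const (c (j*M+i)) * (g ^ ((j*M+i) div M) * b ((j*M+i) mod M)))"
      by (rule sum.reindex_bij_witness[of _ "\<lambda>i. j*M+i" "\<lambda>i. i - j*M"]) auto
    also have "\<dots> = g ^ j * l j"
      unfolding l_def sum_distrib_left by (rule sum.cong) (auto simp: algebra_simps)
    finally show "(\<Sum>i\<in>{j*M..<j*M+M}. const (c i) * (g ^ (i div M) * b (i mod M))) = g ^ j * l j" .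
  qed
  finally have "(\<Sum>j<N. g ^ j * l j) \<in> I" using c by simp
  moreover have "l j = 0" if "l j \<in> J" for j
  proof -
    have "\<forall>i<M. c (j * M + i) = 0"
      using that unfolding l_def by (rule mp[OF spec[OF ind[unfolded indep_mod_def]]])
    then show ?thesis by (simp add: l_def)
  qed
  ultimately have "\<forall>j<N. l j = 0"
    using powers_indep_aux[OF I J g nzd] by blast
  then have "l (i div M) = 0" using i M by (simp add: less_mult_imp_div_less)
  then have "(\<Sum>k<M. const (c (i div M * M + k)) * b k) \<in> J"
    using ideal_zero[OF J(1)] unfolding l_def by simp
  then have "\<forall>k<M. c (i div M * M + k) = 0"
    by (rule mp[OF spec[OF ind[unfolded indep_mod_def]]])
  then have "c (i div M * M + i mod M) = 0" using mod_less_divisor[OF M] by blast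
  then show "c i = 0" by (simp only: div_mult_mod_eq)
qed

text \<open>Iterating the previous lemma from the single element \<open>1\<close>, which is independent modulo a proper
  ideal. The bound on the exponents grows only linearly in \<open>N\<close>, while the size of the family
  is \<open>N ^ k\<close>.\<close>

lemma chain_indep:
  fixes I :: "nat \<Rightarrow> ('v::finite, 'k::field) mpoly set"
  assumes "\<And>i. i \<le> k \<Longrightarrow> is_ideal (I i)" "\<And>i. i < k \<Longrightarrow> I i \<subseteq> I (Suc i)" "1 \<notin> I k"
    and "\<And>i. i < k \<Longrightarrow> g i \<in> I (Suc i)"
    and "\<And>i r. i < k \<Longrightarrow> g i * r \<in> I i \<Longrightarrow> r \<in> I i"
    and "\<And>i. i < k \<Longrightarrow> exps_le D (g i)"
  shows "\<exists>b. indep_mod (I 0) (N ^ k) b \<and> (\<forall>i<N^k. exps_le (k * (N * D)) (b i))"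
  using assms
proof (induction k arbitrary: I g)
  case 0
  have "c = 0" if "const c \<in> I 0" for c
  proof (rule ccontr)
    assume "c \<noteq> 0"
    have "const (inverse c) * const c \<in> I 0" using that "0.prems"(1)[of 0] by (intro ideal_mult) simp_all
    moreover have "const (inverse c) * const c = (1 :: ('v, 'k) mpoly)"
      using \<open>c \<noteq> 0\<close> by (simp add: mult_single)
    ultimately show False using "0.prems"(3) by simp
  qed
  then have "indep_mod (I 0) (N ^ 0) (\<lambda>_. 1)" by (simp add: indep_mod_def)
  then show ?case by (intro exI[of _ "\<lambda>_. 1"]) (simp add: exps_le_1)
next
  case (Suc k)
  have "\<exists>b. indep_mod (I (Suc 0)) (N ^ k) b \<and> (\<forall>i<N^k. exps_le (k * (N * D)) (b i))"
  proof (rule Suc.IH[of "\<lambda>i. I (Suc i)" "\<lambda>i. g (Suc i)"])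
    show "1 \<notin> I (Suc k)" by (rule Suc.prems(3))
  qed (use Suc.prems(1,2,4-6) in \<open>simp_all\<close>)
  then obtain b where b: "indep_mod (I (Suc 0)) (N ^ k) b" "\<forall>i<N^k. exps_le (k * (N * D)) (b i)"
    by blast
  let ?M = "N ^ k" and ?b = "\<lambda>i. g 0 ^ (i div N^k) * b (i mod N^k)"
  have "indep_mod (I 0) (N * ?M) ?b"
    by (rule powers_indep[OF _ _ _ _ _ b(1)]) (use Suc.prems(1,2,4,5) in auto)
  moreover have "exps_le (Suc k * (N * D)) (?b i)" if i: "i < N * ?M" for i
  proof -
    from i have M: "0 < ?M" by (cases ?M) auto
    have "exps_le ((i div ?M) * D) (g 0 ^ (i div ?M))" using Suc.prems(6) by (intro exps_le_power) auto
    moreover have "i div ?M < N" using i by (simp add: less_mult_imp_div_less)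
    ultimately have "exps_le (N * D) (g 0 ^ (i div ?M))"
      by (elim exps_le_mono) (simp add: mult_le_mono1)
    moreover have "exps_le (k * (N * D)) (b (i mod ?M))" using b(2) M by simp
    ultimately have "exps_le (N * D + k * (N * D)) (?b i)" by (rule exps_le_mult)
    then show ?thesis by simp
  qed
  ultimately show ?case by (intro exI[of _ ?b]) simp
qed

lemma card_monomials_le:
  fixes \<Delta> :: "'v::finite set set" and T :: nat
  assumes \<Delta>: "\<And>U. U \<in> \<Delta> \<Longrightarrow> card U \<le> d"
  defines "E \<equiv> {u :: 'v \<Rightarrow>\<^sub>0 nat. (\<exists>U\<in>\<Delta>. keys u \<subseteq> U) \<and> (\<forall>v. lookup u v \<le> T)}"
  shows "finite E" "card E \<le> card \<Delta> * (T + 1) ^ d"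
proof -
  define E' where "E' U = {u :: 'v \<Rightarrow>\<^sub>0 nat. keys u \<subseteq> U \<and> (\<forall>v. lookup u v \<le> T)}" for U
  have fc: "finite (E' U) \<and> card (E' U) \<le> (T + 1) ^ card U" for U
  proof -
    let ?r = "\<lambda>u :: 'v \<Rightarrow>\<^sub>0 nat. restrict (lookup u) U"
    have inj: "inj_on ?r (E' U)"
    proof (rule inj_onI)
      fix u w assume uw: "u \<in> E' U" "w \<in> E' U" "?r u = ?r w"
      show "u = w"
      proof (rule poly_mapping_eqI)
        fix v show "lookup u v = lookup w v"
        proof (cases "v \<in> U")
          case True
          then show ?thesis using fun_cong[OF uw(3), of v] by simp
        next
          case False
          then have "v \<notin> keys u" "v \<notin> keys w"
            using uw by (auto simp: E'_def)
          then show ?thesis by (simp add: in_keys_iff)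
        qed
      qed
    qed
    have img: "?r ` E' U \<subseteq> PiE U (\<lambda>_. {..T})" by (auto simp: E'_def)
    have fin: "finite (PiE U (\<lambda>_. {..T}))" by (intro finite_PiE) auto
    have "card (E' U) \<le> card (PiE U (\<lambda>_. {..T}))" by (rule card_inj_on_le[OF inj img fin])
    moreover have "finite (E' U)" using inj img fin by (meson finite_imageD finite_subset)
    ultimately show ?thesis by (simp add: card_PiE)
  qed
  have E: "E = (\<Union>U\<in>\<Delta>. E' U)" by (auto simp: E_def E'_def)
  then show "finite E" using fc by auto
  have "card E \<le> (\<Sum>U\<in>\<Delta>. card (E' U))" unfolding E by (rule card_UN_le) simp
  also have "\<dots> \<le> (\<Sum>U\<in>\<Delta>. (T + 1) ^ d)"
  proof (rule sum_mono)
    fix U assume "U \<in> \<Delta>"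
    then have "(T + 1) ^ card U \<le> (T + 1) ^ d" using \<Delta> by (intro power_increasing) auto
    then show "card (E' U) \<le> (T + 1) ^ d" using fc order_trans by blast
  qed
  finally show "card E \<le> card \<Delta> * (T + 1) ^ d" by simp
qed

text \<open>Only the monomials supported on some \<open>U \<in> \<Delta>\<close> matter modulo \<open>I\<close>. A family with more members
  than there are such monomials has a nontrivial combination in which all of them cancel.\<close>

lemma indep_mod_card_le:
  fixes I :: "('v::finite, 'k::field) mpoly set"
  assumes I: "is_ideal I"
    and nonface: "\<And>u. (\<forall>U\<in>\<Delta>. \<not> keys u \<subseteq> U) \<Longrightarrow> mon u \<in> I"
    and \<Delta>: "\<And>U. U \<in> \<Delta> \<Longrightarrow> card U \<le> d"
    and b: "indep_mod I M b" "\<And>i. i < M \<Longrightarrow> exps_le T (b i)"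
  shows "M \<le> card \<Delta> * (T + 1) ^ d"
proof (rule ccontr)
  assume big: "\<not> M \<le> card \<Delta> * (T + 1) ^ d"
  define E where "E = {u :: 'v \<Rightarrow>\<^sub>0 nat. (\<exists>U\<in>\<Delta>. keys u \<subseteq> U) \<and> (\<forall>v. lookup u v \<le> T)}"
  note cm = card_monomials_le[of \<Delta> d T, OF \<Delta>, folded E_def]
  have "finite E" by (rule cm(1))
  moreover have "card E < card {..<M}"
    using cm(2) big by simp
  ultimately have "\<exists>c. (\<exists>i\<in>{..<M}. c i \<noteq> 0) \<and> (\<forall>u\<in>E. (\<Sum>i<M. c i * lookup (b i) u) = 0)"
    by (intro underdetermined_system) simp_all
  then obtain c where c: "\<exists>i\<in>{..<M}. c i \<noteq> 0"
    "\<forall>u\<in>E. (\<Sum>i<M. c i * lookup (b i) u) = 0"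
    by (elim exE conjE)
  let ?s = "\<Sum>i<M. const (c i) * b i"
  have "?s \<in> supported {u. \<forall>U\<in>\<Delta>. \<not> keys u \<subseteq> U}"
  proof (rule supportedI, rule CollectI, intro ballI notI)
    fix u U assume u: "u \<in> keys ?s" "U \<in> \<Delta>" "keys u \<subseteq> U"
    have ne: "(\<Sum>i<M. c i * lookup (b i) u) \<noteq> 0"
      using u(1) by (simp add: in_keys_iff lookup_sum)
    obtain i where i: "i < M" "c i * lookup (b i) u \<noteq> 0"
      using sum.not_neutral_contains_not_neutral[OF ne] by auto
    then have "u \<in> keys (b i)" by (simp add: in_keys_iff)
    then have "\<forall>v. lookup u v \<le> T" using b(2)[OF i(1)] unfolding exps_le_def by blast
    then have "u \<in> E" using u by (auto simp: E_def)
    then show False using c(2) ne by simp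
  qed
  moreover have "supported {u. \<forall>U\<in>\<Delta>. \<not> keys u \<subseteq> U} \<subseteq> I"
    by (rule supported_subset_ideal[OF I]) (rule nonface, simp)
  ultimately have "?s \<in> I" by (rule rev_subsetD)
  then have "\<forall>i<M. c i = 0" by (rule mp[OF spec[OF b(1)[unfolded indep_mod_def]]])
  then show False using c(1) by simp
qed

text \<open>If \<open>I 0\<close> contains the Stanley-Reisner ideal of a complex \<open>\<Delta>\<close> with facets of at most \<open>d\<close> elements,
  the number of monomials modulo \<open>I 0\<close> with exponents up to \<open>T\<close> grows like \<open>T ^ d\<close>. A chain of
  length \<open>k\<close> produces \<open>N ^ k\<close> independent elements with exponents linear in \<open>N\<close>, whence \<open>k \<le> d\<close>.\<close>

theorem chain_length_le:
  fixes I :: "nat \<Rightarrow> ('v::finite, 'k::field) mpoly set"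
  assumes I: "\<And>i. i \<le> k \<Longrightarrow> is_ideal (I i)" "\<And>i. i < k \<Longrightarrow> I i \<subseteq> I (Suc i)" "1 \<notin> I k"
    and g: "\<And>i. i < k \<Longrightarrow> g i \<in> I (Suc i)" "\<And>i r. i < k \<Longrightarrow> g i * r \<in> I i \<Longrightarrow> r \<in> I i"
    and nonface: "\<And>u. (\<forall>U\<in>\<Delta>. \<not> keys u \<subseteq> U) \<Longrightarrow> mon u \<in> I 0"
    and \<Delta>: "\<And>U. U \<in> \<Delta> \<Longrightarrow> card U \<le> d"
  shows "k \<le> d"
proof (rule ccontr)
  assume "\<not> k \<le> d"
  have "\<exists>t. \<forall>i. exps_le (t i) (g i)" by (rule choice) (simp add: exps_le_exists)
  then obtain t where t: "\<And>i. exps_le (t i) (g i)" by blast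
  define D where "D = (\<Sum>i<k. t i)"
  have D: "exps_le D (g i)" if "i < k" for i
    using that by (intro exps_le_mono[OF t]) (auto simp: D_def intro: member_le_sum)
  \<comment> \<open>For \<open>N = C + 1\<close> the inequality \<open>N ^ k \<le> C * N ^ d\<close> of the two counts fails if \<open>k > d\<close>.\<close>
  define C where "C = card \<Delta> * (k * D + 1) ^ d"
  define N where "N = C + 1"
  obtain b where "indep_mod (I 0) (N ^ k) b" "\<forall>i<N^k. exps_le (k * (N * D)) (b i)"
    using chain_indep[OF I g D] by blast
  then have "N ^ k \<le> card \<Delta> * (k * (N * D) + 1) ^ d"
    using indep_mod_card_le[OF I(1) nonface \<Delta>] by blast
  also have "\<dots> \<le> card \<Delta> * (N * (k * D + 1)) ^ d"
    by (intro mult_le_mono2 power_mono) (simp_all add: N_def algebra_simps)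
  also have "\<dots> = C * N ^ d" by (simp only: C_def power_mult_distrib mult.assoc mult.commute[of "N ^ d"])
  also have "\<dots> < N ^ Suc d" by (simp add: N_def)
  also have "\<dots> \<le> N ^ k" using \<open>\<not> k \<le> d\<close> by (intro power_increasing) (auto simp: N_def)
  finally show False by simp
qed

section \<open>Subquotients of the polynomial ring\<close>

text \<open>The module \<open>M\<close> is the subquotient \<open>A / B\<close> of the ring, \<open>\<rho> a\<close> being the class of \<open>a\<close>. All modules
  in a filtration of \<open>R / J\<close> are of this form, which replaces computations with cosets of cosets
  by computations with ideals.\<close>

definition presents :: "('a::comm_ring_1, 'm) module \<Rightarrow> 'a set \<Rightarrow> 'a set \<Rightarrow> ('a \<Rightarrow> 'm) \<Rightarrow> bool" where
  "presents M A B \<rho> \<longleftrightarrow>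
    is_ideal A \<and> is_ideal B \<and> B \<subseteq> A \<and> carrier M = \<rho> ` A \<and> \<zero>\<^bsub>M\<^esub> = \<rho> 0 \<and>
    (\<forall>a\<in>A. \<forall>b\<in>A. \<rho> a \<oplus>\<^bsub>M\<^esub> \<rho> b = \<rho> (a + b)) \<and>
    (\<forall>r. \<forall>a\<in>A. r \<odot>\<^bsub>M\<^esub> \<rho> a = \<rho> (r * a)) \<and>
    (\<forall>a\<in>A. \<forall>b\<in>A. \<rho> a = \<rho> b \<longleftrightarrow> a - b \<in> B)"

lemma presentsD:
  assumes "presents M A B \<rho>"
  shows "is_ideal A" "is_ideal B" "B \<subseteq> A" "carrier M = \<rho> ` A" "\<zero>\<^bsub>M\<^esub> = \<rho> 0"
    "\<And>a b. a \<in> A \<Longrightarrow> b \<in> A \<Longrightarrow> \<rho> a \<oplus>\<^bsub>M\<^esub> \<rho> b = \<rho> (a + b)"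
    "\<And>r a. a \<in> A \<Longrightarrow> r \<odot>\<^bsub>M\<^esub> \<rho> a = \<rho> (r * a)"
    "\<And>a b. a \<in> A \<Longrightarrow> b \<in> A \<Longrightarrow> \<rho> a = \<rho> b \<longleftrightarrow> a - b \<in> B"
  using assms by (auto simp: presents_def)

lemma presents_regular_module:
  "presents (regular_module ring_of_type_algebra) (UNIV :: 'a::comm_ring_1 set) {0} id"
  by (simp add: presents_def regular_module_def ideal_UNIV ideal_zero_ideal)

lemma presents_restrict:
  assumes "presents M A B \<rho>" "is_ideal A'" "B \<subseteq> A'" "A' \<subseteq> A"
  shows "presents (M\<lparr>carrier := \<rho> ` A'\<rparr>) A' B \<rho>"
  using presentsD[OF assms(1)] assms(2-) by (auto simp: presents_def subset_iff)

lemma set_add_image: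
  fixes M :: "('a::comm_ring_1, 'm) module" and \<rho> :: "'a \<Rightarrow> 'm"
  assumes "presents M A B \<rho>" "S \<subseteq> A" "T \<subseteq> A"
  shows "(\<rho> ` S) <+>\<^bsub>M\<^esub> (\<rho> ` T) = \<rho> ` {x + y | x y. x \<in> S \<and> y \<in> T}"
  unfolding set_add_def set_mult_def
  using presentsD(6)[OF assms(1)] assms(2,3) by (auto 0 4 simp: subset_iff)

lemma coset_image:
  fixes M :: "('a::comm_ring_1, 'm) module" and \<rho> :: "'a \<Rightarrow> 'm"
  assumes P: "presents M A B \<rho>" and I: "is_ideal I" "I \<subseteq> A" and f: "f \<in> A"
  shows "(\<rho> ` I) +>\<^bsub>M\<^esub> (\<rho> f) = \<rho> ` {g \<in> A. g - f \<in> I}"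
proof -
  have "(\<rho> ` I) +>\<^bsub>M\<^esub> (\<rho> f) = (\<Union>h\<in>I. {\<rho> h \<oplus>\<^bsub>M\<^esub> \<rho> f})"
    by (auto simp: a_r_coset_def r_coset_def)
  also have "\<dots> = \<rho> ` ((\<lambda>h. h + f) ` I)" using presentsD(6)[OF P] I(2) f by (auto simp: subset_iff image_iff)
  also have "(\<lambda>h. h + f) ` I = {g \<in> A. g - f \<in> I}"
    using I f ideal_add[OF presentsD(1)[OF P]] by (auto simp: image_iff) (metis diff_add_cancel)
  finally show ?thesis .
qed

lemma presents_quotient:
  fixes M :: "('a::comm_ring_1, 'm) module" and \<rho> :: "'a \<Rightarrow> 'm"
  assumes P: "presents M A B \<rho>" and I: "is_ideal I" "B \<subseteq> I" "I \<subseteq> A"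
  shows "presents (M QuotM (\<rho> ` I)) A I (\<lambda>f. \<rho> ` {g \<in> A. g - f \<in> I})" (is "presents _ _ _ ?\<rho>")
proof -
  note p = presentsD[OF P]
  have "carrier (M QuotM (\<rho> ` I)) = ?\<rho> ` A"
    by (auto simp: quotient_module_def A_RCOSETS_def' p(4) coset_image[OF P I(1,3)])
  moreover have "\<zero>\<^bsub>M QuotM (\<rho> ` I)\<^esub> = ?\<rho> 0"
    using I by (auto simp: quotient_module_def intro!: arg_cong[of _ _ "image \<rho>"])
  moreover have "?\<rho> a \<oplus>\<^bsub>M QuotM (\<rho> ` I)\<^esub> ?\<rho> b = ?\<rho> (a + b)" if "a \<in> A" "b \<in> A" for a b
  proof -
    have "?\<rho> a \<oplus>\<^bsub>M QuotM (\<rho> ` I)\<^esub> ?\<rho> b = \<rho> ` {x + y | x y. x \<in> {g \<in> A. g - a \<in> I} \<and> y \<in> {g \<in> A. g - b \<in> I}}"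
      unfolding quotient_module_def using set_add_image[OF P] by simp
    also have "{x + y | x y. x \<in> {g \<in> A. g - a \<in> I} \<and> y \<in> {g \<in> A. g - b \<in> I}} = {g \<in> A. g - (a + b) \<in> I}"
    proof (intro equalityI subsetI)
      fix g assume "g \<in> {x + y | x y. x \<in> {g \<in> A. g - a \<in> I} \<and> y \<in> {g \<in> A. g - b \<in> I}}"
      then obtain x y where "g = x + y" "x \<in> A" "y \<in> A" "x - a \<in> I" "y - b \<in> I" by auto
      moreover from this have "(x - a) + (y - b) \<in> I" using ideal_add[OF I(1)] by blast
      ultimately show "g \<in> {g \<in> A. g - (a + b) \<in> I}"
        using ideal_add[OF p(1)] by (auto simp: algebra_simps)
    next
      fix g assume g: "g \<in> {g \<in> A. g - (a + b) \<in> I}"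
      then have "g - b \<in> A" "(g - b) - a \<in> I" "b - b \<in> I"
        using that ideal_diff[OF p(1)] ideal_zero[OF I(1)] by (auto simp: algebra_simps)
      then show "g \<in> {x + y | x y. x \<in> {g \<in> A. g - a \<in> I} \<and> y \<in> {g \<in> A. g - b \<in> I}}"
        using that by (intro CollectI exI[of _ "g - b"] exI[of _ b]) auto
    qed
    finally show ?thesis .
  qed
  moreover have "r \<odot>\<^bsub>M QuotM (\<rho> ` I)\<^esub> ?\<rho> a = ?\<rho> (r * a)" if a: "a \<in> A" for r a
  proof -
    have "(\<lambda>x. r \<odot>\<^bsub>M\<^esub> x) ` ?\<rho> a = \<rho> ` ((*) r ` {g \<in> A. g - a \<in> I})"
      unfolding image_image by (rule image_cong) (simp_all add: p(7))
    then have "r \<odot>\<^bsub>M QuotM (\<rho> ` I)\<^esub> ?\<rho> a = (\<rho> ` ((*) r ` {g \<in> A. g - a \<in> I})) <+>\<^bsub>M\<^esub> (\<rho> ` I)"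
      by (simp add: quotient_module_def)
    also have "\<dots> = \<rho> ` {x + y | x y. x \<in> (*) r ` {g \<in> A. g - a \<in> I} \<and> y \<in> I}"
      using ideal_mult[OF p(1)] I by (intro set_add_image[OF P]) auto
    also have "{x + y | x y. x \<in> (*) r ` {g \<in> A. g - a \<in> I} \<and> y \<in> I} = {g \<in> A. g - r * a \<in> I}"
    proof (intro equalityI subsetI)
      fix g assume "g \<in> {x + y | x y. x \<in> (*) r ` {g \<in> A. g - a \<in> I} \<and> y \<in> I}"
      then obtain x y where xy: "g = r * x + y" "x \<in> A" "x - a \<in> I" "y \<in> I" by auto
      then have "r * (x - a) + y \<in> I" using ideal_add[OF I(1)] ideal_mult[OF I(1)] by blast
      moreover have "r * x + y \<in> A" using xy I ideal_add[OF p(1)] ideal_mult[OF p(1)] by blast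
      ultimately show "g \<in> {g \<in> A. g - r * a \<in> I}" using xy(1) by (auto simp: algebra_simps)
    next
      fix g assume g: "g \<in> {g \<in> A. g - r * a \<in> I}"
      then show "g \<in> {x + y | x y. x \<in> (*) r ` {g \<in> A. g - a \<in> I} \<and> y \<in> I}"
        using a ideal_zero[OF I(1)] by (intro CollectI exI[of _ "r * a"] exI[of _ "g - r * a"]) auto
    qed
    finally show ?thesis .
  qed
  moreover have "?\<rho> a = ?\<rho> b \<longleftrightarrow> a - b \<in> I" if ab: "a \<in> A" "b \<in> A" for a b
  proof
    assume "?\<rho> a = ?\<rho> b"
    moreover have "\<rho> a \<in> ?\<rho> a" using ab ideal_zero[OF I(1)] by auto
    ultimately obtain g where g: "g \<in> A" "g - b \<in> I" "\<rho> a = \<rho> g" by auto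
    then have "a - g \<in> I" using p(8) ab I by auto
    then have "(a - g) + (g - b) \<in> I" using g ideal_add[OF I(1)] by blast
    then show "a - b \<in> I" by simp
  next
    assume d: "a - b \<in> I"
    have "g - a \<in> I \<longleftrightarrow> g - b \<in> I" for g
      using ideal_add[OF I(1) _ d, of "g - a"] ideal_diff[OF I(1) _ d, of "g - b"] by auto
    then show "?\<rho> a = ?\<rho> b" by simp
  qed
  ultimately show ?thesis using p(1) I by (simp add: presents_def)
qed

text \<open>The colon ideal \<open>B : A\<close>, which is the annihilator of \<open>A / B\<close>.\<close>

definition ann :: "'a::comm_ring_1 set \<Rightarrow> 'a set \<Rightarrow> 'a set" where
  "ann A B = {r. \<forall>a\<in>A. r * a \<in> B}"

text \<open>The ideal \<open>(f\<^sub>1, \<dots>, f\<^sub>k) A + B\<close>, the preimage in \<open>A\<close> of the submodule \<open>(f\<^sub>1, \<dots>, f\<^sub>k) (A / B)\<close>.\<close>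

primrec rmult :: "'a::comm_ring_1 set \<Rightarrow> 'a set \<Rightarrow> 'a list \<Rightarrow> 'a set" where
  "rmult A B [] = B"
| "rmult A B (f # fs) = {f * a + b | a b. a \<in> A \<and> b \<in> rmult A B fs}"

definition rel_regular :: "'a::comm_ring_1 set \<Rightarrow> 'a set \<Rightarrow> 'a list \<Rightarrow> bool" where
  "rel_regular A B fs \<longleftrightarrow>
    (\<forall>i<length fs. \<forall>a\<in>A. fs ! i * a \<in> rmult A B (take i fs) \<longrightarrow> a \<in> rmult A B (take i fs)) \<and>
    rmult A B fs \<noteq> A"

definition quot_depth :: "('v::finite, 'k::field) mpoly set \<Rightarrow> ('v, 'k) mpoly set \<Rightarrow> enat" where
  "quot_depth A B =
    Sup {enat (length fs) | fs. (\<forall>f\<in>set fs. \<exists>d>0. f \<in> homogeneous d) \<and> rel_regular A B fs}"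

definition quot_dim :: "('v::finite, 'k::field) mpoly set \<Rightarrow> ('v, 'k) mpoly set \<Rightarrow> enat" where
  "quot_dim A B = chain_length_sup {Q. primeideal Q mpoly_ring \<and> ann A B \<subseteq> Q}"

lemma rmult_ideal:
  assumes A: "is_ideal A" and B: "is_ideal B" "B \<subseteq> A"
  shows "is_ideal (rmult A B fs)" "B \<subseteq> rmult A B fs" "rmult A B fs \<subseteq> A"
proof (induction fs)
  case (Cons f fs)
  {
    case 1
    show ?case
    proof (rule is_idealI)
      show "0 \<in> rmult A B (f # fs)"
        using ideal_zero[OF A] ideal_zero[OF Cons(1)] by force
    next
      fix x y assume "x \<in> rmult A B (f # fs)" "y \<in> rmult A B (f # fs)"
      then obtain a b a' b' where *: "a \<in> A" "b \<in> rmult A B fs" "a' \<in> A" "b' \<in> rmult A B fs"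
        "x = f * a + b" "y = f * a' + b'" by auto
      then have "x + y = f * (a + a') + (b + b')" by (simp add: algebra_simps)
      moreover have "a + a' \<in> A" "b + b' \<in> rmult A B fs"
        using * ideal_add[OF A] ideal_add[OF Cons(1)] by auto
      ultimately show "x + y \<in> rmult A B (f # fs)" unfolding rmult.simps by blast
    next
      fix r x assume "x \<in> rmult A B (f # fs)"
      then obtain a b where *: "a \<in> A" "b \<in> rmult A B fs" "x = f * a + b" by auto
      then have "r * x = f * (r * a) + r * b" by (simp add: algebra_simps)
      moreover have "r * a \<in> A" "r * b \<in> rmult A B fs"
        using * ideal_mult[OF A] ideal_mult[OF Cons(1)] by auto
      ultimately show "r * x \<in> rmult A B (f # fs)" unfolding rmult.simps by blast
    qed
  next
    case 2
    show ?case
    proof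
      fix b assume "b \<in> B"
      then have "b = f * 0 + b" "0 \<in> A" "b \<in> rmult A B fs"
        using Cons(2) ideal_zero[OF A] by auto
      then show "b \<in> rmult A B (f # fs)" unfolding rmult.simps by blast
    qed
  next
    case 3
    show ?case using Cons(3) ideal_add[OF A] ideal_mult[OF A] by auto
  }
qed (use assms in auto)

context
  fixes M :: "('a::comm_ring_1, 'm) module" and A B :: "'a set" and \<rho> :: "'a \<Rightarrow> 'm"
  assumes P: "presents M A B \<rho>"
begin

lemma presents_mem_iff:
  assumes "is_ideal S" "B \<subseteq> S" "S \<subseteq> A" "a \<in> A"
  shows "\<rho> a \<in> \<rho> ` S \<longleftrightarrow> a \<in> S"
proof
  assume "\<rho> a \<in> \<rho> ` S"
  then obtain s where s: "s \<in> S" "\<rho> a = \<rho> s" by auto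
  then have "a - s \<in> S" using presentsD(8)[OF P] assms by auto
  then have "(a - s) + s \<in> S" using s(1) assms(1) ideal_add by blast
  then show "a \<in> S" by simp
qed simp

lemma presents_annihilator: "annihilator ring_of_type_algebra M = ann A B"
proof -
  note p = presentsD[OF P]
  have "r \<odot>\<^bsub>M\<^esub> \<rho> a = \<zero>\<^bsub>M\<^esub> \<longleftrightarrow> r * a \<in> B" if "a \<in> A" for r a
  proof -
    have "r * a \<in> A" "0 \<in> A" by (rule ideal_mult[OF p(1) that], rule ideal_zero[OF p(1)])
    then show ?thesis using p(7)[OF that] p(8)[of "r * a" 0] p(5) by simp
  qed
  then show ?thesis using p(4) by (auto simp: annihilator_def ann_def)
qed

lemma presents_multiples: "multiples M fs = \<rho> ` rmult A B fs"
proof (induction fs)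
  note p = presentsD[OF P]
  case Nil
  have "\<rho> b = \<rho> 0" if "b \<in> B" for b
    using p(8)[OF subsetD[OF p(3) that] ideal_zero[OF p(1)]] that by simp
  then have "\<rho> ` B = {\<rho> 0}" using ideal_zero[OF p(2)] by blast
  then show ?case by (simp add: p(5))
next
  note p = presentsD[OF P]
  case (Cons f fs)
  have "(\<lambda>x. f \<odot>\<^bsub>M\<^esub> x) ` carrier M = \<rho> ` ((*) f ` A)"
    unfolding p(4) image_image by (rule image_cong) (simp_all add: p(7))
  then have "multiples M (f # fs) = (\<rho> ` ((*) f ` A)) <+>\<^bsub>M\<^esub> (\<rho> ` rmult A B fs)" using Cons by simp
  also have "\<dots> = \<rho> ` {x + y | x y. x \<in> (*) f ` A \<and> y \<in> rmult A B fs}"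
    using rmult_ideal(3)[OF p(1-3)] ideal_mult[OF p(1)] by (intro set_add_image[OF P]) auto
  also have "{x + y | x y. x \<in> (*) f ` A \<and> y \<in> rmult A B fs} = rmult A B (f # fs)"
    unfolding rmult.simps by (rule Collect_cong) blast
  finally show ?case .
qed

lemma presents_regular_sequence: "regular_sequence M fs \<longleftrightarrow> rel_regular A B fs"
proof -
  note p = presentsD[OF P]
  note r = rmult_ideal[OF p(1-3)]
  have "f \<odot>\<^bsub>M\<^esub> \<rho> a \<in> multiples M gs \<longleftrightarrow> f * a \<in> rmult A B gs"
    "\<rho> a \<in> multiples M gs \<longleftrightarrow> a \<in> rmult A B gs" if "a \<in> A" for f a gs
    using that p(7) ideal_mult[OF p(1)] by (simp_all add: presents_multiples presents_mem_iff r)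
  moreover have "multiples M fs = carrier M \<longleftrightarrow> rmult A B fs = A"
    unfolding presents_multiples p(4) using presents_mem_iff[OF r] r(3) by blast
  ultimately show ?thesis
    by (auto simp: regular_sequence_def rel_regular_def p(4))
qed

lemma presents_abelian_group: "abelian_group M"
proof -
  note p = presentsD[OF P]
  show ?thesis
  proof (rule abelian_groupI)
    fix x assume "x \<in> carrier M"
    then obtain a where "x = \<rho> a" "a \<in> A" using p(4) by auto
    then show "\<exists>y\<in>carrier M. y \<oplus>\<^bsub>M\<^esub> x = \<zero>\<^bsub>M\<^esub>"
      using p(4,5,6) ideal_minus[OF p(1)] by (auto intro!: bexI[of _ "- a"])
  qed (use p(4-6) ideal_zero[OF p(1)] ideal_add[OF p(1)] in \<open>auto simp: algebra_simps\<close>)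
qed

lemma presents_finsum:
  assumes "finite D" "\<And>d. d \<in> D \<Longrightarrow> g d \<in> A"
  shows "finsum M (\<lambda>d. \<rho> (g d)) D = \<rho> (sum g D)"
  using assms
proof (induction D rule: finite_induct)
  case empty
  interpret abelian_group M by (rule presents_abelian_group)
  show ?case using presentsD(5)[OF P] by simp
next
  case (insert d D)
  interpret abelian_group M by (rule presents_abelian_group)
  note p = presentsD[OF P]
  have "finsum M (\<lambda>d. \<rho> (g d)) (insert d D) = \<rho> (g d) \<oplus>\<^bsub>M\<^esub> finsum M (\<lambda>d. \<rho> (g d)) D"
    using insert p(4) by (intro finsum_insert) auto
  also have "\<dots> = \<rho> (g d) \<oplus>\<^bsub>M\<^esub> \<rho> (sum g D)" using insert by simp
  also have "\<dots> = \<rho> (g d + sum g D)"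
    using insert ideal_sum[OF p(1), of D g] by (intro p(6)) auto
  finally show ?case using insert by simp
qed

lemma presents_submodule:
  assumes I: "is_ideal I" "I \<subseteq> A"
  shows "submodule (\<rho> ` I) ring_of_type_algebra M"
proof -
  note p = presentsD[OF P]
  interpret abelian_group M by (rule presents_abelian_group)
  have inv: "inv\<^bsub>add_monoid M\<^esub> (\<rho> a) = \<rho> (- a)" if "a \<in> I" for a
  proof -
    have "\<rho> (- a) \<oplus>\<^bsub>M\<^esub> \<rho> a = \<zero>\<^bsub>M\<^esub>" using that p(5,6) ideal_minus[OF p(1)] I by auto
    then have "\<ominus>\<^bsub>M\<^esub> \<rho> a = \<rho> (- a)"
      using that p(4) ideal_minus[OF p(1)] I by (intro minus_equality) auto
    then show ?thesis by (simp add: a_inv_def)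
  qed
  show ?thesis
  proof (intro submodule.intro subgroup.intro submodule_axioms.intro)
    show "\<rho> ` I \<subseteq> carrier (add_monoid M)" using p(4) I by auto
  next
    fix x y assume "x \<in> \<rho> ` I" "y \<in> \<rho> ` I"
    then show "x \<otimes>\<^bsub>add_monoid M\<^esub> y \<in> \<rho> ` I" using p(6) I ideal_add[OF I(1)] by (auto simp: subset_iff)
  next
    show "\<one>\<^bsub>add_monoid M\<^esub> \<in> \<rho> ` I" using p(5) ideal_zero[OF I(1)] by auto
  next
    fix x assume "x \<in> \<rho> ` I"
    then show "inv\<^bsub>add_monoid M\<^esub> x \<in> \<rho> ` I" using inv ideal_minus[OF I(1)] by auto
  next
    fix r x assume "x \<in> \<rho> ` I"
    then show "r \<odot>\<^bsub>M\<^esub> x \<in> \<rho> ` I" using p(7) I ideal_mult[OF I(1)] by (auto simp: subset_iff)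
  qed
qed

lemma submodule_preimage:
  assumes N: "submodule N ring_of_type_algebra M"
  defines "I \<equiv> {a \<in> A. \<rho> a \<in> N}"
  shows "is_ideal I" "B \<subseteq> I" "\<rho> ` I = N"
proof -
  note p = presentsD[OF P]
  interpret submodule N ring_of_type_algebra M by fact
  have N': "N \<subseteq> carrier M" "\<zero>\<^bsub>M\<^esub> \<in> N" "\<And>x y. x \<in> N \<Longrightarrow> y \<in> N \<Longrightarrow> x \<oplus>\<^bsub>M\<^esub> y \<in> N"
    "\<And>r x. x \<in> N \<Longrightarrow> r \<odot>\<^bsub>M\<^esub> x \<in> N"
    using subset one_closed m_closed smult_closed by auto
  show "is_ideal I"
  proof (rule is_idealI)
    show "0 \<in> I" using N'(2) p(5) ideal_zero[OF p(1)] by (simp add: I_def)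
    show "a + b \<in> I" if "a \<in> I" "b \<in> I" for a b
      using that N'(3)[of "\<rho> a" "\<rho> b"] p(6) ideal_add[OF p(1)] by (simp add: I_def)
    show "r * a \<in> I" if "a \<in> I" for r a
      using that N'(4)[of "\<rho> a" r] p(7) ideal_mult[OF p(1)] by (simp add: I_def)
  qed
  show "B \<subseteq> I"
  proof
    fix b assume b: "b \<in> B"
    then have "\<rho> b = \<rho> 0" using p(3,8) ideal_zero[OF p(1)] by auto
    then show "b \<in> I" using b N'(2) p(3,5) by (auto simp: I_def)
  qed
  show "\<rho> ` I = N" using N'(1) p(4) by (auto simp: I_def)
qed

end

lemma presents_depth:
  "presents M A B \<rho> \<Longrightarrow> depth M = quot_depth A B"
  by (simp add: depth_def quot_depth_def presents_regular_sequence)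

lemma presents_dim:
  "presents M A B \<rho> \<Longrightarrow> module_dim mpoly_ring M = quot_dim A B"
  by (simp add: module_dim_def quot_dim_def presents_annihilator)

section \<open>Restricting a polynomial to some of its monomials\<close>

definition restr :: "(('v::finite \<Rightarrow>\<^sub>0 nat) \<Rightarrow> bool) \<Rightarrow> ('v, 'k::field) mpoly \<Rightarrow> ('v, 'k) mpoly" where
  "restr P f = Abs_poly_mapping (\<lambda>u. if P u then lookup f u else 0)"

lemma lookup_restr: "lookup (restr P f) u = (if P u then lookup f u else 0)"
proof -
  have "finite {u. (if P u then lookup f u else 0) \<noteq> 0}"
    by (rule finite_subset[OF _ finite_keys[of f]]) (auto simp: in_keys_iff split: if_splits)
  then show ?thesis by (simp add: restr_def)
qed

lemma keys_restr: "keys (restr P f) = {u \<in> keys f. P u}"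
  by (auto simp: in_keys_iff lookup_restr split: if_splits)

lemma restr_add: "restr P (f + g) = restr P f + restr P g"
  by (rule poly_mapping_eqI) (simp add: lookup_restr lookup_add)

lemma restr_diff: "restr P (f - g) = restr P f - restr P g"
  by (rule poly_mapping_eqI) (simp add: lookup_restr lookup_minus)

lemma restr_0 [simp]: "restr P 0 = 0"
  by (rule poly_mapping_eqI) (simp add: lookup_restr)

lemma restr_sum: "restr P (sum f S) = (\<Sum>x\<in>S. restr P (f x))"
  by (induction S rule: infinite_finite_induct) (auto simp: restr_add)

lemma restr_id: "(\<And>u. u \<in> keys f \<Longrightarrow> P u) \<Longrightarrow> restr P f = f"
  by (rule poly_mapping_eqI) (auto simp: lookup_restr in_keys_iff)

lemma restr_eq_0: "(\<And>u. u \<in> keys f \<Longrightarrow> \<not> P u) \<Longrightarrow> restr P f = 0"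
  by (rule poly_mapping_eqI) (auto simp: lookup_restr in_keys_iff)

lemma restr_supported: "f \<in> supported E \<Longrightarrow> restr P f \<in> supported E"
  by (auto simp: supported_def keys_restr)

lemma restr_compl: "f = restr P f + restr (\<lambda>u. \<not> P u) f"
  by (rule poly_mapping_eqI) (simp add: lookup_restr lookup_add)

section \<open>Homogeneous ideals\<close>

abbreviation hcomp :: "nat \<Rightarrow> ('v::finite, 'k::field) mpoly \<Rightarrow> ('v, 'k) mpoly" where
  "hcomp d \<equiv> restr (\<lambda>u. mono_degree u = d)"

definition hom_ideal :: "('v::finite, 'k::field) mpoly set \<Rightarrow> bool" where
  "hom_ideal I \<longleftrightarrow> is_ideal I \<and> (\<forall>f\<in>I. \<forall>d. hcomp d f \<in> I)"

lemma hom_idealD: "hom_ideal I \<Longrightarrow> is_ideal I" "hom_ideal I \<Longrightarrow> f \<in> I \<Longrightarrow> hcomp d f \<in> I"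
  by (auto simp: hom_ideal_def)

lemma hom_ideal_supported: "upclosed E \<Longrightarrow> hom_ideal (supported E)"
  by (simp add: hom_ideal_def ideal_supported restr_supported)

lemma hom_ideal_UNIV: "hom_ideal UNIV"
  by (simp add: hom_ideal_def ideal_UNIV)

lemma hcomp_homogeneous: "hcomp d f \<in> homogeneous d"
  by (simp add: homogeneous_def keys_restr)

lemma hcomp_of_homogeneous: "f \<in> homogeneous d \<Longrightarrow> hcomp e f = (if e = d then f else 0)"
  by (auto simp: homogeneous_def intro!: restr_id restr_eq_0)

lemma sum_hcomp: "f = (\<Sum>d\<in>mono_degree ` keys f. hcomp d f)"
proof (rule poly_mapping_eqI)
  fix u
  have "lookup (\<Sum>d\<in>mono_degree ` keys f. hcomp d f) u =
    (\<Sum>d\<in>mono_degree ` keys f. if mono_degree u = d then lookup f u else 0)"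
    by (simp add: lookup_sum lookup_restr)
  also have "\<dots> = lookup f u" by (auto simp: in_keys_iff)
  finally show "lookup f u = lookup (\<Sum>d\<in>mono_degree ` keys f. hcomp d f) u" by simp
qed

text \<open>The finite sum in the definition of a graded submodule lives in the quotient by \<open>J\<close>; since \<open>J\<close>
  is homogeneous, comparing components does not depend on the representatives.\<close>

lemma graded_submodule_iff:
  fixes I J :: "('v::finite, 'k::field) mpoly set"
  assumes P: "presents M UNIV J \<rho>" and J: "hom_ideal J" and I: "is_ideal I" "J \<subseteq> I"
  shows "graded_submodule mpoly_ring M (\<lambda>d. \<rho> ` homogeneous d) (\<rho> ` I) \<longleftrightarrow> hom_ideal I"
proof -
  note p = presentsD[OF P]
  have mem: "\<rho> a \<in> \<rho> ` I \<longleftrightarrow> a \<in> I" for a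
    using presents_mem_iff[OF P] I by auto
  show ?thesis
  proof
    assume g: "graded_submodule mpoly_ring M (\<lambda>d. \<rho> ` homogeneous d) (\<rho> ` I)"
    have "hcomp e f \<in> I" if "f \<in> I" for f e
    proof -
      obtain D c where D: "finite D" "\<forall>d\<in>D. c d \<in> \<rho> ` I \<inter> \<rho> ` homogeneous d" "\<rho> f = finsum M c D"
        using g \<open>f \<in> I\<close> unfolding graded_submodule_def by blast
      then have "\<forall>d\<in>D. \<exists>h. h \<in> homogeneous d \<and> c d = \<rho> h" by blast
      then obtain h where h: "\<And>d. d \<in> D \<Longrightarrow> h d \<in> homogeneous d \<and> c d = \<rho> (h d)" by metis
      have hI: "h d \<in> I" if "d \<in> D" for d using D(2) h[OF that] mem[of "h d"] that by (metis IntD1)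
      interpret abelian_group M by (rule presents_abelian_group[OF P])
      have "finsum M c D = finsum M (\<lambda>d. \<rho> (h d)) D"
        using h p(4) by (intro finsum_cong') auto
      also have "\<dots> = \<rho> (sum h D)" using D(1) by (intro presents_finsum[OF P]) auto
      finally have "f - sum h D \<in> J" using D(3) p(8) by auto
      then have "hcomp e (f - sum h D) \<in> I" using J I by (auto simp: hom_ideal_def)
      moreover have "hcomp e (sum h D) \<in> I"
        unfolding restr_sum
      proof (rule ideal_sum[OF I(1)])
        fix d assume d: "d \<in> D"
        then have "hcomp e (h d) = (if e = d then h d else 0)" using h hcomp_of_homogeneous by blast
        then show "hcomp e (h d) \<in> I" using hI[OF d] ideal_zero[OF I(1)] by simp
      qed
      ultimately have "hcomp e (f - sum h D) + hcomp e (sum h D) \<in> I" using ideal_add[OF I(1)] by blast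
      then show ?thesis by (simp add: restr_diff)
    qed
    then show "hom_ideal I" using I by (simp add: hom_ideal_def)
  next
    assume h: "hom_ideal I"
    have "\<exists>D c. finite D \<and> (\<forall>d\<in>D. c d \<in> \<rho> ` I \<inter> \<rho> ` homogeneous d) \<and> \<rho> f = finsum M c D" if f: "f \<in> I" for f
    proof (intro exI conjI ballI)
      let ?D = "mono_degree ` keys f"
      show "finite ?D" by simp
      show "\<rho> (hcomp d f) \<in> \<rho> ` I \<inter> \<rho> ` homogeneous d" for d
        using hom_idealD(2)[OF h f] hcomp_homogeneous by blast
      show "\<rho> f = finsum M (\<lambda>d. \<rho> (hcomp d f)) ?D"
        by (subst presents_finsum[OF P]) (auto simp: sum_hcomp[symmetric])
    qed
    then show "graded_submodule mpoly_ring M (\<lambda>d. \<rho> ` homogeneous d) (\<rho> ` I)"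
      using presents_submodule[OF P I(1)] by (auto simp: graded_submodule_def)
  qed
qed

text \<open>A filtration of \<open>R / J\<close> that witnesses that \<open>J\<close> is SCM, read as an ascending chain of ideals
  of \<open>R\<close>.\<close>

definition scm_filtration :: "('v::finite, 'k::field) mpoly set \<Rightarrow> nat \<Rightarrow> (nat \<Rightarrow> ('v, 'k) mpoly set) \<Rightarrow> bool" where
  "scm_filtration J r I \<longleftrightarrow>
    I 0 = J \<and> I r = UNIV \<and> (\<forall>i\<le>r. hom_ideal (I i)) \<and>
    (\<forall>i<r. I i \<subset> I (Suc i) \<and> quot_depth (I (Suc i)) (I i) = quot_dim (I (Suc i)) (I i)) \<and>
    (\<forall>i. Suc i < r \<longrightarrow> quot_dim (I (Suc i)) (I i) < quot_dim (I (Suc (Suc i))) (I (Suc i)))"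

lemma presents_R_mod_J:
  fixes J :: "('v::finite, 'k::field) mpoly set"
  assumes "is_ideal J"
  shows "presents (regular_module mpoly_ring QuotM J) UNIV J (\<lambda>f. J +>\<^bsub>mpoly_ring\<^esub> f)"
proof -
  have eq: "(\<lambda>f. J +>\<^bsub>mpoly_ring\<^esub> f) = (\<lambda>f. id ` {g \<in> UNIV. g - f \<in> J})"
  proof
    fix f
    show "J +>\<^bsub>mpoly_ring\<^esub> f = id ` {g \<in> UNIV. g - f \<in> J}"
      by (auto simp: a_r_coset_def r_coset_def )
  qed
  have "presents (regular_module mpoly_ring QuotM (id ` J)) UNIV J (\<lambda>f. id ` {g \<in> UNIV. g - f \<in> J})"
    by (rule presents_quotient[OF presents_regular_module assms]) (use ideal_zero[OF assms] in auto)
  then show ?thesis unfolding eq by simp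
qed

theorem SCM_iff_filtration:
  fixes J :: "('v::finite, 'k::field) mpoly set"
  assumes J: "hom_ideal J"
  shows "SCM J \<longleftrightarrow> (\<exists>r I. scm_filtration J r I)"
proof -
  define M where "M = regular_module mpoly_ring QuotM J"
  define \<rho> where "\<rho> = (\<lambda>f. J +>\<^bsub>mpoly_ring\<^esub> f)"
  have P: "presents M UNIV J \<rho>"
    using presents_R_mod_J[OF hom_idealD(1)[OF J]] by (simp add: M_def \<rho>_def)
  note p = presentsD[OF P]
  define Q where "Q F i = (M\<lparr>carrier := F (Suc i)\<rparr>) QuotM F i" for F :: "nat \<Rightarrow> ('v, 'k) mpoly set set" and i
  have SCM: "SCM J \<longleftrightarrow> (\<exists>r F. F 0 = {\<zero>\<^bsub>M\<^esub>} \<and> F r = carrier M \<and>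
        (\<forall>i\<le>r. graded_submodule mpoly_ring M (\<lambda>d. \<rho> ` homogeneous d) (F i)) \<and>
        (\<forall>i<r. F i \<subset> F (Suc i) \<and> cohen_macaulay (Q F i)) \<and>
        (\<forall>i. Suc i < r \<longrightarrow> module_dim mpoly_ring (Q F i) < module_dim mpoly_ring (Q F (Suc i))))"
    unfolding SCM_def sequentially_cohen_macaulay_def Let_def M_def \<rho>_def Q_def image_def by simp
  have translate: "(F 0 = {\<zero>\<^bsub>M\<^esub>} \<and> F r = carrier M \<and>
        (\<forall>i\<le>r. graded_submodule mpoly_ring M (\<lambda>d. \<rho> ` homogeneous d) (F i)) \<and>
        (\<forall>i<r. F i \<subset> F (Suc i) \<and> cohen_macaulay (Q F i)) \<and>
        (\<forall>i. Suc i < r \<longrightarrow> module_dim mpoly_ring (Q F i) < module_dim mpoly_ring (Q F (Suc i))))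
     \<longleftrightarrow> scm_filtration J r I"
    if I: "\<And>i. i \<le> r \<Longrightarrow> is_ideal (I i)" "\<And>i. i \<le> r \<Longrightarrow> J \<subseteq> I i" and F: "\<And>i. i \<le> r \<Longrightarrow> F i = \<rho> ` I i"
    for r F I
  proof -
    have sub: "\<rho> ` S \<subseteq> \<rho> ` T \<longleftrightarrow> S \<subseteq> T" if "is_ideal T" "J \<subseteq> T" for S T
      using presents_mem_iff[OF P that] by (metis UNIV_I image_mono image_subset_iff subsetI top_greatest)
    have eq: "\<rho> ` S = \<rho> ` T \<longleftrightarrow> S = T" if "is_ideal S" "J \<subseteq> S" "is_ideal T" "J \<subseteq> T" for S T
      using sub that by (metis subset_antisym order_refl)
    have "{\<zero>\<^bsub>M\<^esub>} = \<rho> ` J" using presents_multiples[OF P, of "[]"] by simp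
    then have c0: "F 0 = {\<zero>\<^bsub>M\<^esub>} \<longleftrightarrow> I 0 = J" using F[of 0] I[of 0] eq p(2) by simp
    have cr: "F r = carrier M \<longleftrightarrow> I r = UNIV" using F[of r] I[of r] eq[of "I r" UNIV] ideal_UNIV p(4) by simp
    have g: "graded_submodule mpoly_ring M (\<lambda>d. \<rho> ` homogeneous d) (F i) \<longleftrightarrow> hom_ideal (I i)" if "i \<le> r" for i
      using F[OF that] I[OF that] graded_submodule_iff[OF P J] by simp
    have lt: "F i \<subset> F (Suc i) \<longleftrightarrow> I i \<subset> I (Suc i)" if "i < r" for i
      using F[of i] I[of i] F[of "Suc i"] I[of "Suc i"] that eq sub by (simp add: psubset_eq)
    have pQ: "\<exists>\<sigma>. presents (Q F i) (I (Suc i)) (I i) \<sigma>" if "i < r" "I i \<subset> I (Suc i)" for i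
    proof -
      have "presents (M\<lparr>carrier := \<rho> ` I (Suc i)\<rparr>) (I (Suc i)) J \<rho>"
        using I that by (intro presents_restrict[OF P]) auto
      from presents_quotient[OF this, of "I i"] show ?thesis
        using I[of i] that F[of i] F[of "Suc i"] unfolding Q_def by (intro exI) auto
    qed
    have cm: "cohen_macaulay (Q F i) \<longleftrightarrow> quot_depth (I (Suc i)) (I i) = quot_dim (I (Suc i)) (I i)"
      and dim: "module_dim mpoly_ring (Q F i) = quot_dim (I (Suc i)) (I i)"
      if "i < r" "I i \<subset> I (Suc i)" for i
    proof -
      note pQ[OF that]
      then obtain \<sigma> where \<sigma>: "presents (Q F i) (I (Suc i)) (I i) \<sigma>" by blast
      show "module_dim mpoly_ring (Q F i) = quot_dim (I (Suc i)) (I i)" by (rule presents_dim[OF \<sigma>])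
      then show "cohen_macaulay (Q F i) \<longleftrightarrow> quot_depth (I (Suc i)) (I i) = quot_dim (I (Suc i)) (I i)"
        by (simp add: cohen_macaulay_def presents_depth[OF \<sigma>])
    qed
    have g': "(\<forall>i\<le>r. graded_submodule mpoly_ring M (\<lambda>d. \<rho> ` homogeneous d) (F i)) \<longleftrightarrow> (\<forall>i\<le>r. hom_ideal (I i))"
      by (simp add: g)
    have cm': "(\<forall>i<r. F i \<subset> F (Suc i) \<and> cohen_macaulay (Q F i)) \<longleftrightarrow>
        (\<forall>i<r. I i \<subset> I (Suc i) \<and> quot_depth (I (Suc i)) (I i) = quot_dim (I (Suc i)) (I i))"
    proof (intro iffI allI impI)
      fix i assume "\<forall>i<r. F i \<subset> F (Suc i) \<and> cohen_macaulay (Q F i)" "i < r"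
      then show "I i \<subset> I (Suc i) \<and> quot_depth (I (Suc i)) (I i) = quot_dim (I (Suc i)) (I i)"
        using lt[of i] cm[of i] by simp
    next
      fix i assume "\<forall>i<r. I i \<subset> I (Suc i) \<and> quot_depth (I (Suc i)) (I i) = quot_dim (I (Suc i)) (I i)" "i < r"
      then show "F i \<subset> F (Suc i) \<and> cohen_macaulay (Q F i)"
        using lt[of i] cm[of i] by simp
    qed
    have dim': "(\<forall>i. Suc i < r \<longrightarrow> module_dim mpoly_ring (Q F i) < module_dim mpoly_ring (Q F (Suc i))) \<longleftrightarrow>
        (\<forall>i. Suc i < r \<longrightarrow> quot_dim (I (Suc i)) (I i) < quot_dim (I (Suc (Suc i))) (I (Suc i)))"
      if "\<forall>i<r. I i \<subset> I (Suc i)"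
      using that dim by simp
    show ?thesis
    proof (cases "\<forall>i<r. I i \<subset> I (Suc i)")
      case True
      show ?thesis unfolding scm_filtration_def c0 cr g' cm' dim'[OF True] by (rule refl)
    next
      case False
      then have "\<not> (\<forall>i<r. I i \<subset> I (Suc i) \<and> quot_depth (I (Suc i)) (I i) = quot_dim (I (Suc i)) (I i))"
        by blast
      then show ?thesis unfolding scm_filtration_def c0 cr g' cm' by (simp only: simp_thms)
    qed
  qed
  show ?thesis
  proof
    assume "SCM J"
    then obtain r F where rF: "F 0 = {\<zero>\<^bsub>M\<^esub>} \<and> F r = carrier M \<and>
        (\<forall>i\<le>r. graded_submodule mpoly_ring M (\<lambda>d. \<rho> ` homogeneous d) (F i)) \<and>
        (\<forall>i<r. F i \<subset> F (Suc i) \<and> cohen_macaulay (Q F i)) \<and>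
        (\<forall>i. Suc i < r \<longrightarrow> module_dim mpoly_ring (Q F i) < module_dim mpoly_ring (Q F (Suc i)))"
      unfolding SCM by (elim exE)
    define I where "I i = {a \<in> UNIV. \<rho> a \<in> F i}" for i
    have "is_ideal (I i)" "J \<subseteq> I i" "\<rho> ` I i = F i" if "i \<le> r" for i
      using rF that submodule_preimage[OF P, of "F i"] by (auto simp: I_def graded_submodule_def)
    then have "scm_filtration J r I" using rF by (subst translate[of r I F, symmetric]) simp_all
    then show "\<exists>r I. scm_filtration J r I" by blast
  next
    assume "\<exists>r I. scm_filtration J r I"
    then obtain r I where rI: "scm_filtration J r I" by blast
    have "J \<subseteq> I i" if "i \<le> r" for i
      using that
    proof (induction i)
      case (Suc i)
      then show ?case using rI unfolding scm_filtration_def by (meson Suc_le_lessD less_imp_le psubset_imp_subset subset_trans)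
    qed (use rI in \<open>simp add: scm_filtration_def\<close>)
    moreover have "is_ideal (I i)" if "i \<le> r" for i
      using rI that by (auto simp: scm_filtration_def hom_ideal_def)
    ultimately show "SCM J"
      unfolding SCM
      by (intro exI[of _ r] exI[of _ "\<lambda>i. \<rho> ` I i"], subst translate[of r I]) (simp_all add: rI)
  qed
qed

section \<open>Dimension, depth and height\<close>

lemma chain_length_sup_le:
  assumes "\<And>P k. \<forall>i\<le>k. P i \<in> S \<Longrightarrow> \<forall>i<k. P i \<subset> P (Suc i) \<Longrightarrow> k \<le> d"
  shows "chain_length_sup S \<le> enat d"
  unfolding chain_length_sup_def
proof (rule Sup_least)
  fix e assume "e \<in> {enat k | k. \<exists>P. (\<forall>i\<le>k. P i \<in> S) \<and> (\<forall>i<k. P i \<subset> P (Suc i))}"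
  then obtain k P where "e = enat k" "\<forall>i\<le>k. P i \<in> S" "\<forall>i<k. P i \<subset> P (Suc i)" by blast
  then show "e \<le> enat d" using assms by simp
qed

lemma chain_length_sup_ge:
  assumes "\<And>i. i \<le> k \<Longrightarrow> P i \<in> S" "\<And>i. i < k \<Longrightarrow> P i \<subset> P (Suc i)"
  shows "enat k \<le> chain_length_sup S"
  unfolding chain_length_sup_def using assms by (intro Sup_upper) blast

text \<open>In a chain of primes, any element of the larger prime that is missing in the smaller one is a
  nonzerodivisor modulo the smaller one.\<close>

lemma prime_chain_le:
  fixes P :: "nat \<Rightarrow> ('v::finite, 'k::field) mpoly set"
  assumes pr: "\<And>i. i \<le> k \<Longrightarrow> primeideal (P i) mpoly_ring" and lt: "\<And>i. i < k \<Longrightarrow> P i \<subset> P (Suc i)"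
    and nonface: "\<And>u. (\<forall>U\<in>\<Delta>. \<not> keys u \<subseteq> U) \<Longrightarrow> mon u \<in> P 0"
    and \<Delta>: "\<And>U. U \<in> \<Delta> \<Longrightarrow> card U \<le> d"
  shows "k \<le> d"
proof -
  have "\<forall>i. \<exists>g. i < k \<longrightarrow> g \<in> P (Suc i) \<and> g \<notin> P i" using lt by blast
  then obtain g where g: "\<And>i. i < k \<Longrightarrow> g i \<in> P (Suc i) \<and> g i \<notin> P i" by metis
  show ?thesis
  proof (rule chain_length_le[where I = P and g = g and \<Delta> = \<Delta>])
    show "is_ideal (P i)" if "i \<le> k" for i using pr[OF that] by (simp add: primeideal_iff)
    show "1 \<notin> P k" using pr[of k] by (simp add: primeideal_iff)
    show "r \<in> P i" if "i < k" "g i * r \<in> P i" for i r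
      using pr[of i] g[of i] that by (auto simp: primeideal_iff)
  qed (use g lt nonface \<Delta> in auto)
qed

lemma quot_dim_le:
  fixes A B :: "('v::finite, 'k::field) mpoly set"
  assumes nonface: "\<And>u. (\<forall>U\<in>\<Delta>. \<not> keys u \<subseteq> U) \<Longrightarrow> mon u \<in> ann A B"
    and \<Delta>: "\<And>U. U \<in> \<Delta> \<Longrightarrow> card U \<le> d"
  shows "quot_dim A B \<le> enat d"
  unfolding quot_dim_def
proof (rule chain_length_sup_le)
  fix P :: "nat \<Rightarrow> ('v, 'k) mpoly set" and k
  assume P: "\<forall>i\<le>k. P i \<in> {Q. primeideal Q mpoly_ring \<and> ann A B \<subseteq> Q}" "\<forall>i<k. P i \<subset> P (Suc i)"
  show "k \<le> d"
  proof (rule prime_chain_le[where P = P and \<Delta> = \<Delta>])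
    fix u :: "'v \<Rightarrow>\<^sub>0 nat" assume "\<forall>U\<in>\<Delta>. \<not> keys u \<subseteq> U"
    then have "mon u \<in> ann A B" by (rule nonface)
    then show "mon u \<in> P 0" using P(1) by blast
  qed (use P \<Delta> in auto)
qed

lemma rmult_append: "rmult A B (fs @ gs) = rmult A (rmult A B gs) fs"
  by (induction fs) auto

lemma rmult_mono: "B \<subseteq> B' \<Longrightarrow> rmult A B fs \<subseteq> rmult A B' fs"
  by (induction fs) auto

text \<open>For a regular sequence on \<open>A / B\<close> and an element \<open>m\<close> of \<open>A\<close> outside \<open>(f\<^sub>1, \<dots>, f\<^sub>k) A + B\<close>, the colon
  ideals \<open>((f\<^sub>1, \<dots>, f\<^sub>i) A + B) : m\<close> form a chain in which \<open>f\<^sub>i\<^sub>+\<^sub>1\<close> is a nonzerodivisor modulo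
  the \<open>i\<close>-th ideal and belongs to the next one.\<close>

lemma quot_depth_le:
  fixes A B :: "('v::finite, 'k::field) mpoly set"
  assumes A: "is_ideal A" and B: "is_ideal B" "B \<subseteq> A"
    and nonface: "\<And>u. (\<forall>U\<in>\<Delta>. \<not> keys u \<subseteq> U) \<Longrightarrow> mon u \<in> ann A B"
    and \<Delta>: "\<And>U. U \<in> \<Delta> \<Longrightarrow> card U \<le> d"
  shows "quot_depth A B \<le> enat d"
  unfolding quot_depth_def
proof (rule Sup_least)
  fix e
  assume "e \<in> {enat (length fs) | fs. (\<forall>f\<in>set fs. \<exists>d>0. f \<in> homogeneous d) \<and> rel_regular A B fs}"
  then obtain fs where fs: "e = enat (length fs)" "rel_regular A B fs" by blast
  note r = rmult_ideal[OF A B]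
  have "rmult A B fs \<noteq> A" using fs(2) by (simp add: rel_regular_def)
  then obtain m where m: "m \<in> A" "m \<notin> rmult A B fs" using r(3) by blast
  define I where "I i = {r. r * m \<in> rmult A B (take i fs)}" for i
  have "length fs \<le> d"
  proof (rule chain_length_le[where I = I and g = "\<lambda>i. fs ! i" and \<Delta> = \<Delta>])
    fix i
    show "is_ideal (I i)"
      using r(1)[of "take i fs"]
      by (intro is_idealI) (auto simp: I_def distrib_right mult.assoc ideal_zero ideal_add ideal_mult)
    assume i: "i < length fs"
    have eq: "take (Suc i) fs = take i fs @ [fs ! i]" using i by (rule take_Suc_conv_app_nth)
    have sub: "rmult A B [fs ! i] \<subseteq> rmult A B (take (Suc i) fs)"
      unfolding eq rmult_append using rmult_ideal[OF A r(1) r(3)] by blast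
    have "rmult A B (take i fs) \<subseteq> rmult A B (take (Suc i) fs)"
      unfolding eq rmult_append by (rule rmult_mono[OF r(2)])
    then show "I i \<subseteq> I (Suc i)" by (auto simp: I_def)
    have "fs ! i * m + 0 \<in> rmult A B [fs ! i]" using m(1) ideal_zero[OF B(1)] unfolding rmult.simps by blast
    then show "fs ! i \<in> I (Suc i)" using sub by (auto simp: I_def)
    fix s assume "fs ! i * s \<in> I i"
    then have "fs ! i * (s * m) \<in> rmult A B (take i fs)" by (simp add: I_def mult.assoc)
    then have "s * m \<in> rmult A B (take i fs)"
      using fs(2) i ideal_mult[OF A m(1)] by (auto simp: rel_regular_def)
    then show "s \<in> I i" by (simp add: I_def)
  next
    show "1 \<notin> I (length fs)" using m by (simp add: I_def)
    fix u :: "'v \<Rightarrow>\<^sub>0 nat" assume "\<forall>U\<in>\<Delta>. \<not> keys u \<subseteq> U"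
    then show "mon u \<in> I 0" using nonface m(1) by (auto simp: I_def ann_def)
  qed (rule \<Delta>)
  then show "e \<le> enat d" using fs(1) by simp
qed

lemma var_ideal_take_chain:
  fixes ys :: "'v::finite list"
  assumes "distinct ys" "set ys \<inter> C = {}" "i < length ys"
  shows "(var_ideal (C \<union> set (take i ys)) :: ('v, 'k::field) mpoly set) \<subset> var_ideal (C \<union> set (take (Suc i) ys))"
proof -
  have "ys ! i \<notin> C \<union> set (take i ys)"
  proof
    assume "ys ! i \<in> C \<union> set (take i ys)"
    then have "ys ! i \<in> set (take i ys)" using assms(2) nth_mem[OF assms(3)] by blast
    then show False using assms(1,3) by (auto simp: in_set_conv_nth nth_eq_iff_index_eq)
  qed
  moreover have "ys ! i \<in> C \<union> set (take (Suc i) ys)"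
    using assms by (simp add: take_Suc_conv_app_nth)
  moreover have "C \<union> set (take i ys) \<subseteq> C \<union> set (take (Suc i) ys)"
    using set_take_subset_set_take[of i "Suc i" ys] by auto
  ultimately show ?thesis unfolding psubset_eq var_ideal_subset_iff
    by (metis Var_in_var_ideal)
qed

lemma quot_dim_ge:
  fixes A B :: "('v::finite, 'k::field) mpoly set"
  assumes "ann A B \<subseteq> var_ideal C"
  shows "enat (card (UNIV - C)) \<le> quot_dim A B"
proof -
  obtain ys where ys: "set ys = UNIV - C" "distinct ys" using finite_distinct_list[of "UNIV - C"] by auto
  have sub: "(var_ideal C :: ('v, 'k) mpoly set) \<subseteq> var_ideal (C \<union> set (take i ys))" for i by simp
  have "enat (length ys) \<le> quot_dim A B"
    unfolding quot_dim_def
  proof (rule chain_length_sup_ge)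
    fix i
    show "var_ideal (C \<union> set (take i ys)) \<in> {Q. primeideal Q mpoly_ring \<and> ann A B \<subseteq> Q}"
      using prime_var_ideal assms sub by blast
    assume "i < length ys"
    then show "(var_ideal (C \<union> set (take i ys)) :: ('v, 'k) mpoly set) \<subset> var_ideal (C \<union> set (take (Suc i) ys))"
      using ys by (intro var_ideal_take_chain) auto
  qed
  then show ?thesis using ys distinct_card by fastforce
qed

text \<open>The lower bound comes from adding the variables one at a time. For the upper bound, a chain of
  primes below the ideal is prolonged by adding the remaining variables, and the total length
  is at most the number of all variables.\<close>

theorem height_var_ideal:
  "height mpoly_ring (var_ideal A :: ('v::finite, 'k::field) mpoly set) = enat (card A)"
proof (rule antisym)
  obtain xs where xs: "set xs = A" "distinct xs" using finite_distinct_list[of A] by auto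
  have len: "length xs = card A" using distinct_card[OF xs(2)] xs(1) by simp
  have "enat (length xs) \<le> height mpoly_ring (var_ideal A :: ('v, 'k) mpoly set)"
    unfolding height_def
  proof (rule chain_length_sup_ge)
    fix i
    have "set (take i xs) \<subseteq> A" using xs set_take_subset[of i xs] by simp
    then show "var_ideal ({} \<union> set (take i xs)) \<in> {Q. primeideal Q mpoly_ring \<and> Q \<subseteq> (var_ideal A :: ('v, 'k) mpoly set)}"
      using prime_var_ideal by simp
    assume "i < length xs"
    then show "(var_ideal ({} \<union> set (take i xs)) :: ('v, 'k) mpoly set) \<subset> var_ideal ({} \<union> set (take (Suc i) xs))"
      using xs by (intro var_ideal_take_chain) auto
  qed
  then show "enat (card A) \<le> height mpoly_ring (var_ideal A :: ('v, 'k) mpoly set)" by (simp add: len)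
next
  show "height mpoly_ring (var_ideal A :: ('v, 'k) mpoly set) \<le> enat (card A)"
    unfolding height_def
  proof (rule chain_length_sup_le)
    fix P :: "nat \<Rightarrow> ('v, 'k) mpoly set" and k
    assume P: "\<forall>i\<le>k. P i \<in> {Q. primeideal Q mpoly_ring \<and> Q \<subseteq> var_ideal A}" "\<forall>i<k. P i \<subset> P (Suc i)"
    obtain ys where ys: "set ys = UNIV - A" "distinct ys" using finite_distinct_list[of "UNIV - A"] by auto
    have len: "length ys = card (UNIV - A)" using distinct_card[OF ys(2)] ys(1) by simp
    \<comment> \<open>The last member \<open>P k\<close> is replaced by the ideal of \<open>A\<close> itself, from which the chain goes on.\<close>
    define P' where "P' i = (if i < k then P i else var_ideal (A \<union> set (take (i - k) ys)))" for i
    have "k + length ys \<le> CARD('v)"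
    proof (rule prime_chain_le[where P = P' and \<Delta> = "{UNIV}"])
      fix i assume "i \<le> k + length ys"
      show "primeideal (P' i) mpoly_ring"
        using P(1) prime_var_ideal[of "A \<union> set (take (i - k) ys)", where 'k = 'k] by (simp add: P'_def)
    next
      fix i assume i: "i < k + length ys"
      show "P' i \<subset> P' (Suc i)"
      proof (cases "i < k")
        case True
        then have "P i \<subset> P (Suc i)" "P (Suc i) \<subseteq> var_ideal A" using P by simp_all
        moreover have "Suc i - k = 0" using True by simp
        ultimately show ?thesis using True by (cases "Suc i < k") (auto simp: P'_def)
      next
        case False
        then have eq: "Suc i - k = Suc (i - k)" by simp
        have "(var_ideal (A \<union> set (take (i - k) ys)) :: ('v, 'k) mpoly set)
            \<subset> var_ideal (A \<union> set (take (Suc (i - k)) ys))"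
          using False i ys by (intro var_ideal_take_chain) auto
        then show ?thesis using False by (simp add: P'_def eq)
      qed
    next
      fix u :: "'v \<Rightarrow>\<^sub>0 nat" assume "\<forall>U\<in>{UNIV}. \<not> keys u \<subseteq> U"
      then show "mon u \<in> P' 0" by simp
    next
      fix U :: "'v set" assume "U \<in> {UNIV}" then show "card U \<le> CARD('v)" by simp
    qed
    moreover have "card A + card (UNIV - A) = CARD('v)"
      by (simp add: card_Diff_subset card_mono)
    ultimately show "k \<le> card A" using len by simp
  qed
qed

section \<open>Regular pairs of homogeneous polynomials\<close>

text \<open>Multiplication by \<open>f\<close> is injective on \<open>A / B\<close>.\<close>

definition nzd :: "'a::comm_ring_1 \<Rightarrow> 'a set \<Rightarrow> 'a set \<Rightarrow> bool" where
  "nzd f A B \<longleftrightarrow> (\<forall>a\<in>A. f * a \<in> B \<longrightarrow> a \<in> B)"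

text \<open>A regular sequence of length two on \<open>A / B\<close>, without the condition that the quotient by it is
  nonzero.\<close>

definition reg2 :: "'a::comm_ring_1 set \<Rightarrow> 'a set \<Rightarrow> 'a \<Rightarrow> 'a \<Rightarrow> bool" where
  "reg2 A B x y \<longleftrightarrow> nzd x A B \<and> nzd y A (rmult A B [x])"

lemma nzdD: "nzd f A B \<Longrightarrow> a \<in> A \<Longrightarrow> f * a \<in> B \<Longrightarrow> a \<in> B"
  by (simp add: nzd_def)

lemma rmult1I: "a \<in> A \<Longrightarrow> b \<in> B \<Longrightarrow> x * a + b \<in> rmult A B [x]"
  by auto

lemma rmult1_mult: "a \<in> A \<Longrightarrow> is_ideal B \<Longrightarrow> x * a \<in> rmult A B [x]"
  using rmult1I[of a A 0 B x] ideal_zero[of B] by simp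

lemma rmult1E:
  assumes "f \<in> rmult A B [x]" obtains a b where "a \<in> A" "b \<in> B" "f = x * a + b"
  using assms by auto

lemma rmult_commute: "rmult A (rmult A B [x]) [y] = rmult A (rmult A B [y]) [x]"
proof -
  have "rmult A (rmult A B [x]) [y] \<subseteq> rmult A (rmult A B [y]) [x]" for x y
  proof
    fix f assume "f \<in> rmult A (rmult A B [x]) [y]"
    then obtain a b c where "a \<in> A" "b \<in> A" "c \<in> B" "f = y * a + (x * b + c)"
      by (elim rmult1E) auto
    then have "f = x * b + (y * a + c)" "b \<in> A" "y * a + c \<in> rmult A B [y]" by auto
    then show "f \<in> rmult A (rmult A B [y]) [x]" using rmult1I by blast
  qed
  then show ?thesis by blast
qed

lemma nzd_power:
  assumes "is_ideal A" "nzd x A B" shows "nzd (x ^ n) A B"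
proof (induction n)
  case (Suc n)
  show ?case unfolding nzd_def
  proof (intro ballI impI)
    fix a assume a: "a \<in> A" "x ^ Suc n * a \<in> B"
    then have "x * (x ^ n * a) \<in> B" by (simp add: mult.assoc)
    then have "x ^ n * a \<in> B" using nzdD[OF assms(2) ideal_mult[OF assms(1) a(1)]] by blast
    then show "a \<in> B" using nzdD[OF Suc a(1)] by blast
  qed
qed (simp add: nzd_def)

lemma mono_degree_add: "mono_degree (u + w) = mono_degree u + mono_degree w"
  by (simp add: mono_degree_def lookup_add sum.distrib)

lemma mono_degree_eq_0_iff: "mono_degree u = 0 \<longleftrightarrow> u = 0"
  by (auto simp: mono_degree_def intro: poly_mapping_eqI)

lemma keys_power_degree:
  assumes "x \<in> var_ideal UNIV" "u \<in> keys (x ^ n)"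
  shows "n \<le> mono_degree u"
  using assms(2)
proof (induction n arbitrary: u)
  case (Suc n)
  then obtain s t where st: "s \<in> keys x" "t \<in> keys (x ^ n)" "u = s + t"
    using keys_mult[of x "x ^ n"] by auto
  have "s \<noteq> 0" using st(1) assms(1) by (auto simp: var_ideal_def supported_def)
  then have "1 \<le> mono_degree s" using mono_degree_eq_0_iff[of s] by linarith
  then show ?case using Suc.IH[OF st(2)] st(3) by (simp add: mono_degree_add)
qed simp

text \<open>The elements of \<open>x ^ n * a\<close> have no terms of degree below \<open>n\<close>, so modulo the homogeneous ideal \<open>B\<close>
  every component of \<open>u\<close> vanishes.\<close>

lemma krull_intersection:
  fixes A B :: "('v::finite, 'k::field) mpoly set"
  assumes B: "hom_ideal B" and x: "x \<in> var_ideal UNIV"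
    and u: "\<And>n. \<exists>a. u - x ^ n * a \<in> B"
  shows "u \<in> B"
proof -
  obtain n where n: "mono_degree ` keys u \<subseteq> {..<n}"
    using finite_nat_bounded[of "mono_degree ` keys u"] by auto
  obtain a where a: "u - x ^ n * a \<in> B" using u by blast
  have "hcomp d u \<in> B" if "d \<in> mono_degree ` keys u" for d
  proof -
    have "hcomp d (x ^ n * a) = 0"
    proof (rule restr_eq_0)
      fix w assume "w \<in> keys (x ^ n * a)"
      then obtain s t where st: "s \<in> keys (x ^ n)" "w = s + t"
        using keys_mult[of "x ^ n" a] by auto
      then have "n \<le> mono_degree w" using keys_power_degree[OF x st(1)] by (simp add: mono_degree_add)
      moreover have "d < n" using n that by blast
      ultimately show "mono_degree w \<noteq> d" by simp
    qed
    then have "hcomp d u = hcomp d (u - x ^ n * a)" by (simp add: restr_diff)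
    then show ?thesis using hom_idealD(2)[OF B a] by simp
  qed
  then have "(\<Sum>d\<in>mono_degree ` keys u. hcomp d u) \<in> B"
    by (rule ideal_sum[OF hom_idealD(1)[OF B]])
  then show ?thesis using sum_hcomp[of u] by simp
qed

text \<open>If \<open>y u \<in> B\<close>, then \<open>u\<close> can be divided by \<open>x\<close> modulo \<open>B\<close> again and again, so it lies in \<open>B\<close> by
  the Krull intersection property. The other half is a diagram chase.\<close>

lemma reg2_swap:
  fixes A B :: "('v::finite, 'k::field) mpoly set"
  assumes A: "is_ideal A" and B: "hom_ideal B" "B \<subseteq> A" and x: "x \<in> var_ideal UNIV"
    and r: "reg2 A B x y"
  shows "reg2 A B y x"
  unfolding reg2_def
proof
  note B' = hom_idealD(1)[OF B(1)]
  have rx: "nzd x A B" and ry: "nzd y A (rmult A B [x])" using r by (auto simp: reg2_def)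
  show "nzd y A B"
    unfolding nzd_def
  proof (intro ballI impI)
    fix u assume u: "u \<in> A" "y * u \<in> B"
    have "\<exists>a\<in>A. u - x ^ n * a \<in> B" for n
    proof (induction n)
      case 0
      show ?case using u(1) ideal_zero[OF B'] by (intro bexI[of _ u]) auto
    next
      case (Suc n)
      then obtain a where a: "a \<in> A" "u - x ^ n * a \<in> B" by blast
      have "y * u - y * (u - x ^ n * a) \<in> B" by (intro ideal_diff B' u ideal_mult a)
      then have "x ^ n * (y * a) \<in> B" by (simp add: algebra_simps)
      then have "y * a \<in> B" by (rule nzdD[OF nzd_power[OF A rx] ideal_mult[OF A a(1)]])
      then have "y * a \<in> rmult A B [x]" using rmult_ideal(2)[OF A B' B(2)] by blast
      then have "a \<in> rmult A B [x]" by (rule nzdD[OF ry a(1)])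
      then obtain a' b where ab: "a' \<in> A" "b \<in> B" "a = x * a' + b" by (rule rmult1E)
      have "(u - x ^ n * a) + x ^ n * b \<in> B" by (intro ideal_add B' a ideal_mult ab)
      then have "u - x ^ Suc n * a' \<in> B" by (simp add: ab(3) algebra_simps)
      then show ?case using ab(1) by blast
    qed
    then show "u \<in> B" by (intro krull_intersection[OF B(1) x]) blast
  qed
  show "nzd x A (rmult A B [y])"
    unfolding nzd_def
  proof (intro ballI impI)
    fix u assume u: "u \<in> A" "x * u \<in> rmult A B [y]"
    obtain v b where v: "v \<in> A" "b \<in> B" "x * u = y * v + b" using u(2) by (rule rmult1E)
    have "x * u + (- b) \<in> rmult A B [x]" by (intro rmult1I u(1) ideal_minus B' v)
    then have "y * v \<in> rmult A B [x]" using v(3) by simp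
    then have "v \<in> rmult A B [x]" by (rule nzdD[OF ry v(1)])
    then obtain v' b' where v': "v' \<in> A" "b' \<in> B" "v = x * v' + b'" by (rule rmult1E)
    have "y * b' + b \<in> B" by (intro ideal_add B' ideal_mult v' v)
    moreover have "x * (u - y * v') = y * b' + b" using v(3) v'(3) by (simp add: algebra_simps)
    ultimately have "x * (u - y * v') \<in> B" by simp
    then have "u - y * v' \<in> B" by (rule nzdD[OF rx ideal_diff[OF A u(1) ideal_mult[OF A v'(1)]]])
    then have "y * v' + (u - y * v') \<in> rmult A B [y]" by (intro rmult1I v')
    then show "u \<in> rmult A B [y]" by simp
  qed
qed

lemma reg2_power_right: "is_ideal A \<Longrightarrow> reg2 A B x y \<Longrightarrow> reg2 A B x (y ^ n)"
  by (simp add: reg2_def nzd_power)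

lemma power_in_var_ideal: "x \<in> var_ideal C \<Longrightarrow> 0 < n \<Longrightarrow> x ^ n \<in> var_ideal C"
  by (cases n) (auto intro: ideal_mult2[OF ideal_var_ideal])

text \<open>The second entry may be replaced by a power; swapping gives the same for the first one.\<close>

lemma reg2_power:
  fixes A B :: "('v::finite, 'k::field) mpoly set"
  assumes A: "is_ideal A" and B: "hom_ideal B" "B \<subseteq> A"
    and xy: "x \<in> var_ideal UNIV" "y \<in> var_ideal UNIV"
    and r: "reg2 A B x y" and n: "0 < n"
  shows "reg2 A B (x ^ m) (y ^ n)"
proof -
  have "reg2 A B x (y ^ n)" by (rule reg2_power_right[OF A r])
  then have "reg2 A B (y ^ n) x" by (rule reg2_swap[OF A B xy(1)])
  then have "reg2 A B (y ^ n) (x ^ m)" by (rule reg2_power_right[OF A])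
  then show ?thesis by (rule reg2_swap[OF A B power_in_var_ideal[OF xy(2) n]])
qed

lemma reg2_linear:
  fixes A B :: "('v::finite, 'k::field) mpoly set"
  assumes A: "is_ideal A" and B: "is_ideal B" "B \<subseteq> A" and r: "reg2 A B x y"
  shows "reg2 A B x (y - c * x)"
  unfolding reg2_def
proof
  show "nzd x A B" using r by (simp add: reg2_def)
  show "nzd (y - c * x) A (rmult A B [x])"
    unfolding nzd_def
  proof (intro ballI impI)
    fix u assume u: "u \<in> A" "(y - c * x) * u \<in> rmult A B [x]"
    have "(y - c * x) * u + x * (c * u) \<in> rmult A B [x]"
      by (intro ideal_add rmult_ideal(1)[OF A B] u rmult1_mult ideal_mult A B)
    then have "y * u \<in> rmult A B [x]" by (simp add: algebra_simps)
    then show "u \<in> rmult A B [x]" using r u(1) by (auto simp: reg2_def nzd_def simp del: rmult.simps)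
  qed
qed

lemma homogeneous_mult:
  assumes "x \<in> homogeneous d" "y \<in> homogeneous e" shows "x * y \<in> homogeneous (d + e)"
proof -
  have "mono_degree w = d + e" if w: "w \<in> keys (x * y)" for w
  proof -
    obtain s t where "s \<in> keys x" "t \<in> keys y" "w = s + t"
      using keys_mult[of x y] w by auto
    then show ?thesis using assms by (simp add: homogeneous_def mono_degree_add)
  qed
  then show ?thesis by (simp add: homogeneous_def)
qed

lemma homogeneous_power:
  assumes "x \<in> homogeneous d" shows "x ^ n \<in> homogeneous (n * d)"
proof (induction n)
  case 0
  show ?case by (simp add: homogeneous_def mono_degree_def)
next
  case (Suc n)
  then show ?case using homogeneous_mult[OF assms] by fastforce
qed

lemma homogeneous_in_var_ideal:
  assumes "x \<in> homogeneous d" "0 < d" shows "x \<in> var_ideal UNIV"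
proof -
  have "keys u \<noteq> {}" if "u \<in> keys x" for u
    using assms that by (auto simp: homogeneous_def mono_degree_def)
  then show ?thesis by (simp add: var_ideal_def supported_def subset_iff)
qed

lemma hcomp_mult:
  assumes x: "x \<in> homogeneous d"
  shows "hcomp e (x * a) = (if d \<le> e then x * hcomp (e - d) a else 0)"
proof (cases "d \<le> e")
  case True
  let ?r = "restr (\<lambda>u. mono_degree u \<noteq> e - d) a"
  have "x * (hcomp (e - d) a + ?r) = x * hcomp (e - d) a + x * ?r" by (rule distrib_left)
  then have "x * a = x * hcomp (e - d) a + x * ?r" unfolding restr_compl[symmetric] .
  moreover have "hcomp e (x * hcomp (e - d) a) = x * hcomp (e - d) a"
    using hcomp_of_homogeneous[OF homogeneous_mult[OF x hcomp_homogeneous[of "e - d" a]]] True by simp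
  moreover have "hcomp e (x * ?r) = 0"
  proof (rule restr_eq_0)
    fix w assume "w \<in> keys (x * ?r)"
    then obtain s t where "s \<in> keys x" "t \<in> keys ?r" "w = s + t"
      using keys_mult[of x ?r] by auto
    then show "mono_degree w \<noteq> e" using x by (auto simp: homogeneous_def mono_degree_add keys_restr)
  qed
  ultimately show ?thesis using True by (simp add: restr_add)
next
  case False
  have "hcomp e (x * a) = 0"
  proof (rule restr_eq_0)
    fix w assume "w \<in> keys (x * a)"
    then obtain s t where "s \<in> keys x" "w = s + t"
      using keys_mult[of x a] by auto
    then show "mono_degree w \<noteq> e" using x False by (auto simp: homogeneous_def mono_degree_add)
  qed
  then show ?thesis using False by simp
qed

lemma hom_ideal_rmult1:
  fixes A B :: "('v::finite, 'k::field) mpoly set"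
  assumes A: "hom_ideal A" and B: "hom_ideal B" "B \<subseteq> A" and x: "x \<in> homogeneous d"
  shows "hom_ideal (rmult A B [x])"
  unfolding hom_ideal_def
proof (intro conjI ballI allI)
  show "is_ideal (rmult A B [x])" by (intro rmult_ideal hom_idealD A B)
  fix f e assume "f \<in> rmult A B [x]"
  then obtain a b where ab: "a \<in> A" "b \<in> B" "f = x * a + b" by (rule rmult1E)
  have "hcomp e f = x * (if d \<le> e then hcomp (e - d) a else 0) + hcomp e b"
    by (simp add: ab(3) restr_add hcomp_mult[OF x])
  moreover have "(if d \<le> e then hcomp (e - d) a else 0) \<in> A"
    using hom_idealD(2)[OF A ab(1)] ideal_zero[OF hom_idealD(1)[OF A]] by simp
  ultimately show "hcomp e f \<in> rmult A B [x]"
    using rmult1I[OF _ hom_idealD(2)[OF B(1) ab(2)]] by (simp del: rmult.simps)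
qed

text \<open>The only monomial of degree \<open>d\<close> without a variable other than \<open>t\<close> is the power of \<open>t\<close>.\<close>

lemma homogeneous_mem_var_ideal:
  fixes x :: "('v::finite, 'k::field) mpoly"
  assumes x: "x \<in> homogeneous d" and 0: "lookup x (single t d) = 0"
  shows "x \<in> var_ideal (UNIV - {t})"
  unfolding var_ideal_def
proof (rule supportedI, rule CollectI, rule notI)
  fix u assume u: "u \<in> keys x" "keys u \<inter> (UNIV - {t}) = {}"
  have z: "lookup u v = 0" if "v \<noteq> t" for v
  proof -
    have "v \<notin> keys u" using u(2) that by blast
    then show ?thesis by (simp add: in_keys_iff)
  qed
  then have eq: "u = single t (lookup u t)"
    by (intro poly_mapping_eqI) (simp add: lookup_single when_def)
  have "d = (\<Sum>v\<in>UNIV. lookup u v)" using x u(1) by (auto simp: homogeneous_def mono_degree_def)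
  also have "\<dots> = (\<Sum>v\<in>{t}. lookup u v)"
    by (rule sum.mono_neutral_right) (auto simp: z)
  finally have "u = single t d" using eq by simp
  then show False using 0 u(1) by (simp add: in_keys_iff)
qed

text \<open>Suitable powers of \<open>y\<close> and \<open>z\<close> have the same degree, and a multiple of the former cancels the
  pure power of \<open>t\<close> in the latter.\<close>

lemma combine_into_var_ideal:
  fixes A B :: "('v::finite, 'k::field) mpoly set"
  assumes A: "is_ideal A" and B: "hom_ideal B" "B \<subseteq> A"
    and y: "y \<in> homogeneous b" "0 < b" "y \<notin> var_ideal (UNIV - {t})" and z: "z \<in> homogeneous c" "0 < c"
    and r: "reg2 A B y z"
  shows "\<exists>u d p. u \<in> var_ideal (UNIV - {t}) \<and> u \<in> homogeneous d \<and> 0 < d \<and> 0 < p \<and> reg2 A B (y ^ p) u"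
proof -
  define q where "q = lookup (z ^ b) (single t (b * c)) /
     lookup (y ^ c) (single t (b * c))"
  \<comment> \<open>The quotient \<open>q\<close> is the one for which the coefficient of the power of \<open>t\<close> cancels.\<close>
  define u where "u = z ^ b - const q * y ^ c"
  have Y: "y ^ c \<in> homogeneous (b * c)" and Z: "z ^ b \<in> homogeneous (b * c)"
    using homogeneous_power[OF y(1), of c] homogeneous_power[OF z(1), of b] by (simp_all add: mult.commute)
  have "y ^ n \<notin> var_ideal (UNIV - {t})" for n
  proof (induction n)
    case (Suc n) then show ?case using y(3) var_ideal_primeD[of y "y ^ n"] by auto
  qed simp
  then have "lookup (y ^ c) (single t (b * c)) \<noteq> 0"
    using homogeneous_mem_var_ideal[OF Y] by blast
  then have "lookup u (single t (b * c)) = 0"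
    by (simp add: u_def q_def lookup_minus)
  moreover have u: "u \<in> homogeneous (b * c)"
    using Y Z by (auto simp: u_def homogeneous_def in_keys_iff lookup_minus)
  ultimately have "u \<in> var_ideal (UNIV - {t})" by (intro homogeneous_mem_var_ideal)
  moreover have "reg2 A B (y ^ c) (z ^ b)"
    by (rule reg2_power[OF A B]) (use homogeneous_in_var_ideal y z r in auto)
  then have "reg2 A B (y ^ c) u"
    unfolding u_def by (rule reg2_linear[OF A hom_idealD(1)[OF B(1)] B(2)])
  ultimately show ?thesis using u y(2) z(2)
    by (intro exI[of _ u] exI[of _ "b * c"] exI[of _ c]) simp
qed

lemma nzd_in_var_ideal:
  fixes A B :: "('v::finite, 'k::field) mpoly set"
  assumes A: "is_ideal A" and B: "hom_ideal B" "B \<subseteq> A"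
    and y: "y \<in> homogeneous b" "0 < b" and z: "z \<in> homogeneous c" "0 < c"
    and r: "reg2 A B y z"
  shows "\<exists>u d. u \<in> var_ideal (UNIV - {t}) \<and> u \<in> homogeneous d \<and> 0 < d \<and> nzd u A B"
proof (cases "y \<in> var_ideal (UNIV - {t})")
  case True
  then show ?thesis using y r by (auto simp: reg2_def)
next
  case False
  obtain u d p where u: "u \<in> var_ideal (UNIV - {t})" "u \<in> homogeneous d" "0 < d" "0 < p" "reg2 A B (y ^ p) u"
    using combine_into_var_ideal[OF A B y False z r] by blast
  have "y ^ p \<in> var_ideal UNIV"
    using power_in_var_ideal[OF homogeneous_in_var_ideal[OF y]] u(4) by blast
  then have "reg2 A B u (y ^ p)" using reg2_swap[OF A B _ u(5)] by blast
  then show ?thesis using u by (auto simp: reg2_def)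
qed

text \<open>The prime generated by the variables other than \<open>t\<close> has a quotient of dimension \<open>1\<close>, so passing
  from the maximal ideal to it costs one element of a regular sequence. Twice, two entries are
  combined into one that avoids the pure powers of \<open>t\<close>.\<close>

lemma regular_pair_in_var_ideal:
  fixes A B :: "('v::finite, 'k::field) mpoly set"
  assumes A: "hom_ideal A" and B: "hom_ideal B" "B \<subseteq> A"
    and x: "x \<in> homogeneous a" "0 < a" and y: "y \<in> homogeneous b" "0 < b" and z: "z \<in> homogeneous c" "0 < c"
    and rx: "nzd x A B" and ryz: "reg2 A (rmult A B [x]) y z"
  shows "\<exists>u\<in>var_ideal (UNIV - {t}). \<exists>v\<in>var_ideal (UNIV - {t}). reg2 A B u v"
proof -
  note A' = hom_idealD(1)[OF A] and B' = hom_idealD(1)[OF B(1)]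
  note r = rmult_ideal[OF A' B' B(2)]
  note xh = homogeneous_in_var_ideal[OF x] and yh = homogeneous_in_var_ideal[OF y]
    and zh = homogeneous_in_var_ideal[OF z]
  note B1 = hom_ideal_rmult1[OF A B x(1)] r(3)[of "[x]"]
  show ?thesis
  proof (cases "x \<in> var_ideal (UNIV - {t})")
    case True
    obtain u d where "u \<in> var_ideal (UNIV - {t})" "nzd u A (rmult A B [x])"
      using nzd_in_var_ideal[OF A' B1 y z ryz] by blast
    then show ?thesis using True rx unfolding reg2_def by blast
  next
    case False
    \<comment> \<open>Move \<open>z\<close> to the front.\<close>
    have zy: "reg2 A (rmult A B [x]) z y" by (rule reg2_swap[OF A' B1 yh ryz])
    then have "reg2 A B x z" using rx by (simp add: reg2_def)
    then have zx: "reg2 A B z x" by (rule reg2_swap[OF A' B xh])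
    note C = hom_ideal_rmult1[OF A B z(1)] r(3)[of "[z]"]
    have "reg2 A (rmult A B [z]) x y"
      using zx zy rmult_commute[of A B x z] by (simp add: reg2_def del: rmult.simps)
    then obtain u d p where u: "u \<in> var_ideal (UNIV - {t})" "u \<in> homogeneous d" "0 < d" "0 < p"
        "reg2 A (rmult A B [z]) (x ^ p) u"
      using combine_into_var_ideal[OF A' C x False y] by blast
    note uh = homogeneous_in_var_ideal[OF u(2,3)] and xp = power_in_var_ideal[OF xh u(4)]
    have ux: "reg2 A (rmult A B [z]) u (x ^ p)" by (rule reg2_swap[OF A' C xp u(5)])
    then have "reg2 A B z u" using zx by (simp add: reg2_def del: rmult.simps)
    then have uz: "reg2 A B u z" by (rule reg2_swap[OF A' B zh])
    note D = hom_ideal_rmult1[OF A B u(2)] r(3)[of "[u]"]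
    have zxp: "reg2 A (rmult A B [u]) z (x ^ p)"
      using ux uz rmult_commute[of A B u z] by (simp add: reg2_def del: rmult.simps)
    have xph: "x ^ p \<in> homogeneous (p * a)" "0 < p * a" using homogeneous_power[OF x(1)] u(4) x(2) by auto
    obtain v e where "v \<in> var_ideal (UNIV - {t})" "nzd v A (rmult A B [u])"
      using nzd_in_var_ideal[OF A' D z xph zxp] by blast
    then show ?thesis using u(1) uz unfolding reg2_def by blast
  qed
qed

section \<open>Multipartite edge ideals: necessity of the condition on parts\<close>

text \<open>The edge ideal of the complete multipartite graph on \<open>V\<close> whose parts are the fibres of \<open>c\<close>.
  Variables outside \<open>V\<close> are allowed; they are free modulo the ideal.\<close>

definition multipartite :: "'v::finite set \<Rightarrow> ('v \<Rightarrow> 'c) \<Rightarrow> ('v, 'k::field) mpoly set" where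
  "multipartite V c =
    supported {u. \<exists>x\<in>keys u \<inter> V. \<exists>y\<in>keys u \<inter> V. c x \<noteq> c y}"

lemma hom_ideal_multipartite: "hom_ideal (multipartite V c)"
  unfolding multipartite_def
  by (rule hom_ideal_supported) (auto simp: upclosed_def keys_add_nat)

definition part :: "'v::finite set \<Rightarrow> ('v \<Rightarrow> 'c) \<Rightarrow> 'c \<Rightarrow> 'v set" where
  "part V c k = {v \<in> V. c v = k}"

lemma multipartite_subset_var_ideal:
  "(multipartite V c :: ('v::finite, 'k::field) mpoly set) \<subseteq> var_ideal (V - part V c k)"
  unfolding multipartite_def var_ideal_def supported_subset_iff part_def by auto

text \<open>Modulo the ideal, \<open>\<phi>\<close> is multiplication by the idempotent which is \<open>1\<close> on the \<open>k\<close>-th component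
  and \<open>0\<close> on the others. This idempotent is defined away from the common intersection of the
  components, so \<open>\<phi>\<close> is linear on the ideal generated by \<open>V\<close>; the statement is the instance of
  linearity that the descent along a filtration uses.\<close>

lemma part_multiplier_commutes:
  fixes f g :: "('v::finite, 'k::field) mpoly" and c :: "'v \<Rightarrow> 'c" and k :: 'c
  assumes fg: "f \<in> var_ideal V" "g \<in> var_ideal V"
  defines "\<phi> \<equiv> restr (\<lambda>u. keys u \<inter> part V c k \<noteq> {})"
  shows "g * \<phi> f - f * \<phi> g \<in> multipartite V c"
proof -
  define \<psi> where "\<psi> = (restr (\<lambda>u. \<not> (keys u \<inter> part V c k \<noteq> {})) :: ('v, 'k) mpoly \<Rightarrow> _)"
  have mixed: "\<psi> h * \<phi> h' \<in> multipartite V c" if h: "h \<in> var_ideal V" for h h'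
    unfolding multipartite_def
  proof (rule mult_in_supported, rule CollectI)
    fix s t assume st: "s \<in> keys (\<psi> h)" "t \<in> keys (\<phi> h')"
    have "keys s \<inter> V \<noteq> {}" using h st(1)
      by (auto simp: \<psi>_def keys_restr var_ideal_def supported_def)
    then obtain x where x: "x \<in> keys s" "x \<in> V" by blast
    have "x \<notin> part V c k" using st(1) x by (auto simp: \<psi>_def keys_restr)
    then have "c x \<noteq> k" using x by (simp add: part_def)
    obtain y where y: "y \<in> keys t" "y \<in> part V c k"
      using st(2) by (auto simp: \<phi>_def keys_restr)
    have "c x \<noteq> c y" "y \<in> V" using y(2) \<open>c x \<noteq> k\<close> by (auto simp: part_def)
    then show "\<exists>x\<in>keys (s + t) \<inter> V. \<exists>y\<in>keys (s + t) \<inter> V. c x \<noteq> c y"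
      using x y(1) by (intro bexI[of _ x] bexI[of _ y]) (auto simp: keys_add_nat)
  qed
  have split: "h = \<phi> h + \<psi> h" for h unfolding \<phi>_def \<psi>_def by (rule restr_compl)
  have "g * \<phi> f - f * \<phi> g = (\<phi> g + \<psi> g) * \<phi> f - (\<phi> f + \<psi> f) * \<phi> g"
    using split[of f] split[of g] by simp
  also have "\<dots> = \<psi> g * \<phi> f - \<psi> f * \<phi> g" by (simp add: algebra_simps)
  finally show ?thesis
    using ideal_diff[OF hom_idealD(1)[OF hom_ideal_multipartite] mixed[OF fg(2)] mixed[OF fg(1)]] by simp
qed

lemma quot_depth_geD:
  assumes "enat (Suc n) \<le> quot_depth A B"
  shows "\<exists>fs. Suc n \<le> length fs \<and> (\<forall>f\<in>set fs. \<exists>d>0. f \<in> homogeneous d) \<and> rel_regular A B fs"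
proof (rule ccontr)
  assume *: "\<not> ?thesis"
  have "quot_depth A B \<le> enat n"
    unfolding quot_depth_def
  proof (rule Sup_least)
    fix e
    assume "e \<in> {enat (length fs) | fs. (\<forall>f\<in>set fs. \<exists>d>0. f \<in> homogeneous d) \<and> rel_regular A B fs}"
    then obtain fs where fs: "e = enat (length fs)"
      "\<forall>f\<in>set fs. \<exists>d>0. f \<in> homogeneous d" "rel_regular A B fs" by blast
    have "\<not> Suc n \<le> length fs" using fs * by blast
    then show "e \<le> enat n" using fs(1) by simp
  qed
  with assms show False by (metis Suc_n_not_le_n enat_ord_simps(1) order_trans)
qed

text \<open>With no variable outside \<open>V\<close>, homogeneous elements of positive degree lie in the ideal
  generated by \<open>V\<close>; with one, depth at least \<open>3\<close> provides the triple to which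
  \<open>regular_pair_in_var_ideal\<close> applies.\<close>

lemma regular_pair_from_depth:
  fixes A B :: "('v::finite, 'k::field) mpoly set"
  assumes A: "hom_ideal A" and B: "hom_ideal B" "B \<subseteq> A"
    and V: "card (UNIV - V) \<le> 1" and d: "enat (2 + card (UNIV - V)) \<le> quot_depth A B"
  shows "\<exists>u\<in>var_ideal V. \<exists>v\<in>var_ideal V. reg2 A B u v"
proof -
  obtain fs where fs: "2 + card (UNIV - V) \<le> length fs"
    "\<forall>f\<in>set fs. \<exists>d>0. f \<in> homogeneous d" "rel_regular A B fs"
    using quot_depth_geD[of "1 + card (UNIV - V)" A B] d by auto
  have hom: "\<exists>d>0. fs ! i \<in> homogeneous d" if "i < length fs" for i using fs(2) that by simp
  have nz: "nzd (fs ! i) A (rmult A B (take i fs))" if "i < length fs" for i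
    using fs(3) that by (simp add: rel_regular_def nzd_def)
  have len: "0 < length fs" "1 < length fs" using fs(1) by auto
  have take1: "take 1 fs = [fs ! 0]" using len take_Suc_conv_app_nth[of 0 fs] by simp
  have n0: "nzd (fs ! 0) A B" using nz[OF len(1)] by simp
  have n1: "nzd (fs ! 1) A (rmult A B [fs ! 0])" using nz[OF len(2)] take1 by simp
  obtain a where a: "0 < a" "fs ! 0 \<in> homogeneous a" using hom[OF len(1)] by blast
  obtain b where b: "0 < b" "fs ! 1 \<in> homogeneous b" using hom[OF len(2)] by blast
  show ?thesis
  proof (cases "V = UNIV")
    case True
    have "fs ! 0 \<in> var_ideal V" "fs ! 1 \<in> var_ideal V"
      unfolding True using homogeneous_in_var_ideal[OF a(2,1)] homogeneous_in_var_ideal[OF b(2,1)] by auto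
    then show ?thesis using n0 n1 unfolding reg2_def by blast
  next
    case False
    then have "card (UNIV - V) \<noteq> 0" by auto
    then have 1: "card (UNIV - V) = 1" using V by linarith
    then obtain t where "UNIV - V = {t}" by (auto simp: card_1_singleton_iff)
    then have t: "V = UNIV - {t}" by blast
    have len2: "2 < length fs" using fs(1) 1 by simp
    have take2: "take 2 fs = [fs ! 0, fs ! 1]"
      using take_Suc_conv_app_nth[OF len(2)] take1 by (simp add: numeral_2_eq_2)
    have "rmult A B (take 2 fs) = rmult A (rmult A B [fs ! 0]) [fs ! 1]"
      unfolding take2 using rmult_append[of A B "[fs ! 0]" "[fs ! 1]"] rmult_commute[of A B "fs ! 0" "fs ! 1"] by simp
    then have "reg2 A (rmult A B [fs ! 0]) (fs ! 1) (fs ! 2)"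
      using n1 nz[OF len2] unfolding reg2_def by simp
    moreover obtain c where c: "0 < c" "fs ! 2 \<in> homogeneous c" using hom[OF len2] by blast
    ultimately show ?thesis
      unfolding t using regular_pair_in_var_ideal[OF A B a(2,1) b(2,1) c(2,1) n0] by blast
  qed
qed

text \<open>Suppose the parts \<open>k\<close> and \<open>l\<close> are both large. The pieces of the filtration of small dimension
  are killed by elements outside the primes of these two parts, so the ideal that the
  filtration reaches by them lies in both primes. All later pieces have depth at least \<open>2\<close> with
  respect to the ideal generated by \<open>V\<close>, so every homomorphism from that ideal to such a piece is a multiplication. Hence the
  homomorphism \<open>\<phi>\<close>, which acts as \<open>1\<close> on the part \<open>k\<close> and as \<open>0\<close> on the part \<open>l\<close>, is
  multiplication by some \<open>b\<close> modulo both primes. But then \<open>b\<close> is congruent to \<open>1\<close> modulo one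
  of them and to \<open>0\<close> modulo the other, although their sum is a proper ideal.\<close>

theorem SCM_multipartite_imp:
  fixes c :: "'v::finite \<Rightarrow> 'c"
  assumes scm: "SCM (multipartite V c :: ('v, 'k::field) mpoly set)"
    and V: "card (UNIV - V) \<le> 1"
    and ab: "2 \<le> card (part V c k)" "2 \<le> card (part V c l)" "k \<noteq> l"
  shows False
proof -
  define J :: "('v, 'k) mpoly set" where "J = multipartite V c"
  define \<phi> where "\<phi> = (restr (\<lambda>u. keys u \<inter> part V c k \<noteq> {}) :: ('v, 'k) mpoly \<Rightarrow> _)"
  define w where "w = 2 + card (UNIV - V)"
  obtain r I where "scm_filtration J r I"
    using scm SCM_iff_filtration[OF hom_ideal_multipartite] unfolding J_def by blast
  then have I: "I 0 = J" "I r = UNIV" "\<And>i. i \<le> r \<Longrightarrow> hom_ideal (I i)"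
    "\<And>i. i < r \<Longrightarrow> I i \<subset> I (Suc i)"
    "\<And>i. i < r \<Longrightarrow> quot_depth (I (Suc i)) (I i) = quot_dim (I (Suc i)) (I i)"
    "\<And>i. Suc i < r \<Longrightarrow> quot_dim (I (Suc i)) (I i) < quot_dim (I (Suc (Suc i))) (I (Suc i))"
    unfolding scm_filtration_def by blast+
  note id = hom_idealD(1)[OF I(3)]
  have JI: "J \<subseteq> I i" if "i \<le> r" for i
    using that
  proof (induction i)
    case (Suc i)
    then show ?case using I(4)[of i] by auto
  qed (simp add: I(1))
  \<comment> \<open>The first step whose quotient has dimension at least \<open>w\<close>. By monotonicity, all later steps
    have this property as well.\<close>
  define m where "m = (LEAST i. i = r \<or> enat w \<le> quot_dim (I (Suc i)) (I i))"
  have m: "m = r \<or> enat w \<le> quot_dim (I (Suc m)) (I m)"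
    unfolding m_def by (rule LeastI[of _ r]) simp
  have "m \<le> r" unfolding m_def by (rule Least_le) simp
  have low: "\<not> enat w \<le> quot_dim (I (Suc i)) (I i)" if "i < m" for i
    using not_less_Least[of i] that unfolding m_def by blast
  have high: "enat w \<le> quot_dim (I (Suc i)) (I i)" if "m \<le> i" "i < r" for i
    using that
  proof (induction rule: dec_induct)
    case base
    then show ?case using m by auto
  next
    case (step n)
    then show ?case using I(6)[of n] by (auto intro: order_trans less_imp_le)
  qed
  \<comment> \<open>The part of small dimension lies in every component of large dimension.\<close>
  have small: "I i \<subseteq> var_ideal (V - part V c j)" if i: "i \<le> m" and j: "2 \<le> card (part V c j)" for i j
    using i
  proof (induction i)
    case 0
    show ?case unfolding I(1) J_def by (rule multipartite_subset_var_ideal)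
  next
    case (Suc i)
    have "card (part V c j) + card (UNIV - V) = card (part V c j \<union> (UNIV - V))"
      by (rule card_Un_disjoint[symmetric]) (auto simp: part_def)
    also have "part V c j \<union> (UNIV - V) = UNIV - (V - part V c j)" by (auto simp: part_def)
    finally have "w \<le> card (UNIV - (V - part V c j))" using j by (simp add: w_def)
    then have "\<not> ann (I (Suc i)) (I i) \<subseteq> var_ideal (V - part V c j)"
      using quot_dim_ge[of "I (Suc i)" "I i" "V - part V c j"] low[of i] Suc.prems
      by (meson Suc_le_lessD enat_ord_simps(1) order_trans)
    then obtain s where s: "s \<in> ann (I (Suc i)) (I i)" "s \<notin> var_ideal (V - part V c j)" by blast
    show ?case
    proof
      fix f assume "f \<in> I (Suc i)"
      then have "s * f \<in> I i" using s(1) by (simp add: ann_def)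
      then have "s * f \<in> var_ideal (V - part V c j)" using Suc by auto
      then show "f \<in> var_ideal (V - part V c j)" using s(2) by (rule var_ideal_cancel)
    qed
  qed
  \<comment> \<open>Above step \<open>m\<close> the map \<open>\<phi>\<close> is a multiplication modulo each ideal of the filtration. Going down
    one step, the error \<open>\<psi>\<close> maps to a quotient with a regular pair, so it is a multiplication too.\<close>
  have descend: "\<exists>b. \<forall>z\<in>var_ideal V. \<phi> z - z * b \<in> I i" if "m \<le> i" "i \<le> r" for i
    using that(2,1)
  proof (induction rule: inc_induct)
    case base
    show ?case by (simp add: I(2))
  next
    case (step i)
    then obtain b where b: "\<forall>z\<in>var_ideal V. \<phi> z - z * b \<in> I (Suc i)" by auto
    define A B where "A = I (Suc i)" and "B = I i"
    have hA: "hom_ideal A" and hB: "hom_ideal B" and BA: "B \<subseteq> A"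
      using I(3)[of i] I(3)[of "Suc i"] I(4)[of i] step.hyps by (auto simp: A_def B_def)
    note iA = hom_idealD(1)[OF hA] and iB = hom_idealD(1)[OF hB]
    have "enat w \<le> quot_depth A B"
      using high[of i] I(5)[of i] step by (simp add: A_def B_def)
    then obtain u v where uv: "u \<in> var_ideal V" "v \<in> var_ideal V" "reg2 A B u v"
      using regular_pair_from_depth[OF hA hB BA V] unfolding w_def by blast
    define \<psi> where "\<psi> z = \<phi> z - z * b" for z
    have \<psi>: "\<psi> z \<in> A" if "z \<in> var_ideal V" for z using b that by (simp add: \<psi>_def A_def)
    have cross: "y * \<psi> z - z * \<psi> y \<in> B" if "y \<in> var_ideal V" "z \<in> var_ideal V" for y z
    proof -
      have "y * \<phi> z - z * \<phi> y \<in> J"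
        unfolding J_def \<phi>_def by (rule part_multiplier_commutes[OF that(2,1)])
      then have "y * \<phi> z - z * \<phi> y \<in> B" using JI[of i] step.hyps by (auto simp: B_def)
      then show ?thesis by (simp add: \<psi>_def algebra_simps)
    qed
    have "u * \<psi> v + (v * \<psi> u - u * \<psi> v) \<in> rmult A B [u]"
      by (intro rmult1I \<psi> uv cross)
    then have "v * \<psi> u \<in> rmult A B [u]" by simp
    then have "\<psi> u \<in> rmult A B [u]"
      using uv(3) \<psi>[OF uv(1)] unfolding reg2_def by (meson nzdD)
    then obtain e e' where e: "e \<in> A" "e' \<in> B" "\<psi> u = u * e + e'" by (rule rmult1E)
    have "\<phi> z - z * (b + e) \<in> B" if z: "z \<in> var_ideal V" for z
    proof -
      have "(u * \<psi> z - z * \<psi> u) + z * e' \<in> B"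
        by (intro ideal_add iB cross uv z ideal_mult e)
      moreover have "u * (\<psi> z - z * e) = (u * \<psi> z - z * \<psi> u) + z * e'"
        by (simp add: e(3) algebra_simps)
      ultimately have "u * (\<psi> z - z * e) \<in> B" by simp
      moreover have "\<psi> z - z * e \<in> A" by (intro ideal_diff iA \<psi> z ideal_mult e)
      ultimately have "\<psi> z - z * e \<in> B" using uv(3) unfolding reg2_def by (meson nzdD)
      then show ?thesis by (simp add: \<psi>_def algebra_simps)
    qed
    then show ?case unfolding B_def by blast
  qed
  obtain b where b: "\<And>z. z \<in> var_ideal V \<Longrightarrow> \<phi> z - z * b \<in> I m"
    using descend[of m] \<open>m \<le> r\<close> by blast
  obtain x where x: "x \<in> part V c k" using ab(1) by fastforce
  obtain y where y: "y \<in> part V c l" using ab(2) by fastforce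
  have "\<phi> (Var x) = Var x" "\<phi> (Var y) = 0"
    unfolding \<phi>_def using x y ab(3) by (auto simp: Var_def mon_def part_def intro!: restr_id restr_eq_0)
  moreover have "(Var x :: ('v, 'k) mpoly) \<in> var_ideal V" "(Var y :: ('v, 'k) mpoly) \<in> var_ideal V"
    using x y by (auto simp: part_def)
  ultimately have bx: "Var x - Var x * b \<in> I m" and by': "0 - Var y * b \<in> I m"
    using b[of "Var x"] b[of "Var y"] by simp_all
  have "Var x * (1 - b) \<in> var_ideal (V - part V c k)"
    using small[of m k] ab(1) bx by (auto simp: algebra_simps)
  then have 1: "1 - b \<in> var_ideal (V - part V c k)"
    by (rule var_ideal_cancel_Var) (use x in simp)
  have "- (0 - Var y * b) \<in> var_ideal (V - part V c l)"
    using small[of m l] ab(2) by' by (intro ideal_minus ideal_var_ideal) auto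
  then have "Var y * b \<in> var_ideal (V - part V c l)" by simp
  then have 2: "b \<in> var_ideal (V - part V c l)"
    by (rule var_ideal_cancel_Var) (use y in simp)
  have up: "f \<in> var_ideal UNIV" if "f \<in> var_ideal C" for f :: "('v, 'k) mpoly" and C
    using that by (rule subsetD[OF iffD2[OF var_ideal_subset_iff subset_UNIV]])
  have "(1 - b) + b \<in> var_ideal UNIV"
    by (rule ideal_add[OF ideal_var_ideal up[OF 1] up[OF 2]])
  then show False by simp
qed

section \<open>Cohen-Macaulay quotients: sufficiency of the condition on parts\<close>

lemma quot_depth_ge:
  assumes "\<And>f. f \<in> set fs \<Longrightarrow> f \<in> homogeneous 1" "rel_regular A B fs"
  shows "enat (length fs) \<le> quot_depth A B"
  unfolding quot_depth_def
proof (rule Sup_upper, rule CollectI, intro exI conjI ballI)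
  show "enat (length fs) = enat (length fs)" ..
  show "rel_regular A B fs" by fact
  show "0 < (1::nat)" by simp
  show "f \<in> homogeneous 1" if "f \<in> set fs" for f using assms(1) that .
qed

lemma Var_homogeneous: "(Var v :: ('v::finite, 'k::field) mpoly) \<in> homogeneous 1"
proof -
  have "(\<Sum>x\<in>UNIV. lookup (single v (1::nat)) x) = 1" for v :: "'a::finite"
    by (simp add: lookup_single when_def)
  then show ?thesis by (simp add: homogeneous_def Var_def mon_def mono_degree_def)
qed

text \<open>Nakayama for graded modules: if \<open>A / B\<close> were equal to its submodule of multiples of linear
  forms, its nonzero component of least degree would vanish.\<close>

lemma rmult_linear_neq:
  fixes A B :: "('v::finite, 'k::field) mpoly set"
  assumes A: "hom_ideal A" and B: "hom_ideal B" and AB: "\<not> A \<subseteq> B"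
    and fs: "\<And>f. f \<in> set fs \<Longrightarrow> f \<in> homogeneous 1"
  shows "rmult A B fs \<noteq> A"
proof
  assume eq: "rmult A B fs = A"
  note A' = hom_idealD(1)[OF A] and B' = hom_idealD(1)[OF B]
  have step: "hcomp d f \<in> B"
    if "f \<in> rmult A B gs" "\<And>g. g \<in> set gs \<Longrightarrow> g \<in> homogeneous 1" "\<And>e a. e < d \<Longrightarrow> a \<in> A \<Longrightarrow> hcomp e a \<in> B"
    for f d gs
    using that
  proof (induction gs arbitrary: f)
    case Nil
    then show ?case using hom_idealD(2)[OF B] by simp
  next
    case (Cons g gs)
    then obtain a b where ab: "a \<in> A" "b \<in> rmult A B gs" "f = g * a + b" by auto
    have g: "g \<in> homogeneous 1" using Cons.prems(2) by simp
    have "hcomp d b \<in> B" using Cons.IH[OF ab(2)] Cons.prems(2,3) by simp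
    moreover have "(if 1 \<le> d then g * hcomp (d - 1) a else 0) \<in> B"
      using Cons.prems(3)[of "d - 1" a] ab(1) ideal_zero[OF B'] ideal_mult[OF B'] by simp
    moreover have "hcomp d f = (if 1 \<le> d then g * hcomp (d - 1) a else 0) + hcomp d b"
      unfolding ab(3) restr_add hcomp_mult[OF g] ..
    ultimately show ?case using ideal_add[OF B'] by presburger
  qed
  have all: "hcomp d a \<in> B" if "a \<in> A" for d a
    using that
  proof (induction d arbitrary: a rule: less_induct)
    case (less d)
    then show ?case using step[of a fs d] eq fs by simp
  qed
  have "A \<subseteq> B"
  proof
    fix a assume a: "a \<in> A"
    have "(\<Sum>d\<in>mono_degree ` keys a. hcomp d a) \<in> B"
      using all[OF a] by (intro ideal_sum[OF B'])
    then show "a \<in> B" using sum_hcomp[of a] by simp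
  qed
  then show False using AB by blast
qed

lemma rmult_var_ideal:
  "rmult UNIV (var_ideal C) (map Var vs) = (var_ideal (C \<union> set vs) :: ('v::finite, 'k::field) mpoly set)"
proof (induction vs)
  case (Cons v vs)
  let ?D = "C \<union> set vs"
  have main: "rmult UNIV (var_ideal ?D) [Var v] = (var_ideal (insert v ?D) :: ('v, 'k) mpoly set)"
  proof
    show "rmult UNIV (var_ideal ?D) [Var v] \<subseteq> (var_ideal (insert v ?D) :: ('v, 'k) mpoly set)"
    proof
      fix f :: "('v, 'k) mpoly" assume "f \<in> rmult UNIV (var_ideal ?D) [Var v]"
      then obtain a b where ab: "b \<in> var_ideal ?D" "f = Var v * a + b" by (rule rmult1E)
      have "b \<in> var_ideal (insert v ?D)" using ab(1)
        by (rule subsetD[OF iffD2[OF var_ideal_subset_iff subset_insertI]])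
      then show "f \<in> var_ideal (insert v ?D)"
        unfolding ab(2) by (intro ideal_add ideal_mult2 ideal_var_ideal) simp_all
    qed
    have id: "is_ideal (rmult UNIV (var_ideal ?D) [Var v] :: ('v, 'k) mpoly set)"
      by (intro rmult_ideal ideal_UNIV ideal_var_ideal) simp
    show "(var_ideal (insert v ?D) :: ('v, 'k) mpoly set) \<subseteq> rmult UNIV (var_ideal ?D) [Var v]"
      unfolding var_ideal_def[of "insert v ?D"]
    proof (rule supported_subset_ideal[OF id])
      fix u :: "'v \<Rightarrow>\<^sub>0 nat" assume u: "u \<in> {u. keys u \<inter> insert v ?D \<noteq> {}}"
      show "(mon u :: ('v, 'k) mpoly) \<in> rmult UNIV (var_ideal ?D) [Var v]"
      proof (cases "keys u \<inter> ?D = {}")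
        case True
        then have "v \<in> keys u" using u by blast
        from single_le_split[OF this] obtain w where "u = single v 1 + w" ..
        then have eq: "mon u = Var v * (mon w :: ('v, 'k) mpoly)" by (simp add: Var_def mon_mult)
        show ?thesis unfolding eq by (rule rmult1_mult[OF UNIV_I ideal_var_ideal])
      next
        case False
        then have "(mon u :: ('v, 'k) mpoly) \<in> var_ideal ?D" by (simp add: var_ideal_def)
        then show ?thesis
          by (rule subsetD[OF rmult_ideal(2)[OF ideal_UNIV ideal_var_ideal subset_UNIV]])
      qed
    qed
  qed
  have "rmult UNIV (var_ideal C) (map Var (v # vs)) =
      (rmult UNIV (rmult UNIV (var_ideal C) (map Var vs)) [Var v] :: ('v, 'k) mpoly set)"
    by (simp only: rmult.simps list.map)
  also have "\<dots> = rmult UNIV (var_ideal ?D) [Var v]" by (simp only: Cons)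
  also note main
  also have "insert v ?D = C \<union> set (v # vs)" by simp
  finally show ?case .
qed simp

text \<open>The quotient is a polynomial ring in the variables outside \<open>C\<close>, and these form a regular
  sequence.\<close>

lemma var_ideal_quotient:
  fixes C :: "'v::finite set"
  defines "P \<equiv> (var_ideal C :: ('v, 'k::field) mpoly set)"
  shows "quot_dim UNIV P = enat (card (UNIV - C))" "quot_depth UNIV P = enat (card (UNIV - C))"
proof -
  have ann: "ann UNIV P = P"
  proof
    show "ann UNIV P \<subseteq> P" unfolding ann_def by (metis (mono_tags, lifting) UNIV_I mem_Collect_eq mult_1_right subsetI)
    show "P \<subseteq> ann UNIV P" unfolding ann_def P_def using ideal_mult2[OF ideal_var_ideal] by blast
  qed
  have nonface: "mon u \<in> ann UNIV P" if "\<forall>U\<in>{UNIV - C}. \<not> keys u \<subseteq> U" for u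
    using that unfolding ann unfolding P_def var_ideal_def by auto
  have c: "card U \<le> card (UNIV - C)" if "U \<in> {UNIV - C}" for U using that by simp
  show "quot_dim UNIV P = enat (card (UNIV - C))"
    by (rule antisym, rule quot_dim_le[OF nonface c], assumption+, rule quot_dim_ge) (simp add: ann, simp add: P_def)
  obtain ys where ys: "set ys = UNIV - C" "distinct ys" using finite_distinct_list[of "UNIV - C"] by auto
  have len: "length ys = card (UNIV - C)" using distinct_card[OF ys(2)] ys(1) by simp
  have "rel_regular UNIV P (map Var ys)"
    unfolding rel_regular_def
  proof (intro conjI allI impI ballI)
    fix i a assume i: "i < length (map Var ys)" and "map Var ys ! i * a \<in> rmult UNIV P (take i (map Var ys))"
    then have "Var (ys ! i) * a \<in> var_ideal (C \<union> set (take i ys))"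
      by (simp add: P_def take_map rmult_var_ideal)
    moreover have "ys ! i \<notin> C \<union> set (take i ys)"
    proof
      assume "ys ! i \<in> C \<union> set (take i ys)"
      then have "ys ! i \<in> set (take i ys)" using ys(1) nth_mem[of i ys] i by auto
      then show False using ys(2) i by (auto simp: in_set_conv_nth nth_eq_iff_index_eq)
    qed
    ultimately have "a \<in> var_ideal (C \<union> set (take i ys))"
      by (rule var_ideal_cancel_Var)
    then show "a \<in> rmult UNIV P (take i (map Var ys))" by (simp add: P_def take_map rmult_var_ideal)
  next
    have "1 \<notin> rmult UNIV P (map Var ys)" by (simp add: P_def rmult_var_ideal)
    then show "rmult UNIV P (map Var ys) \<noteq> UNIV" by auto
  qed
  then have "enat (length (map Var ys :: ('v, 'k) mpoly list)) \<le> quot_depth UNIV P"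
    by (intro quot_depth_ge) (auto simp: Var_homogeneous simp del: One_nat_def)
  then have "enat (card (UNIV - C)) \<le> quot_depth UNIV P" by (simp add: len)
  moreover have "quot_depth UNIV P \<le> enat (card (UNIV - C))"
    by (rule quot_depth_le[OF ideal_UNIV _ _ nonface c]) (auto simp: P_def ideal_var_ideal)
  ultimately show "quot_depth UNIV P = enat (card (UNIV - C))" by (rule antisym[rotated])
qed

lemma divide_Var:
  fixes f :: "('v::finite, 'k::field) mpoly"
  assumes "\<And>u. u \<in> keys f \<Longrightarrow> t \<in> keys u"
  shows "\<exists>g. f = Var t * g"
proof -
  have "f = (\<Sum>u\<in>keys f. const (lookup f u) * mon u)" by (rule mpoly_as_sum)
  also have "\<dots> = (\<Sum>u\<in>keys f. Var t * (const (lookup f u) * mon (u - single t 1)))"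
  proof (rule sum.cong[OF refl])
    fix u assume "u \<in> keys f"
    from single_le_split[OF assms[OF this]] obtain w where w: "u = single t 1 + w" ..
    then have "mon u = Var t * (mon w :: ('v, 'k) mpoly)" "u - single t 1 = w"
      by (simp_all add: Var_def mon_mult)
    then show "const (lookup f u) * mon u =
        Var t * (const (lookup f u) * mon (u - single t 1))"
      by (simp add: mult.left_commute)
  qed
  also have "\<dots> = Var t * (\<Sum>u\<in>keys f. const (lookup f u) * mon (u - single t 1))"
    by (rule sum_distrib_left[symmetric])
  finally show ?thesis by blast
qed

lemma Var_cancel:
  assumes "Var t * (g :: ('v::finite, 'k::field) mpoly) = 0" shows "g = 0"
proof -
  have "h \<in> var_ideal {} \<longleftrightarrow> h = 0" for h :: "('v, 'k) mpoly"
    by (simp add: var_ideal_def supported_def)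
  then show ?thesis using assms var_ideal_cancel_Var[of t g "{}"] by simp
qed

lemma keys_Var_mult: "u \<in> keys (Var t * g) \<Longrightarrow> t \<in> keys u"
  using keys_mult[of "Var t" g] by (auto simp: Var_def mon_def keys_add_nat)

text \<open>Here \<open>A / J\<close> embeds into the product of the quotients by the primes of the singleton parts
  \<open>k \<in> K\<close>. A regular sequence consists of the sum \<open>\<sigma>\<close> of the variables of these parts, which lies in
  none of the primes, and of the variable \<open>t\<close> outside \<open>V\<close>, if there is one.\<close>

lemma thin_quotient:
  fixes A :: "('v::finite, 'k::field) mpoly set" and V :: "'v set" and c :: "'v \<Rightarrow> 'c"
  defines "J \<equiv> (multipartite V c :: ('v, 'k) mpoly set)"
  assumes V: "card (UNIV - V) \<le> 1"
    and A: "is_ideal A" "J \<subseteq> A" and Ar: "\<And>P f. f \<in> A \<Longrightarrow> restr P f \<in> A"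
    and At: "\<And>t f. t \<notin> V \<Longrightarrow> Var t * f \<in> A \<Longrightarrow> f \<in> A"
    and thin: "\<And>k. k \<in> K \<Longrightarrow> card (part V c k) = 1"
    and inter: "\<And>f. f \<in> A \<Longrightarrow> (\<And>k. k \<in> K \<Longrightarrow> f \<in> var_ideal (V - part V c k)) \<Longrightarrow> f \<in> J"
    and l: "l \<in> K" "\<not> A \<subseteq> var_ideal (V - part V c l)"
  shows "quot_dim A J = enat (1 + card (UNIV - V))" "quot_depth A J = enat (1 + card (UNIV - V))"
proof -
  define \<Delta> where "\<Delta> = (\<lambda>k. part V c k \<union> (UNIV - V)) ` K"
  have Jh: "hom_ideal J" unfolding J_def by (rule hom_ideal_multipartite)
  note J = hom_idealD(1)[OF Jh]
  have Ah: "hom_ideal A" using A Ar by (simp add: hom_ideal_def)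
  have JP: "f \<in> var_ideal (V - part V c k)" if "f \<in> J" for f k
    using that unfolding J_def by (rule subsetD[OF multipartite_subset_var_ideal])
  have card_eq: "card (part V c k \<union> (UNIV - V)) = 1 + card (UNIV - V)" if "k \<in> K" for k
    using thin[OF that] by (subst card_Un_disjoint) (auto simp: part_def)
  have c: "card U \<le> 1 + card (UNIV - V)" if "U \<in> \<Delta>" for U
    using that card_eq by (auto simp: \<Delta>_def)
  have nonface: "mon u \<in> ann A J" if u: "\<forall>U\<in>\<Delta>. \<not> keys u \<subseteq> U" for u
    unfolding ann_def
  proof (rule CollectI, rule ballI, rule inter)
    fix a assume a: "a \<in> A"
    then show "mon u * a \<in> A" by (rule ideal_mult[OF A(1)])
    fix k assume "k \<in> K"
    then have "keys u \<inter> (V - part V c k) \<noteq> {}" using u by (auto simp: \<Delta>_def)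
    then have "(mon u :: ('v, 'k) mpoly) \<in> var_ideal (V - part V c k)" by (simp add: var_ideal_def)
    then show "mon u * a \<in> var_ideal (V - part V c k)" by (rule ideal_mult2[OF ideal_var_ideal])
  qed
  obtain p where p: "p \<in> A" "p \<notin> var_ideal (V - part V c l)" using l(2) by blast
  have "ann A J \<subseteq> var_ideal (V - part V c l)"
  proof
    fix s assume "s \<in> ann A J"
    then have "s * p \<in> J" using p(1) by (simp add: ann_def)
    then have "p * s \<in> var_ideal (V - part V c l)" using JP[of "s * p" l] by (simp add: mult.commute)
    then show "s \<in> var_ideal (V - part V c l)" using p(2) by (rule var_ideal_cancel)
  qed
  then have "enat (card (UNIV - (V - part V c l))) \<le> quot_dim A J" by (rule quot_dim_ge)
  moreover have "UNIV - (V - part V c l) = part V c l \<union> (UNIV - V)" by (auto simp: part_def)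
  ultimately have "enat (1 + card (UNIV - V)) \<le> quot_dim A J" using card_eq[OF l(1)] by simp
  moreover have "quot_dim A J \<le> enat (1 + card (UNIV - V))" by (rule quot_dim_le[OF nonface c])
  ultimately show "quot_dim A J = enat (1 + card (UNIV - V))" by (rule antisym[rotated])
  define \<sigma> where "\<sigma> = (\<Sum>v | v \<in> V \<and> c v \<in> K. Var v :: ('v, 'k) mpoly)"
  have \<sigma>_lookup: "lookup \<sigma> (single v 1) = (if v \<in> V \<and> c v \<in> K then 1 else 0)" for v
  proof -
    have "single x (1::nat) = single v 1 \<longleftrightarrow> x = v" for x
      by (metis lookup_single_eq lookup_single_not_eq one_neq_zero)
    then show ?thesis by (simp add: \<sigma>_def lookup_sum Var_def mon_def lookup_single when_def)
  qed
  have \<sigma>_keys: "\<exists>v\<in>V. u = single v 1" if "u \<in> keys \<sigma>" for u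
  proof (rule ccontr)
    assume *: "\<not> ?thesis"
    have "lookup \<sigma> u = 0"
      unfolding \<sigma>_def lookup_sum
      by (rule sum.neutral) (use * in \<open>auto simp: Var_def mon_def lookup_single when_def\<close>)
    then show False using that by (simp add: in_keys_iff)
  qed
  have \<sigma>_hom: "\<sigma> \<in> homogeneous 1"
  proof -
    have "mono_degree u = 1" if "u \<in> keys \<sigma>" for u
    proof -
      from \<sigma>_keys[OF that] obtain v where v: "u = single v 1" by (elim bexE)
      show ?thesis
        using Var_homogeneous[of v, where 'k = 'k] unfolding v homogeneous_def Var_def mon_def by simp
    qed
    then show ?thesis by (simp add: homogeneous_def)
  qed
  have \<sigma>_notin: "\<sigma> \<notin> var_ideal (V - part V c k)" if k: "k \<in> K" for k
  proof
    assume s: "\<sigma> \<in> var_ideal (V - part V c k)"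
    obtain v where v: "part V c k = {v}" using thin[OF k] by (auto simp: card_1_singleton_iff)
    then have "v \<in> V" "c v = k" by (auto simp: part_def)
    then have "single v 1 \<in> keys \<sigma>" using \<sigma>_lookup[of v] k by (simp add: in_keys_iff)
    then have "keys (single v (1::nat)) \<inter> (V - part V c k) \<noteq> {}"
      using s unfolding var_ideal_def supported_def by blast
    then show False using v by simp
  qed
  have nzd\<sigma>: "nzd \<sigma> A J"
    unfolding nzd_def
  proof (intro ballI impI)
    fix a assume a: "a \<in> A" "\<sigma> * a \<in> J"
    show "a \<in> J"
    proof (rule inter[OF a(1)])
      fix k assume "k \<in> K"
      then show "a \<in> var_ideal (V - part V c k)" by (rule var_ideal_cancel[OF JP[OF a(2)] \<sigma>_notin])
    qed
  qed
  \<comment> \<open>Setting \<open>t\<close> to \<open>0\<close> commutes with multiplication by \<open>\<sigma>\<close> and preserves \<open>A\<close> and \<open>J\<close>, so a relation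
    \<open>t x = \<sigma> p + j\<close> can be divided by \<open>t\<close>.\<close>
  have nzdt: "nzd (Var t) A (rmult A J [\<sigma>])" if t: "t \<notin> V" for t
    unfolding nzd_def
  proof (intro ballI impI)
    fix x assume x: "x \<in> A" "Var t * x \<in> rmult A J [\<sigma>]"
    obtain p j where pj: "p \<in> A" "j \<in> J" "Var t * x = \<sigma> * p + j" using x(2) by (rule rmult1E)
    define \<pi> where "\<pi> = (restr (\<lambda>u. t \<notin> keys u) :: ('v, 'k) mpoly \<Rightarrow> _)"
    have dec: "\<exists>g. f = \<pi> f + Var t * g" for f
    proof -
      have "\<exists>g. restr (\<lambda>u. \<not> t \<notin> keys u) f = Var t * g"
        by (rule divide_Var) (simp add: keys_restr)
      then obtain g where "restr (\<lambda>u. \<not> t \<notin> keys u) f = Var t * g" by blast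
      then have "f = \<pi> f + Var t * g" unfolding \<pi>_def using restr_compl[of f "\<lambda>u. t \<notin> keys u"] by simp
      then show ?thesis by blast
    qed
    obtain p' where p': "p = \<pi> p + Var t * p'" using dec by blast
    obtain j' where j': "j = \<pi> j + Var t * j'" using dec by blast
    have \<pi>t: "\<pi> (Var t * g) = 0" for g
      unfolding \<pi>_def by (rule restr_eq_0) (use keys_Var_mult in blast)
    have eq: "Var t * x = (\<sigma> * \<pi> p + \<pi> j) + Var t * (\<sigma> * p' + j')"
    proof -
      have "\<sigma> * p + j = \<sigma> * (\<pi> p + Var t * p') + (\<pi> j + Var t * j')" using p' j' by simp
      then show ?thesis unfolding pj(3) by (simp add: algebra_simps)
    qed
    have "\<pi> (\<sigma> * \<pi> p + \<pi> j) = \<sigma> * \<pi> p + \<pi> j"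
      unfolding \<pi>_def
    proof (rule restr_id)
      fix u assume "u \<in> keys (\<sigma> * restr (\<lambda>u. t \<notin> keys u) p + restr (\<lambda>u. t \<notin> keys u) j)"
      then have "u \<in> keys (\<sigma> * restr (\<lambda>u. t \<notin> keys u) p) \<union>
          keys (restr (\<lambda>u. t \<notin> keys u) j)"
        by (rule subsetD[OF Poly_Mapping.keys_add])
      then consider "u \<in> keys (\<sigma> * restr (\<lambda>u. t \<notin> keys u) p)"
        | "u \<in> keys (restr (\<lambda>u. t \<notin> keys u) j)"
        by (elim UnE)
      then show "t \<notin> keys u"
      proof cases
        case 1
        then obtain s w where "s \<in> keys \<sigma>" "t \<notin> keys w" "u = s + w"
          using keys_mult[of \<sigma> "restr (\<lambda>u. t \<notin> keys u) p"] by (auto simp: keys_restr)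
        moreover from this obtain v where "v \<in> V" "s = single v 1" using \<sigma>_keys by blast
        ultimately show ?thesis using t by (auto simp: keys_add_nat)
      qed (simp add: keys_restr)
    qed
    moreover have "\<pi> (Var t * x) = \<pi> (\<sigma> * \<pi> p + \<pi> j) + \<pi> (Var t * (\<sigma> * p' + j'))"
      unfolding eq by (simp add: \<pi>_def restr_add)
    ultimately have "\<sigma> * \<pi> p + \<pi> j = 0" by (simp add: \<pi>t)
    then have "Var t * (x - (\<sigma> * p' + j')) = 0" using eq by (simp add: algebra_simps)
    then have "x - (\<sigma> * p' + j') = 0" by (rule Var_cancel)
    then have x_eq: "x = \<sigma> * p' + j'" by simp
    have "Var t * p' = p - \<pi> p" "Var t * j' = j - \<pi> j" using p' j' by (metis add_diff_cancel_left')+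
    moreover have "p - \<pi> p \<in> A" unfolding \<pi>_def by (intro ideal_diff A pj Ar)
    moreover have "j - \<pi> j \<in> J"
    proof -
      have "\<pi> j \<in> J" using pj(2) unfolding \<pi>_def J_def multipartite_def by (rule restr_supported)
      then show ?thesis using ideal_diff[OF J pj(2)] by blast
    qed
    ultimately have tp: "Var t * p' \<in> A" "Var t * j' \<in> J" by simp_all
    have "p' \<in> A" using At[OF t tp(1)] .
    moreover have "j' \<in> J"
    proof (rule inter)
      show "j' \<in> A" using At[OF t] tp(2) A(2) by blast
      fix k
      show "j' \<in> var_ideal (V - part V c k)"
        by (rule var_ideal_cancel_Var[OF JP[OF tp(2)]]) (use t in simp)
    qed
    ultimately show "x \<in> rmult A J [\<sigma>]" unfolding x_eq by (rule rmult1I)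
  qed
  have AJ: "\<not> A \<subseteq> J" using p JP by blast
  obtain fs where fs: "length fs = 1 + card (UNIV - V)" "rel_regular A J fs"
    "\<And>f. f \<in> set fs \<Longrightarrow> f \<in> homogeneous 1"
  proof (cases "V = UNIV")
    case True
    have h: "f \<in> homogeneous 1" if "f \<in> set [\<sigma>]" for f using that \<sigma>_hom by simp
    have "rmult A J [\<sigma>] \<noteq> A" by (rule rmult_linear_neq[OF Ah Jh AJ h])
    then have "rel_regular A J [\<sigma>]"
      using nzd\<sigma> unfolding rel_regular_def nzd_def by simp
    then show ?thesis using that[of "[\<sigma>]"] h True by simp
  next
    case False
    then have "card (UNIV - V) \<noteq> 0" by auto
    then have 1: "card (UNIV - V) = 1" using V by linarith
    then obtain t where "UNIV - V = {t}" by (auto simp: card_1_singleton_iff)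
    then have t: "t \<notin> V" by blast
    have h: "f \<in> homogeneous 1" if "f \<in> set [\<sigma>, Var t]" for f
      using that \<sigma>_hom Var_homogeneous[of t] by auto
    have "rel_regular A J [\<sigma>, Var t]"
      unfolding rel_regular_def
    proof (intro conjI allI impI ballI)
      show "rmult A J [\<sigma>, Var t] \<noteq> A" by (rule rmult_linear_neq[OF Ah Jh AJ h])
      fix i a assume i: "i < length [\<sigma>, Var t]" and a: "a \<in> A"
        "[\<sigma>, Var t] ! i * a \<in> rmult A J (take i [\<sigma>, Var t])"
      consider "i = 0" | "i = 1" using i by fastforce
      then show "a \<in> rmult A J (take i [\<sigma>, Var t])"
      proof cases
        case 1
        then show ?thesis using a nzdD[OF nzd\<sigma> a(1)] by simp
      next
        case 2
        then have "Var t * a \<in> rmult A J [\<sigma>]" using a(2) by simp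
        then show ?thesis using nzdD[OF nzdt[OF t] a(1)] 2 by simp
      qed
    qed
    then show ?thesis using that[of "[\<sigma>, Var t]"] h 1 by simp
  qed
  have "enat (1 + card (UNIV - V)) \<le> quot_depth A J" using quot_depth_ge[OF fs(3,2)] fs(1) by simp
  moreover have "quot_depth A J \<le> enat (1 + card (UNIV - V))"
    by (rule quot_depth_le[OF A(1) J A(2) nonface c])
  ultimately show "quot_depth A J = enat (1 + card (UNIV - V))" by (rule antisym[rotated])
qed

text \<open>If all parts are singletons, \<open>R / J\<close> itself is Cohen-Macaulay. Otherwise the filtration is
  \<open>J \<subset> A \<subset> R\<close> with \<open>A\<close> the prime of the large part.\<close>

theorem SCM_multipartiteI:
  fixes c :: "'v::finite \<Rightarrow> 'c"
  assumes V: "card (UNIV - V) \<le> 1"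
    and one: "\<And>k l. 2 \<le> card (part V c k) \<Longrightarrow> 2 \<le> card (part V c l) \<Longrightarrow> k = l"
    and xy: "x \<in> V" "y \<in> V" "c x \<noteq> c y"
  shows "SCM (multipartite V c :: ('v, 'k::field) mpoly set)"
proof -
  define J where "J = (multipartite V c :: ('v, 'k) mpoly set)"
  have Jh: "hom_ideal J" unfolding J_def by (rule hom_ideal_multipartite)
  have JP: "J \<subseteq> var_ideal (V - part V c k)" for k
    unfolding J_def by (rule multipartite_subset_var_ideal)
  have pos: "card (part V c k) = 1 \<or> 2 \<le> card (part V c k)" if "k \<in> c ` V" for k
  proof -
    have "part V c k \<noteq> {}" using that by (auto simp: part_def)
    then have "card (part V c k) \<noteq> 0" by simp
    then show ?thesis by linarith
  qed
  have inter: "f \<in> J" if f: "\<And>k. k \<in> c ` V \<Longrightarrow> f \<in> var_ideal (V - part V c k)" for f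
    unfolding J_def multipartite_def
  proof (rule supportedI, rule CollectI)
    fix u assume u: "u \<in> keys f"
    have ex: "\<exists>v\<in>keys u \<inter> V. c v \<noteq> k" if k: "k \<in> c ` V" for k
    proof -
      have "keys u \<inter> (V - part V c k) \<noteq> {}"
        using f[OF k] u unfolding var_ideal_def supported_def by blast
      then show ?thesis by (auto simp: part_def)
    qed
    obtain v where v: "v \<in> keys u \<inter> V" using ex[of "c x"] xy by blast
    obtain v' where "v' \<in> keys u \<inter> V" "c v' \<noteq> c v" using ex[of "c v"] v by blast
    then show "\<exists>x\<in>keys u \<inter> V. \<exists>y\<in>keys u \<inter> V. c x \<noteq> c y" using v by blast
  qed
  have prim: "f \<in> var_ideal (V - part V c k)" if "t \<notin> V" "Var t * f \<in> var_ideal (V - part V c k)" for t f k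
    using that(2) by (rule var_ideal_cancel_Var) (use that(1) in simp)
  have "\<exists>r I. scm_filtration J r I"
  proof (cases "\<exists>k0\<in>c ` V. 2 \<le> card (part V c k0)")
    case False
    then have thin: "card (part V c k) = 1" if "k \<in> c ` V" for k using pos[OF that] that by blast
    have ne: "\<not> UNIV \<subseteq> (var_ideal (V - part V c (c x)) :: ('v, 'k) mpoly set)"
      using one_notin_var_ideal by blast
    have cx: "c x \<in> c ` V" using xy(1) by simp
    have interU: "f \<in> J" if "f \<in> UNIV" "\<And>k. k \<in> c ` V \<Longrightarrow> f \<in> var_ideal (V - part V c k)" for f
      using that(2) by (rule inter)
    note q = thin_quotient[OF V ideal_UNIV subset_UNIV UNIV_I UNIV_I thin interU[unfolded J_def] cx ne,
        folded J_def]
    have "J \<noteq> UNIV" using JP[of "c x"] ne by auto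
    then have "scm_filtration J 1 (\<lambda>i. if i = 0 then J else UNIV)"
      unfolding scm_filtration_def
      by (intro conjI allI impI) (simp_all add: Jh hom_ideal_UNIV q psubset_eq)
    then show ?thesis by blast
  next
    case True
    then obtain k0 where k0: "k0 \<in> c ` V" "2 \<le> card (part V c k0)" by blast
    define A where "A = (var_ideal (V - part V c k0) :: ('v, 'k) mpoly set)"
    define K where "K = c ` V - {k0}"
    have thin: "card (part V c k) = 1" if "k \<in> K" for k using pos[of k] that one[OF _ k0(2)] by (auto simp: K_def)
    obtain z where z: "z \<in> V" "c z \<noteq> k0" using xy by metis
    then have zK: "c z \<in> K" by (simp add: K_def)
    have zA: "(Var z :: ('v, 'k) mpoly) \<in> A" using z by (simp add: A_def part_def)
    have "(Var z :: ('v, 'k) mpoly) \<notin> var_ideal (V - part V c (c z))" using z by (simp add: part_def)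
    with zA have ne: "\<not> A \<subseteq> var_ideal (V - part V c (c z))" by blast
    have restrA: "restr P f \<in> A" if "f \<in> A" for P f
      using that unfolding A_def var_ideal_def by (rule restr_supported)
    have interA: "f \<in> J" if "f \<in> A" "\<And>k. k \<in> K \<Longrightarrow> f \<in> var_ideal (V - part V c k)" for f
      using that by (intro inter) (auto simp: K_def A_def)
    have primA: "f \<in> A" if "t \<notin> V" "Var t * f \<in> A" for t f using prim that unfolding A_def by blast
    have iA: "is_ideal A" unfolding A_def by (rule ideal_var_ideal)
    have JA: "J \<subseteq> A" using JP[of k0] by (simp add: A_def)
    note q = thin_quotient[OF V iA JA[unfolded J_def] restrA primA thin interA[unfolded J_def] zK ne,
        folded J_def]
    have "card (UNIV - (V - part V c k0)) = card (part V c k0) + card (UNIV - V)"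
      by (subst card_Un_disjoint[symmetric]) (auto simp: part_def intro!: arg_cong[of _ _ card])
    then have lt: "1 + card (UNIV - V) < card (UNIV - (V - part V c k0))" using k0(2) by simp
    note q' = var_ideal_quotient[of "V - part V c k0", where 'k = 'k, folded A_def]
    have "J \<noteq> A" using JP[of "c z"] ne by auto
    then have JA': "J \<subset> A" using JA by (rule psubsetI[rotated])
    have "1 \<notin> A" unfolding A_def by (rule one_notin_var_ideal)
    then have AU: "A \<subset> UNIV" by auto
    have hA: "hom_ideal A" using iA restrA by (simp add: hom_ideal_def)
    define F where "F = (\<lambda>i::nat. if i = 0 then J else if i = 1 then A else UNIV)"
    have F: "F 0 = J" "F 1 = A" "F (Suc 0) = A" "F 2 = UNIV" "F (Suc (Suc 0)) = UNIV"
      by (simp_all add: F_def)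
    have "scm_filtration J 2 F"
      unfolding scm_filtration_def
    proof (intro conjI allI impI)
      show "F 0 = J" "F 2 = UNIV" by (rule F)+
      show "hom_ideal (F i)" for i by (simp add: F_def Jh hA hom_ideal_UNIV)
    next
      fix i :: nat assume "i < 2"
      then have i: "i = 0 \<or> i = 1" by linarith
      then show "F i \<subset> F (Suc i)" by (elim disjE) (simp_all only: F JA' AU One_nat_def)
      show "quot_depth (F (Suc i)) (F i) = quot_dim (F (Suc i)) (F i)"
        using i by (elim disjE) (simp_all only: F q q' One_nat_def)
    next
      fix i :: nat assume "Suc i < 2"
      then have "i = 0" by linarith
      then show "quot_dim (F (Suc i)) (F i) < quot_dim (F (Suc (Suc i))) (F (Suc i))"
        using lt by (simp add: F q q')
    qed
    then show ?thesis by blast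
  qed
  then show ?thesis using SCM_iff_filtration[OF Jh] unfolding J_def by blast
qed

section \<open>Minimal monomial generators\<close>

text \<open>The elements of \<open>I\<close> among the monomials that are minimal for divisibility. Every monomial
  generating set contains them and they generate a monomial ideal, so they are \<open>min_gens I\<close>.\<close>

definition minimal_exps :: "('v::finite, 'k::field) mpoly set \<Rightarrow> ('v \<Rightarrow>\<^sub>0 nat) set" where
  "minimal_exps I = {u. mon u \<in> I \<and> (\<forall>w z. mon w \<in> I \<longrightarrow> u = w + z \<longrightarrow> w = u)}"

lemma mon_in_mono_gen:
  "(mon u :: ('v::finite, 'k::field) mpoly) \<in> mono_gen S \<longleftrightarrow> (\<exists>s\<in>S. \<exists>w. u = s + w)"
  by (simp add: mono_gen_eq)

lemma minimal_exps_subset: "minimal_exps (mono_gen S :: ('v::finite, 'k::field) mpoly set) \<subseteq> S"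
proof
  fix u assume u: "u \<in> minimal_exps (mono_gen S :: ('v, 'k) mpoly set)"
  then have "(mon u :: ('v, 'k) mpoly) \<in> mono_gen S" by (simp add: minimal_exps_def)
  then obtain s w where s: "s \<in> S" "u = s + w" unfolding mon_in_mono_gen by auto
  have "s = s + 0" by simp
  then have "(mon s :: ('v, 'k) mpoly) \<in> mono_gen S" using s(1) unfolding mon_in_mono_gen by blast
  then have "s = u" using u s(2) unfolding minimal_exps_def by blast
  then show "u \<in> S" using s(1) by simp
qed

lemma minimal_exps_below:
  fixes I :: "('v::finite, 'k::field) mpoly set"
  assumes "mon u \<in> I" shows "\<exists>s\<in>minimal_exps I. \<exists>w. u = s + w"
  using assms
proof (induction "mono_degree u" arbitrary: u rule: less_induct)
  case less
  show ?case
  proof (cases "u \<in> minimal_exps I")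
    case True
    have "u = u + 0" by simp
    then show ?thesis using True by blast
  next
    case False
    then obtain w z where wz: "mon w \<in> I" "u = w + z" "w \<noteq> u"
      using less.prems unfolding minimal_exps_def by blast
    then have "z \<noteq> 0" by auto
    then have "mono_degree z \<noteq> 0" by (simp add: mono_degree_eq_0_iff)
    then have "mono_degree w < mono_degree u" by (simp add: wz(2) mono_degree_add)
    from less.hyps[OF this wz(1)] obtain s w' where s: "s \<in> minimal_exps I" "w = s + w'" by blast
    then have "u = s + (w' + z)" by (simp add: wz(2) add.assoc)
    then show ?thesis using s(1) by blast
  qed
qed

lemma mono_gen_minimal_exps:
  fixes S :: "('v::finite \<Rightarrow>\<^sub>0 nat) set"
  defines "I \<equiv> (mono_gen S :: ('v, 'k::field) mpoly set)"
  shows "mono_gen (minimal_exps I) = I"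
proof -
  have "{u. \<exists>s\<in>minimal_exps I. \<exists>w. u = s + w} = {u. \<exists>s\<in>S. \<exists>w. u = s + w}"
  proof (intro equalityI subsetI CollectI)
    fix u assume "u \<in> {u. \<exists>s\<in>minimal_exps I. \<exists>w. u = s + w}"
    then show "\<exists>s\<in>S. \<exists>w. u = s + w" using minimal_exps_subset[of S, where 'k = 'k] unfolding I_def by blast
  next
    fix u assume "u \<in> {u. \<exists>s\<in>S. \<exists>w. u = s + w}"
    then have "(mon u :: ('v, 'k) mpoly) \<in> I" unfolding I_def mon_in_mono_gen by simp
    then show "\<exists>s\<in>minimal_exps I. \<exists>w. u = s + w" by (rule minimal_exps_below)
  qed
  then show ?thesis unfolding I_def mono_gen_eq by simp
qed

lemma min_gens_mono_gen:
  "min_gens (mono_gen S :: ('v::finite, 'k::field) mpoly set) = minimal_exps (mono_gen S :: ('v, 'k) mpoly set)"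
  unfolding min_gens_def
proof (rule the_equality)
  let ?I = "mono_gen S :: ('v, 'k) mpoly set"
  have sub: "minimal_exps ?I \<subseteq> T" if "?I = mono_gen T" for T
    unfolding that by (rule minimal_exps_subset)
  show "?I = mono_gen (minimal_exps ?I) \<and> (\<forall>T. T \<subset> minimal_exps ?I \<longrightarrow> ?I \<noteq> mono_gen T)"
    using sub mono_gen_minimal_exps[of S, where 'k = 'k] by (metis leD)
  fix T assume T: "?I = mono_gen T \<and> (\<forall>U. U \<subset> T \<longrightarrow> ?I \<noteq> mono_gen U)"
  then have "\<not> minimal_exps ?I \<subset> T" using mono_gen_minimal_exps[of S, where 'k = 'k] by metis
  then show "T = minimal_exps ?I" using sub T by blast
qed

lemma mono_gen_min_gens:
  assumes "monomial_ideal I" shows "mono_gen (min_gens I) = I"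
  using assms unfolding monomial_ideal_def by (auto simp: min_gens_mono_gen mono_gen_minimal_exps)

lemma Var_dvd_mon_iff:
  "(Var v :: ('v::finite, 'k::field) mpoly) dvd mon u \<longleftrightarrow> v \<in> keys u"
proof
  assume "(Var v :: ('v, 'k) mpoly) dvd mon u"
  then obtain g where g: "(mon u :: ('v, 'k) mpoly) = Var v * g" by (auto simp: dvd_def)
  have "u \<in> keys (mon u :: ('v, 'k) mpoly)" by (simp add: mon_def)
  then show "v \<in> keys u" unfolding g by (rule keys_Var_mult)
next
  assume "v \<in> keys u"
  from single_le_split[OF this] obtain w where "u = single v 1 + w" ..
  then have "(mon u :: ('v, 'k) mpoly) = Var v * mon w" by (simp add: Var_def mon_mult)
  then show "(Var v :: ('v, 'k) mpoly) dvd mon u" by (rule dvdI)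
qed

text \<open>A nontrivial common divisor can be taken to be a variable.\<close>

lemma is_gcd_1_iff:
  "is_gcd I 1 \<longleftrightarrow> (\<forall>v. \<exists>u\<in>min_gens I. v \<notin> keys u)"
  for I :: "('v::finite, 'k::field) mpoly set"
proof
  assume g: "is_gcd I 1"
  show "\<forall>v. \<exists>u\<in>min_gens I. v \<notin> keys u"
  proof (rule allI, rule ccontr)
    fix v assume "\<not> (\<exists>u\<in>min_gens I. v \<notin> keys u)"
    then have "\<forall>u\<in>min_gens I. (Var v :: ('v, 'k) mpoly) dvd mon u" by (simp add: Var_dvd_mon_iff)
    moreover have "(Var v :: ('v, 'k) mpoly) \<in> range mon" by (simp add: Var_def)
    ultimately have "(Var v :: ('v, 'k) mpoly) dvd mon 0" using g unfolding is_gcd_def mon_0 by blast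
    then show False by (simp add: Var_dvd_mon_iff)
  qed
next
  assume a: "\<forall>v. \<exists>u\<in>min_gens I. v \<notin> keys u"
  show "is_gcd I 1"
    unfolding is_gcd_def
  proof (intro conjI ballI impI)
    show "(1 :: ('v, 'k) mpoly) \<in> range mon" using mon_0 by (metis rangeI)
    fix m :: "('v, 'k) mpoly" assume m: "m \<in> range mon" "\<forall>u\<in>min_gens I. m dvd mon u"
    obtain w where w: "m = mon w" using m(1) by blast
    have "v \<notin> keys w" for v
    proof
      assume "v \<in> keys w"
      then have "(Var v :: ('v, 'k) mpoly) dvd m" by (simp add: w Var_dvd_mon_iff)
      then have "\<forall>u\<in>min_gens I. (Var v :: ('v, 'k) mpoly) dvd mon u" using m(2) dvd_trans by blast
      then show False using a by (auto simp: Var_dvd_mon_iff)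
    qed
    then have "w = 0" by (metis all_not_in_conv keys_eq_empty)
    then show "m dvd 1" by (simp add: w mon_0)
  qed simp
qed

section \<open>Multipartite ideals are the matroidal ideals of degree two\<close>

definition edge :: "'v \<Rightarrow> 'v \<Rightarrow> 'v \<Rightarrow>\<^sub>0 nat" where
  "edge a b = single a 1 + single b 1"

lemma edge_commute: "edge a b = edge b a"
  by (simp add: edge_def add.commute)

lemma keys_edge [simp]: "keys (edge a b) = {a, b}"
  by (auto simp: edge_def keys_add_nat)

lemma lookup_edge: "a \<noteq> b \<Longrightarrow> lookup (edge a b) i = (if i \<in> {a, b} then 1 else 0)"
  by (auto simp: edge_def lookup_add lookup_single when_def)

lemma mono_degree_edge [simp]: "mono_degree (edge a b) = 2"
  by (simp add: edge_def mono_degree_add) (simp add: mono_degree_def lookup_single when_def)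

lemma edge_exists:
  fixes u :: "'v::finite \<Rightarrow>\<^sub>0 nat"
  assumes "mono_degree u = 2" "\<And>v. lookup u v \<le> 1"
  shows "\<exists>a b. a \<noteq> b \<and> u = edge a b"
proof -
  have one: "lookup u v = (if v \<in> keys u then 1 else 0)" for v
    using assms(2)[of v] by (auto simp: in_keys_iff)
  have "mono_degree u = (\<Sum>v\<in>UNIV. if v \<in> keys u then 1 else 0)"
    unfolding mono_degree_def using one by presburger
  also have "\<dots> = card (keys u)" by (simp add: sum.If_cases)
  finally have "card (keys u) = 2" using assms(1) by simp
  then obtain a b where ab: "keys u = {a, b}" "a \<noteq> b" by (auto simp: card_2_iff)
  have "u = edge a b"
    by (rule poly_mapping_eqI) (simp only: one ab(1) lookup_edge[OF ab(2)])
  then show ?thesis using ab(2) by blast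
qed

lemma edge_split:
  fixes u :: "'v \<Rightarrow>\<^sub>0 nat"
  assumes "a \<in> keys u" "b \<in> keys u" "a \<noteq> b"
  shows "\<exists>w. u = edge a b + w"
proof -
  from single_le_split[OF assms(1)] obtain w where w: "u = single a 1 + w" ..
  have "b \<in> keys w" using assms(2,3) by (simp add: w keys_add_nat)
  from single_le_split[OF this] obtain z where "w = single b 1 + z" ..
  then have "u = edge a b + z" by (simp add: w edge_def add.assoc)
  then show ?thesis ..
qed

definition edges :: "'v set \<Rightarrow> ('v \<Rightarrow> 'c) \<Rightarrow> ('v \<Rightarrow>\<^sub>0 nat) set" where
  "edges V c = {edge a b | a b. a \<in> V \<and> b \<in> V \<and> c a \<noteq> c b}"

lemma edgesI: "a \<in> V \<Longrightarrow> b \<in> V \<Longrightarrow> c a \<noteq> c b \<Longrightarrow> edge a b \<in> edges V c"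
  by (auto simp: edges_def)

lemma multipartite_eq_mono_gen:
  "multipartite V c = (mono_gen (edges V c) :: ('v::finite, 'k::field) mpoly set)"
proof -
  have "{u. \<exists>x\<in>keys u \<inter> V. \<exists>y\<in>keys u \<inter> V. c x \<noteq> c y} =
    {u. \<exists>s\<in>edges V c. \<exists>w. u = s + w}"
  proof (intro equalityI subsetI CollectI)
    fix u :: "'v \<Rightarrow>\<^sub>0 nat"
    assume "u \<in> {u. \<exists>x\<in>keys u \<inter> V. \<exists>y\<in>keys u \<inter> V. c x \<noteq> c y}"
    then obtain x y where xy: "x \<in> keys u" "y \<in> keys u" "x \<in> V" "y \<in> V" "c x \<noteq> c y"
      by auto
    then have "x \<noteq> y" by auto
    from edge_split[OF xy(1,2) this] obtain w where "u = edge x y + w" ..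
    then show "\<exists>s\<in>edges V c. \<exists>w. u = s + w" using edgesI[OF xy(3-5)] by blast
  next
    fix u assume "u \<in> {u. \<exists>s\<in>edges V c. \<exists>w. u = s + w}"
    then obtain a b w where ab: "a \<in> V" "b \<in> V" "c a \<noteq> c b" "u = edge a b + w" by (auto simp: edges_def)
    then have "a \<in> keys u \<inter> V" "b \<in> keys u \<inter> V" by (auto simp: keys_add_nat)
    then show "\<exists>x\<in>keys u \<inter> V. \<exists>y\<in>keys u \<inter> V. c x \<noteq> c y"
      using ab(3) by blast
  qed
  then show ?thesis by (simp add: multipartite_def mono_gen_eq)
qed

lemma edge_in_multipartite:
  assumes "a \<in> V" "b \<in> V"
  shows "(mon (edge a b) :: ('v::finite, 'k::field) mpoly) \<in> multipartite V c \<longleftrightarrow> c a \<noteq> c b"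
  unfolding multipartite_def mon_in_supported using assms by auto

lemma min_gens_multipartite:
  "min_gens (multipartite V c :: ('v::finite, 'k::field) mpoly set) = edges V c"
proof -
  have "minimal_exps (mono_gen (edges V c) :: ('v, 'k) mpoly set) = edges V c"
  proof (rule equalityI[OF minimal_exps_subset], rule subsetI)
    fix u assume u: "u \<in> edges V c"
    have "w = u" if w: "(mon w :: ('v, 'k) mpoly) \<in> mono_gen (edges V c)" "u = w + z" for w z
    proof -
      obtain s t where s: "s \<in> edges V c" "w = s + t" using w(1) unfolding mon_in_mono_gen by blast
      have "mono_degree u = 2" "mono_degree s = 2" using u s(1) by (auto simp: edges_def)
      then have "mono_degree z = 0" using w(2) s(2) by (simp add: mono_degree_add)
      then show ?thesis using w(2) by (simp add: mono_degree_eq_0_iff)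
    qed
    moreover have "(mon u :: ('v, 'k) mpoly) \<in> mono_gen (edges V c)"
      unfolding mon_in_mono_gen using u by (intro bexI[of _ u] exI[of _ 0]) simp_all
    ultimately show "u \<in> minimal_exps (mono_gen (edges V c) :: ('v, 'k) mpoly set)"
      unfolding minimal_exps_def by blast
  qed
  then show ?thesis by (simp add: multipartite_eq_mono_gen min_gens_mono_gen)
qed

text \<open>To exchange the endpoint \<open>i\<close> of an edge, note that the other endpoint \<open>b'\<close> is adjacent to at
  least one endpoint of any second edge, since these two lie in different parts.\<close>

lemma matroidal_multipartite:
  "matroidal (multipartite V c :: ('v::finite, 'k::field) mpoly set)"
  unfolding matroidal_def polymatroidal_def generated_in_degree_def min_gens_multipartite
proof (intro conjI exI[of _ 2] ballI allI impI)
  show "monomial_ideal (multipartite V c :: ('v, 'k) mpoly set)"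
    unfolding monomial_ideal_def using multipartite_eq_mono_gen by blast
  show "mono_degree u = 2" if "u \<in> edges V c" for u using that by (auto simp: edges_def)
  show "lookup u v \<le> 1" if u: "u \<in> edges V c" for u v
  proof -
    obtain a b where ab: "u = edge a b" "c a \<noteq> c b" using u by (auto simp: edges_def)
    then have "a \<noteq> b" by auto
    from lookup_edge[OF this] show ?thesis by (simp add: ab(1))
  qed
  fix u v i assume u: "u \<in> edges V c" and v: "v \<in> edges V c"
    and i: "lookup v i < lookup u i"
  obtain x y where xy: "v = edge x y" "x \<in> V" "y \<in> V" "c x \<noteq> c y" using v by (auto simp: edges_def)
  then have "x \<noteq> y" by auto
  obtain a b where ab: "u = edge a b" "a \<in> V" "b \<in> V" "c a \<noteq> c b" using u by (auto simp: edges_def)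
  then have "a \<noteq> b" by auto
  then have i_ab: "i = a \<or> i = b" using i ab(1) lookup_edge[of a b i] by (auto split: if_splits)
  \<comment> \<open>Name the endpoints so that the one to be exchanged is \<open>i\<close>.\<close>
  obtain b' where b': "u = edge i b'" "b' \<in> V" "c i \<noteq> c b'"
  proof (cases "i = a")
    case True
    then show ?thesis using ab that[of b] by simp
  next
    case False
    then have "i = b" using i_ab by simp
    then show ?thesis using ab(2,4) that[of a] by (simp add: ab(1) edge_commute[of a b])
  qed
  have ib: "i \<noteq> b'" using b'(3) by auto
  have iv: "i \<notin> {x, y}" using i lookup_edge[OF \<open>x \<noteq> y\<close>, of i] lookup_edge[OF ib, of i]
    by (auto simp: xy(1) b'(1))
  obtain j where j: "j \<in> {x, y}" "c b' \<noteq> c j" using xy(4) by (cases "c b' = c x") auto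
  then have jn: "j \<notin> {i, b'}" using iv by auto
  have "j \<in> V" using j(1) xy by auto
  have "u - single i 1 + single j 1 = edge b' j"
    by (simp add: b'(1) edge_def)
  also have "\<dots> \<in> edges V c" by (rule edgesI[OF b'(2) \<open>j \<in> V\<close> j(2)])
  finally have "u - single i 1 + single j 1 \<in> edges V c" .
  moreover have "lookup u j < lookup v j"
    using jn j(1) lookup_edge[OF ib, of j] lookup_edge[OF \<open>x \<noteq> y\<close>, of j] by (simp add: b'(1) xy(1))
  ultimately show "\<exists>j. lookup u j < lookup v j \<and>
      u - single i 1 + single j 1 \<in> edges V c" by blast
qed

lemma inj_Var: "inj (Var :: 'v::finite \<Rightarrow> ('v, 'k::field) mpoly)"
proof (rule injI)
  fix v w assume eq: "(Var v :: ('v, 'k) mpoly) = Var w"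
  have "(Var v :: ('v, 'k) mpoly) \<in> var_ideal {v}" by simp
  then show "v = w" unfolding eq by simp
qed

text \<open>By the exchange property, a vertex \<open>b\<close> of the support is adjacent to at least one endpoint of
  every edge. Hence non-adjacency is an equivalence relation, and its classes are the parts.\<close>

theorem matroidal_is_multipartite:
  fixes J :: "('v::finite, 'k::field) mpoly set"
  assumes J: "matroidal J" "generated_in_degree J 2" and supp: "supp J = Var ` V"
  shows "\<exists>c :: 'v \<Rightarrow> 'v set. J = multipartite V c"
proof -
  define G where "G = min_gens J"
  have JG: "J = mono_gen G"
    using J(1) mono_gen_min_gens by (auto simp: matroidal_def polymatroidal_def G_def)
  have ex: "\<exists>a b. a \<noteq> b \<and> u = edge a b" if "u \<in> G" for u
    using J that by (intro edge_exists) (auto simp: matroidal_def generated_in_degree_def G_def)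
  have exch: "\<exists>j. lookup u j < lookup v j \<and>
      u - single i 1 + single j 1 \<in> G"
    if "u \<in> G" "v \<in> G" "lookup v i < lookup u i" for u v i
    using J(1) that unfolding matroidal_def polymatroidal_def G_def by blast
  have V: "v \<in> V \<longleftrightarrow> (\<exists>u\<in>G. v \<in> keys u)" for v
  proof -
    have "v \<in> V \<longleftrightarrow> (Var v :: ('v, 'k) mpoly) \<in> supp J" using supp inj_image_mem_iff[OF inj_Var[where 'v = 'v and 'k = 'k], of v V] by simp
    also have "\<dots> \<longleftrightarrow> (\<exists>u\<in>G. v \<in> keys u)"
      using inj_Var[where 'v = 'v and 'k = 'k] by (auto simp: supp_def G_def Var_dvd_mon_iff inj_eq)
    finally show ?thesis .
  qed
  have noloop: "edge a a \<notin> G" for a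
  proof
    assume "edge a a \<in> G"
    then obtain x y where "x \<noteq> y" "edge a a = edge x y" using ex by blast
    then show False by (metis keys_edge doubleton_eq_iff)
  qed
  have VI: "a \<in> V" "b \<in> V" if "edge a b \<in> G" for a b
    unfolding V by (rule bexI[OF _ that], simp)+
  have nb: "\<exists>d. edge b d \<in> G" if "b \<in> V" for b
  proof -
    from that[unfolded V] obtain u where u: "u \<in> G" "b \<in> keys u" ..
    obtain x y where xy: "u = edge x y" using ex[OF u(1)] by blast
    then have "edge x y \<in> G" "edge y x \<in> G" "b = x \<or> b = y"
      using u by (simp_all add: edge_commute[of y x])
    then show ?thesis by blast
  qed
  \<comment> \<open>The exchange property makes non-adjacency transitive.\<close>
  have trans: "edge a b \<in> G \<or> edge b d \<in> G" if b: "b \<in> V" and ad: "edge a d \<in> G" for a b d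
  proof -
    obtain e where e: "edge b e \<in> G" using nb[OF b] by blast
    show ?thesis
    proof (cases "e \<in> {a, d}")
      case True
      then show ?thesis using e edge_commute[of b a] by auto
    next
      case False
      have "b \<noteq> e" using e noloop by auto
      have "a \<noteq> d" using ad noloop by auto
      have "lookup (edge a d) e < lookup (edge b e) e"
        using False lookup_edge[OF \<open>a \<noteq> d\<close>, of e] lookup_edge[OF \<open>b \<noteq> e\<close>, of e] by simp
      from exch[OF e ad this] obtain j where j: "lookup (edge b e) j < lookup (edge a d) j"
        "edge b e - single e 1 + single j 1 \<in> G" by blast
      have "j \<in> {a, d}" using j(1) lookup_edge[OF \<open>a \<noteq> d\<close>, of j] by (auto split: if_splits)
      moreover have "edge b e - single e 1 + single j 1 = edge b j"
        by (simp add: edge_def)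
      ultimately show ?thesis using j(2) edge_commute[of b a] by auto
    qed
  qed
  define c where "c a = {b \<in> V. edge a b \<notin> G}" for a
  have c: "c a \<noteq> c b \<longleftrightarrow> edge a b \<in> G" if ab: "a \<in> V" "b \<in> V" for a b
  proof
    assume "edge a b \<in> G"
    then have "b \<notin> c a" "b \<in> c b" using ab noloop by (auto simp: c_def)
    then show "c a \<noteq> c b" by auto
  next
    assume "c a \<noteq> c b"
    then obtain d where d: "d \<in> V" "edge a d \<in> G \<and> edge b d \<notin> G \<or> edge b d \<in> G \<and> edge a d \<notin> G"
      by (auto simp: c_def)
    then show "edge a b \<in> G"
      using trans[OF ab(2), of a d] trans[OF ab(1), of b d] edge_commute[of b a] by auto
  qed
  have "edges V c = G"
  proof
    show "edges V c \<subseteq> G" using c by (auto simp: edges_def)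
    show "G \<subseteq> edges V c"
    proof
      fix u assume u: "u \<in> G"
      then obtain a b where ab: "u = edge a b" using ex by blast
      then show "u \<in> edges V c" using VI[of a b] c[of a b] u edgesI[of a V b c] by simp
    qed
  qed
  then have "J = multipartite V c" by (simp add: JG multipartite_eq_mono_gen)
  then show ?thesis by (rule exI[where x = c])
qed

lemma supp_multipartite:
  "supp (multipartite V c) = (Var ` {a \<in> V. \<exists>b\<in>V. c a \<noteq> c b} :: ('v::finite, 'k::field) mpoly set)"
proof -
  have "(\<exists>u\<in>edges V c. v \<in> keys u) \<longleftrightarrow> v \<in> V \<and> (\<exists>b\<in>V. c v \<noteq> c b)" for v
  proof
    assume "\<exists>u\<in>edges V c. v \<in> keys u"
    then obtain a b where "a \<in> V" "b \<in> V" "c a \<noteq> c b" "v \<in> {a, b}" by (auto simp: edges_def)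
    then show "v \<in> V \<and> (\<exists>b\<in>V. c v \<noteq> c b)" by force
  next
    assume "v \<in> V \<and> (\<exists>b\<in>V. c v \<noteq> c b)"
    then obtain b where "edge v b \<in> edges V c" using edgesI by metis
    then show "\<exists>u\<in>edges V c. v \<in> keys u" by (intro bexI[of _ "edge v b"]) simp_all
  qed
  then show ?thesis unfolding supp_def min_gens_multipartite Var_dvd_mon_iff by auto
qed

lemma is_gcd_multipartite:
  "is_gcd (multipartite V c :: ('v::finite, 'k::field) mpoly set) 1 \<longleftrightarrow>
    (\<forall>v. \<exists>a\<in>V - {v}. \<exists>b\<in>V - {v}. c a \<noteq> c b)"
  unfolding is_gcd_1_iff min_gens_multipartite
proof (rule all_cong1)
  fix v
  show "(\<exists>u\<in>edges V c. v \<notin> keys u) \<longleftrightarrow> (\<exists>a\<in>V - {v}. \<exists>b\<in>V - {v}. c a \<noteq> c b)"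
  proof
    assume "\<exists>u\<in>edges V c. v \<notin> keys u"
    then obtain a b where "a \<in> V" "b \<in> V" "c a \<noteq> c b" "v \<notin> {a, b}" by (auto simp: edges_def)
    then show "\<exists>a\<in>V - {v}. \<exists>b\<in>V - {v}. c a \<noteq> c b" by blast
  next
    assume "\<exists>a\<in>V - {v}. \<exists>b\<in>V - {v}. c a \<noteq> c b"
    then obtain a b where "a \<in> V - {v}" "b \<in> V - {v}" "c a \<noteq> c b" by blast
    then have "edge a b \<in> edges V c" "v \<notin> keys (edge a b)" by (auto intro: edgesI)
    then show "\<exists>u\<in>edges V c. v \<notin> keys u" by blast
  qed
qed

section \<open>Splitting off a variable adjacent to all the others\<close>

lemma l_coset_set_add:
  "(g <#\<^bsub>mpoly_ring\<^esub> P) <+>\<^bsub>mpoly_ring\<^esub> I = {g * p + q | p q. p \<in> P \<and> q \<in> I}"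
  by (auto simp: l_coset_def set_add_def set_mult_def)

text \<open>A monomial with variables of two parts is either free of \<open>x\<^sub>a\<close>, or it is \<open>x\<^sub>a\<close> times a monomial
  that involves another variable of \<open>V\<close>.\<close>

lemma multipartite_split:
  fixes c :: "'v::finite \<Rightarrow> 'c"
  assumes a: "a \<in> V" "\<And>z. z \<in> V - {a} \<Longrightarrow> c a \<noteq> c z"
  shows "multipartite V c =
    {Var a * p + q | p q. p \<in> var_ideal (V - {a}) \<and> q \<in> (multipartite (V - {a}) c :: ('v, 'k::field) mpoly set)}"
    (is "_ = ?S")
proof
  let ?J' = "multipartite (V - {a}) c :: ('v, 'k) mpoly set"
  note iJ' = hom_idealD(1)[OF hom_ideal_multipartite[of "V - {a}" c, where 'b = 'k]]
  have S: "?S = rmult (var_ideal (V - {a})) ?J' [Var a]" by simp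
  have idS: "is_ideal ?S"
    unfolding S
  proof (rule rmult_ideal(1)[OF ideal_var_ideal iJ'])
    show "?J' \<subseteq> var_ideal (V - {a})"
      unfolding multipartite_def var_ideal_def supported_subset_iff by auto
  qed
  show "(multipartite V c :: ('v, 'k) mpoly set) \<subseteq> ?S"
    unfolding multipartite_def[of V c]
  proof (rule supported_subset_ideal[OF idS])
    fix u :: "'v \<Rightarrow>\<^sub>0 nat"
    assume "u \<in> {u. \<exists>x\<in>keys u \<inter> V. \<exists>y\<in>keys u \<inter> V. c x \<noteq> c y}"
    then obtain x y where xy: "x \<in> keys u \<inter> V" "y \<in> keys u \<inter> V" "c x \<noteq> c y"
      by blast
    show "mon u \<in> ?S"
    proof (cases "a \<in> keys u")
      case True
      obtain z where z: "z \<in> keys u" "z \<in> V" "z \<noteq> a" using xy by blast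
      from single_le_split[OF True] obtain w where w: "u = single a 1 + w" ..
      have "z \<in> keys w" using z by (simp add: w keys_add_nat)
      then have "keys w \<inter> (V - {a}) \<noteq> {}" using z by blast
      then have "(mon w :: ('v, 'k) mpoly) \<in> var_ideal (V - {a})" by (simp add: var_ideal_def)
      moreover have "mon u = Var a * (mon w :: ('v, 'k) mpoly) + 0" by (simp add: w Var_def mon_mult)
      ultimately show ?thesis using ideal_zero[OF iJ'] by blast
    next
      case False
      then have "x \<in> keys u \<inter> (V - {a})" "y \<in> keys u \<inter> (V - {a})" using xy by auto
      then have "(mon u :: ('v, 'k) mpoly) \<in> ?J'" unfolding multipartite_def mon_in_supported using xy(3) by blast
      moreover have "mon u = Var a * 0 + (mon u :: ('v, 'k) mpoly)" by simp
      ultimately show ?thesis using ideal_zero[OF ideal_var_ideal] by blast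
    qed
  qed
  show "?S \<subseteq> multipartite V c"
  proof
    fix f assume "f \<in> ?S"
    then obtain p q where pq: "f = Var a * p + q" "p \<in> var_ideal (V - {a})" "q \<in> ?J'" by blast
    have "Var a * p \<in> multipartite V c"
      unfolding multipartite_def
    proof (rule mult_in_supported, rule CollectI)
      fix s t assume st: "s \<in> keys (Var a :: ('v, 'k) mpoly)" "t \<in> keys p"
      have s: "a \<in> keys (s + t) \<inter> V" using st(1) a(1) by (auto simp: Var_def mon_def keys_add_nat)
      have "keys t \<inter> (V - {a}) \<noteq> {}" using pq(2) st(2) unfolding var_ideal_def supported_def by blast
      then obtain z where z: "z \<in> keys t" "z \<in> V - {a}" by blast
      then have "z \<in> keys (s + t) \<inter> V" by (simp add: keys_add_nat)
      then show "\<exists>x\<in>keys (s + t) \<inter> V. \<exists>y\<in>keys (s + t) \<inter> V. c x \<noteq> c y"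
        using s a(2)[OF z(2)] by blast
    qed
    moreover have "?J' \<subseteq> multipartite V c" unfolding multipartite_def supported_subset_iff by blast
    ultimately show "f \<in> multipartite V c"
      unfolding pq(1) using pq(3) by (intro ideal_add hom_idealD hom_ideal_multipartite) auto
  qed
qed

lemma bij_betw_enumeration:
  assumes "distinct zs" "set zs = (UNIV :: 'v::finite set)"
  shows "bij_betw (\<lambda>i. Var (zs ! (i - 1)) :: ('v, 'k::field) mpoly) {1..CARD('v)} (range Var)"
proof -
  have len: "length zs = CARD('v)" using distinct_card[OF assms(1)] assms(2) by simp
  have 1: "bij_betw (\<lambda>i::nat. i - 1) {1..CARD('v)} {..<CARD('v)}"
    by (rule bij_betw_byWitness[where f' = Suc]) auto
  have 2: "bij_betw ((!) zs) {..<CARD('v)} UNIV"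
    using bij_betw_nth[OF assms(1), of "{..<CARD('v)}" UNIV] len assms(2) by simp
  have 3: "bij_betw (Var :: 'v \<Rightarrow> ('v, 'k) mpoly) UNIV (range Var)"
    using inj_Var by (simp add: bij_betw_def)
  show ?thesis using bij_betw_trans[OF bij_betw_trans[OF 1 2] 3] by (simp add: comp_def)
qed

lemma monomial_primeD:
  "monomial_prime P \<Longrightarrow> \<exists>A. P = var_ideal A"
  unfolding monomial_prime_def genideal_Var .

lemma monomial_prime_var_ideal: "monomial_prime (var_ideal A)"
  unfolding monomial_prime_def genideal_Var by blast

lemma eq_Diff_if_card:
  fixes A :: "'v::finite set"
  assumes "A \<subseteq> UNIV - B" "card A + card B = CARD('v)"
  shows "A = UNIV - B"
  using assms by (intro card_subset_eq) (auto simp: card_Diff_subset)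

section \<open>Splittings and the number of large parts\<close>

lemma part_large:
  fixes c :: "'v::finite \<Rightarrow> 'c"
  assumes "2 \<le> card (part V c k)"
  obtains x y where "x \<in> V" "y \<in> V" "x \<noteq> y" "c x = k" "c y = k"
proof -
  obtain T where "T \<subseteq> part V c k" "card T = 2" by (rule obtain_subset_with_card_n[OF assms])
  then obtain x y where "T = {x, y}" "x \<noteq> y" unfolding card_2_iff by (elim exE conjE)
  with \<open>T \<subseteq> part V c k\<close> have "x \<in> part V c k" "y \<in> part V c k" "x \<noteq> y" by simp_all
  then show ?thesis using that[of x y] by (simp add: part_def)
qed

lemma part_largeI:
  fixes c :: "'v::finite \<Rightarrow> 'c"
  assumes "x \<in> V" "y \<in> V" "x \<noteq> y" "c x = k" "c y = k"
  shows "2 \<le> card (part V c k)"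
proof -
  have "{x, y} \<subseteq> part V c k" using assms by (simp add: part_def)
  from card_mono[OF _ this] show ?thesis using assms(3) by simp
qed

text \<open>There are two vertices \<open>a\<close>, \<open>b\<close> that are alone in their parts; they become \<open>y 1\<close> and \<open>y 2\<close>. Whether
  the ideal left after splitting off \<open>a\<close> has a common factor decides between the alternatives.\<close>

lemma exists_splitting:
  fixes c :: "'v::finite \<Rightarrow> 'c"
  defines "J \<equiv> (multipartite UNIV c :: ('v, 'k::field) mpoly set)"
  assumes scm: "SCM J" and gcd: "is_gcd J 1"
  shows "\<exists>y :: nat \<Rightarrow> ('v, 'k) mpoly. bij_betw y {1..CARD('v)} (range Var) \<and>
      ((\<exists>P J'.
          monomial_prime P \<and> y 1 \<notin> P \<and> height mpoly_ring P + 1 = enat (CARD('v)) \<and>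
          matroidal J' \<and> SCM J' \<and> supp J' = y ` {2..CARD('v)} \<and> is_gcd J' 1 \<and>
          J = (y 1 <#\<^bsub>mpoly_ring\<^esub> P) <+>\<^bsub>mpoly_ring\<^esub> J')
       \<or>
       (\<exists>P Q.
          monomial_prime P \<and> monomial_prime Q \<and>
          y 1 \<notin> P \<and> y 1 \<notin> Q \<and> y 2 \<notin> Q \<and>
          height mpoly_ring P + 1 = enat (CARD('v)) \<and>
          height mpoly_ring Q + 2 = enat (CARD('v)) \<and>
          J = (y 1 <#\<^bsub>mpoly_ring\<^esub> P) <+>\<^bsub>mpoly_ring\<^esub> (y 2 <#\<^bsub>mpoly_ring\<^esub> Q)))"
proof -
  have g: "\<exists>a\<in>UNIV - {v}. \<exists>b\<in>UNIV - {v}. c a \<noteq> c b" for v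
    using gcd unfolding J_def is_gcd_multipartite by blast
  have one: "k = l" if "2 \<le> card (part UNIV c k)" "2 \<le> card (part UNIV c l)" for k l
  proof (rule ccontr)
    assume "k \<noteq> l"
    show False by (rule SCM_multipartite_imp[OF scm[unfolded J_def] _ that \<open>k \<noteq> l\<close>]) simp
  qed
  \<comment> \<open>Of two adjacent vertices, one is alone in its part and hence adjacent to all the others.\<close>
  have alone: "(\<forall>z. z \<noteq> x \<longrightarrow> c x \<noteq> c z) \<or> (\<forall>z. z \<noteq> y \<longrightarrow> c y \<noteq> c z)" if "c x \<noteq> c y" for x y
  proof (rule ccontr)
    assume "\<not> ?thesis"
    then have "\<not> (\<forall>z. z \<noteq> x \<longrightarrow> c x \<noteq> c z) \<and> \<not> (\<forall>z. z \<noteq> y \<longrightarrow> c y \<noteq> c z)"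
      unfolding de_Morgan_disj .
    note n = conjunct1[OF this] conjunct2[OF this]
    obtain z where z: "z \<noteq> x" "c x = c z" using n(1) by blast
    obtain w where w: "w \<noteq> y" "c y = c w" using n(2) by blast
    have "2 \<le> card (part UNIV c (c x))" "2 \<le> card (part UNIV c (c y))"
      by (rule part_largeI[OF UNIV_I UNIV_I z(1)[symmetric] refl z(2)[symmetric]],
          rule part_largeI[OF UNIV_I UNIV_I w(1)[symmetric] refl w(2)[symmetric]])
    then show False using one[of "c x" "c y"] that by simp
  qed
  obtain x y where "c x \<noteq> c y" using g[of undefined] by (elim bexE)
  from alone[OF this] have "\<exists>a. \<forall>z. z \<noteq> a \<longrightarrow> c a \<noteq> c z" by (elim disjE) (rule exI, assumption)+
  then obtain a where a0: "\<forall>z. z \<noteq> a \<longrightarrow> c a \<noteq> c z" by (elim exE)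
  have a: "c a \<noteq> c z" if "z \<noteq> a" for z using a0 that by simp
  obtain x' y' where xy': "x' \<noteq> a" "y' \<noteq> a" "c x' \<noteq> c y'" using g[of a] by (elim bexE) simp
  from alone[OF xy'(3)] have "\<exists>b. b \<noteq> a \<and> (\<forall>z. z \<noteq> b \<longrightarrow> c b \<noteq> c z)"
  proof
    assume "\<forall>z. z \<noteq> x' \<longrightarrow> c x' \<noteq> c z"
    with xy'(1) show ?thesis by (intro exI[of _ x'] conjI)
  next
    assume "\<forall>z. z \<noteq> y' \<longrightarrow> c y' \<noteq> c z"
    with xy'(2) show ?thesis by (intro exI[of _ y'] conjI)
  qed
  then obtain b where b0: "b \<noteq> a" "\<forall>z. z \<noteq> b \<longrightarrow> c b \<noteq> c z" by (elim exE conjE)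
  have b: "b \<noteq> a" "z \<noteq> b \<Longrightarrow> c b \<noteq> c z" for z using b0 by simp_all
  obtain xs where xs: "set xs = UNIV - {a, b}" "distinct xs" using finite_distinct_list[of "UNIV - {a, b}"] by auto
  define zs where "zs = a # b # xs"
  define y where "y = (\<lambda>i. Var (zs ! (i - 1)) :: ('v, 'k) mpoly)"
  have zs: "distinct zs" "set zs = UNIV" using xs b(1) by (auto simp: zs_def)
  have y: "bij_betw y {1..CARD('v)} (range Var)" unfolding y_def by (rule bij_betw_enumeration[OF zs])
  have y1: "y 1 = Var a" and y2: "y 2 = Var b" by (simp_all add: y_def zs_def)
  define P where "P = (var_ideal (UNIV - {a}) :: ('v, 'k) mpoly set)"
  define J' where "J' = (multipartite (UNIV - {a}) c :: ('v, 'k) mpoly set)"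
  have JP: "J = (y 1 <#\<^bsub>mpoly_ring\<^esub> P) <+>\<^bsub>mpoly_ring\<^esub> J'"
    unfolding l_coset_set_add y1 P_def J'_def J_def by (rule multipartite_split) (use a in auto)
  have two: "2 \<le> CARD('v)" using card_mono[of UNIV "{a, b}"] b(1) by simp
  have P: "monomial_prime P" "y 1 \<notin> P" "height mpoly_ring P + 1 = enat (CARD('v))"
    unfolding P_def y1
    using two by (simp_all add: monomial_prime_var_ideal height_var_ideal card_Diff_subset one_enat_def)
  show ?thesis
  proof (cases "is_gcd J' 1")
    case True
    have V: "card (UNIV - (UNIV - {a})) \<le> 1" by (simp add: Diff_Diff_Int)
    have sub: "card (part (UNIV - {a}) c k) \<le> card (part UNIV c k)" for k
      by (rule card_mono) (auto simp: part_def)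
    have "SCM J'"
      unfolding J'_def
    proof (rule SCM_multipartiteI[OF V])
      show "k = l" if "2 \<le> card (part (UNIV - {a}) c k)" "2 \<le> card (part (UNIV - {a}) c l)" for k l
        using one that sub[of k] sub[of l] by (meson order_trans)
    qed (use xy' in auto)
    moreover have "supp J' = y ` {2..CARD('v)}"
    proof -
      have "{v \<in> UNIV - {a}. \<exists>w\<in>UNIV - {a}. c v \<noteq> c w} = UNIV - {a}"
      proof -
        have "\<exists>w\<in>UNIV - {a}. c v \<noteq> c w" for v
          using xy' by (cases "c v = c x'") auto
        then show ?thesis by blast
      qed
      then have "supp J' = Var ` (UNIV - {a})" by (simp add: J'_def supp_multipartite)
      also have "\<dots> = range Var - {y 1}" by (simp only: image_set_diff[OF inj_Var] y1 image_insert image_empty)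
      also have "\<dots> = y ` {1..CARD('v)} - y ` {1}" using y by (simp add: bij_betw_def)
      also have "\<dots> = y ` ({1..CARD('v)} - {1})"
        using y two by (intro inj_on_image_set_diff[symmetric, of _ "{1..CARD('v)}"]) (auto simp: bij_betw_def)
      also have "{1..CARD('v)} - {1} = {2..CARD('v)}" by auto
      finally show ?thesis .
    qed
    moreover have "matroidal J'" unfolding J'_def by (rule matroidal_multipartite)
    ultimately show ?thesis using True y P JP by (intro exI[of _ y] conjI disjI1 exI[of _ P] exI[of _ J'])
  next
    case False
    define Q where "Q = (var_ideal (UNIV - {a, b}) :: ('v, 'k) mpoly set)"
    from False obtain v where v0: "\<not> (\<exists>x\<in>UNIV - {a} - {v}. \<exists>y\<in>UNIV - {a} - {v}. c x \<noteq> c y)"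
      unfolding J'_def is_gcd_multipartite not_all ..
    have v: "c x = c y" if "x \<notin> {a, v}" "y \<notin> {a, v}" for x y
    proof (rule ccontr)
      assume "c x \<noteq> c y"
      then have "\<exists>x\<in>UNIV - {a} - {v}. \<exists>y\<in>UNIV - {a} - {v}. c x \<noteq> c y"
        by (intro bexI[of _ x] bexI[of _ y]) (use that in simp_all)
      with v0 show False ..
    qed
    have rest: "c x = c y" if "x \<notin> {a, b}" "y \<notin> {a, b}" for x y
    proof (cases "v = b")
      case True
      show ?thesis by (rule v) (use that True in simp_all)
    next
      case False
      \<comment> \<open>Every vertex other than \<open>a\<close>, \<open>b\<close> is adjacent to \<open>b\<close>, so it must be \<open>v\<close>.\<close>
      have w: "w = v" if "w \<notin> {a, b}" for w
      proof (rule ccontr)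
        assume "w \<noteq> v"
        then have "c b = c w" using v[of b w] that False b(1) by simp
        then show False using b(2)[of w] that by simp
      qed
      show ?thesis using w[OF that(1)] w[OF that(2)] by simp
    qed
    have J'Q: "J' = y 2 <#\<^bsub>mpoly_ring\<^esub> Q"
    proof -
      have d: "UNIV - {a} - {b} = UNIV - {a, b}" by auto
      have "f = 0" if f: "f \<in> multipartite (UNIV - {a, b}) c" for f :: "('v, 'k) mpoly"
      proof (rule ccontr)
        assume "f \<noteq> 0"
        then obtain u where "u \<in> keys f" by (metis all_not_in_conv keys_eq_empty)
        then obtain x y where "x \<notin> {a, b}" "y \<notin> {a, b}" "c x \<noteq> c y"
          using f unfolding multipartite_def supported_def by blast
        then show False using rest[of x y] by simp
      qed
      then have "(multipartite (UNIV - {a, b}) c :: ('v, 'k) mpoly set) = {0}"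
        using ideal_zero[OF hom_idealD(1)[OF hom_ideal_multipartite]] by blast
      moreover have "J' = {Var b * p + q | p q. p \<in> var_ideal (UNIV - {a} - {b}) \<and>
          q \<in> (multipartite (UNIV - {a} - {b}) c :: ('v, 'k) mpoly set)}"
        unfolding J'_def by (rule multipartite_split) (use b in auto)
      ultimately have "J' = {Var b * p + 0 | p. p \<in> Q}" unfolding d Q_def by auto
      then show ?thesis by (auto simp: l_coset_def y2)
    qed
    have cardQ: "card (UNIV - {a, b}) + 2 = CARD('v)" using two b(1) by (simp add: card_Diff_subset)
    have "enat (card (UNIV - {a, b})) + 2 = enat (CARD('v))"
      unfolding cardQ[symmetric] by (simp add: numeral_eq_enat)
    then have "monomial_prime Q" "y 1 \<notin> Q" "y 2 \<notin> Q" "height mpoly_ring Q + 2 = enat (CARD('v))"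
      unfolding Q_def y1 y2 by (simp_all add: monomial_prime_var_ideal height_var_ideal)
    then show ?thesis
      using y P JP unfolding J'Q by (intro exI[of _ y] conjI disjI2 exI[of _ P] exI[of _ Q])
  qed
qed

text \<open>The degree of \<open>J'\<close> has to be found first: it is at least \<open>2\<close> because \<open>J'\<close> lies in \<open>J\<close>, and at most
  \<open>2\<close> because \<open>J\<close> has a generator without \<open>x\<^sub>a\<close>, which must come from \<open>J'\<close>. So \<open>J'\<close> is multipartite,
  with the same parts as \<open>J\<close> except for the part consisting of \<open>a\<close>.\<close>

lemma SCM_if_split_matroidal:
  fixes c :: "'v::finite \<Rightarrow> 'c" and J' :: "('v, 'k::field) mpoly set"
  defines "J \<equiv> (multipartite UNIV c :: ('v, 'k) mpoly set)"
  assumes gcd: "is_gcd J 1"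
    and J': "matroidal J'" "SCM J'" "supp J' = Var ` (UNIV - {a})" "is_gcd J' 1"
    and J: "J = {Var a * p + q | p q. p \<in> var_ideal (UNIV - {a}) \<and> q \<in> J'}"
  shows "SCM J"
proof -
  have g: "\<exists>a\<in>UNIV - {v}. \<exists>b\<in>UNIV - {v}. c a \<noteq> c b" for v
    using gcd unfolding J_def is_gcd_multipartite by blast
  have mono: "mono_gen (min_gens J') = J'"
    using J'(1) by (intro mono_gen_min_gens) (simp add: matroidal_def polymatroidal_def)
  have sub: "J' \<subseteq> J"
  proof
    fix q assume "q \<in> J'"
    then have "q = Var a * 0 + q" "0 \<in> (var_ideal (UNIV - {a}) :: ('v, 'k) mpoly set)" "q \<in> J'"
      by (simp_all add: ideal_zero[OF ideal_var_ideal])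
    then show "q \<in> J" unfolding J by blast
  qed
  \<comment> \<open>A monomial of \<open>J\<close> that avoids the split variable comes from the second summand.\<close>
  have avoid: "mon u \<in> J'" if u: "mon u \<in> J" "a \<notin> keys u" for u
  proof -
    obtain p q where pq: "mon u = Var a * p + q" "q \<in> J'" using u(1) unfolding J by blast
    have "u \<in> keys (mon u :: ('v, 'k) mpoly)" by (simp add: mon_def)
    then have "u \<in> keys (Var a * p) \<union> keys q"
      unfolding pq(1) by (rule subsetD[OF Poly_Mapping.keys_add])
    then have "u \<in> keys q" using keys_Var_mult[of u a p] u(2) by blast
    moreover have "q \<in> mono_gen (min_gens J')" unfolding mono by (rule pq(2))
    ultimately have "(mon u :: ('v, 'k) mpoly) \<in> mono_gen (min_gens J')"
      unfolding mono_gen_eq mon_in_supported unfolding supported_def by blast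
    then show ?thesis unfolding mono .
  qed
  have "generated_in_degree J' 2"
  proof -
    obtain d where d: "\<forall>u\<in>min_gens J'. mono_degree u = d"
      using J'(1) by (auto simp: matroidal_def polymatroidal_def generated_in_degree_def)
    obtain u where u: "u \<in> min_gens J'" using J'(4) unfolding is_gcd_1_iff by blast
    have "(mon u :: ('v, 'k) mpoly) \<in> mono_gen (min_gens J')"
      unfolding mon_in_mono_gen using u by (intro bexI[of _ u] exI[of _ 0]) simp_all
    then have "mon u \<in> J" unfolding mono using sub by blast
    then obtain e w where "e \<in> edges UNIV c" "u = e + w"
      unfolding J_def multipartite_eq_mono_gen mon_in_mono_gen by blast
    then have "2 \<le> d" using d u by (auto simp: edges_def mono_degree_add)
    obtain x z where xz: "x \<noteq> a" "z \<noteq> a" "c x \<noteq> c z" using g[of a] by blast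
    have "(mon (edge x z) :: ('v, 'k) mpoly) \<in> J" unfolding J_def using xz by (simp add: edge_in_multipartite)
    then have "(mon (edge x z) :: ('v, 'k) mpoly) \<in> mono_gen (min_gens J')"
      unfolding mono by (rule avoid) (use xz in auto)
    then obtain s w where s: "s \<in> min_gens J'" "edge x z = s + w" unfolding mon_in_mono_gen by blast
    have "2 = mono_degree s + mono_degree w" using s(2) by (metis mono_degree_edge mono_degree_add)
    then have "d \<le> 2" using d s(1) by simp
    then show ?thesis using d \<open>2 \<le> d\<close> by (simp add: generated_in_degree_def)
  qed
  then obtain c' :: "'v \<Rightarrow> 'v set" where c': "J' = multipartite (UNIV - {a}) c'"
    using matroidal_is_multipartite[OF J'(1) _ J'(3)] by blast
  have cc': "c x \<noteq> c z \<longleftrightarrow> c' x \<noteq> c' z" if "x \<noteq> a" "z \<noteq> a" for x z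
  proof -
    have "c x \<noteq> c z \<longleftrightarrow> (mon (edge x z) :: ('v, 'k) mpoly) \<in> J"
      unfolding J_def by (simp add: edge_in_multipartite)
    also have "\<dots> \<longleftrightarrow> (mon (edge x z) :: ('v, 'k) mpoly) \<in> J'"
      using avoid[of "edge x z"] sub that by auto
    also have "\<dots> \<longleftrightarrow> c' x \<noteq> c' z" unfolding c' using that by (simp add: edge_in_multipartite)
    finally show ?thesis .
  qed
  have ca: "c a \<noteq> c z" if "z \<noteq> a" for z
  proof -
    have "(Var z :: ('v, 'k) mpoly) \<in> var_ideal (UNIV - {a})" using that by simp
    moreover have "0 \<in> J'" unfolding c' by (intro ideal_zero hom_idealD hom_ideal_multipartite)
    moreover have "(mon (edge a z) :: ('v, 'k) mpoly) = Var a * Var z + 0" by (simp add: Var_def mon_mult edge_def)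
    ultimately have "(mon (edge a z) :: ('v, 'k) mpoly) \<in> J" unfolding J by blast
    then show ?thesis unfolding J_def by (simp add: edge_in_multipartite)
  qed
  obtain x0 z0 where xz0: "c x0 \<noteq> c z0" using g by blast
  have V: "card (UNIV - (UNIV - {a})) \<le> 1" by (simp add: Diff_Diff_Int)
  show "SCM J"
    unfolding J_def
  proof (rule SCM_multipartiteI)
    show "card (UNIV - (UNIV :: 'v set)) \<le> 1" by simp
    show "c x0 \<noteq> c z0" by fact
    fix k l assume kl: "2 \<le> card (part UNIV c k)" "2 \<le> card (part UNIV c l)"
    obtain x y where xy: "x \<noteq> y" "c x = k" "c y = k" using part_large[OF kl(1)] by blast
    obtain z w where zw: "z \<noteq> w" "c z = l" "c w = l" using part_large[OF kl(2)] by blast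
    have ne: "x \<noteq> a" if "x \<noteq> y" "c x = c y" for x y using ca[of y] that by auto
    have na: "x \<noteq> a" "y \<noteq> a" "z \<noteq> a" "w \<noteq> a"
      using ne[of x y] ne[of y x] ne[of z w] ne[of w z] xy zw by simp_all
    have "2 \<le> card (part (UNIV - {a}) c' (c' x))" "2 \<le> card (part (UNIV - {a}) c' (c' z))"
      using part_largeI[of x "UNIV - {a}" y c' "c' x"] part_largeI[of z "UNIV - {a}" w c' "c' z"]
        cc'[of x y] cc'[of z w] xy zw na by auto
    then have "c' x = c' z" using SCM_multipartite_imp[OF J'(2)[unfolded c'] V] by blast
    then show "k = l" using cc'[of x z] na xy zw by simp
  qed simp_all
qed

text \<open>The vertices \<open>a\<close> and \<open>b\<close> are adjacent to all others, and there are no further edges, so all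
  remaining vertices form one part.\<close>

lemma SCM_if_split_twice:
  fixes c :: "'v::finite \<Rightarrow> 'c"
  defines "J \<equiv> (multipartite UNIV c :: ('v, 'k::field) mpoly set)"
  assumes gcd: "is_gcd J 1" and ab: "a \<noteq> b"
    and J: "J = {Var a * p + Var b * q | p q. p \<in> var_ideal (UNIV - {a}) \<and> q \<in> var_ideal (UNIV - {a, b})}"
  shows "SCM J"
proof -
  obtain x0 z0 where xz0: "c x0 \<noteq> c z0"
    using gcd unfolding J_def is_gcd_multipartite by blast
  have iff: "c x \<noteq> c z \<longleftrightarrow> (mon (edge x z) :: ('v, 'k) mpoly) \<in> J" for x z
    unfolding J_def by (simp add: edge_in_multipartite)
  have zero: "0 \<in> (var_ideal C :: ('v, 'k) mpoly set)" for C by (rule ideal_zero[OF ideal_var_ideal])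
  have ca: "c a \<noteq> c z" if "z \<noteq> a" for z
  proof -
    have "(Var z :: ('v, 'k) mpoly) \<in> var_ideal (UNIV - {a})" using that by simp
    moreover have "(mon (edge a z) :: ('v, 'k) mpoly) = Var a * Var z + Var b * 0"
      by (simp add: Var_def mon_mult edge_def)
    ultimately show ?thesis
      unfolding iff J by (intro CollectI exI[of _ "Var z"] exI[of _ 0] conjI zero)
  qed
  have cb: "c b \<noteq> c z" if "z \<noteq> b" for z
  proof (cases "z = a")
    case True
    then show ?thesis using ca[of b] ab by auto
  next
    case False
    then have "(Var z :: ('v, 'k) mpoly) \<in> var_ideal (UNIV - {a, b})" using that by simp
    moreover have "(mon (edge b z) :: ('v, 'k) mpoly) = Var a * 0 + Var b * Var z"
      by (simp add: Var_def mon_mult edge_def)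
    ultimately show ?thesis
      unfolding iff J by (intro CollectI exI[of _ 0] exI[of _ "Var z"] conjI zero)
  qed
  have rest: "c x = c z" if "x \<notin> {a, b}" "z \<notin> {a, b}" for x z
  proof (rule ccontr)
    assume "c x \<noteq> c z"
    then have "(mon (edge x z) :: ('v, 'k) mpoly) \<in> J" by (simp only: iff)
    then obtain p q where pq: "(mon (edge x z) :: ('v, 'k) mpoly) = Var a * p + Var b * q"
      unfolding J by blast
    have "edge x z \<in> keys (mon (edge x z) :: ('v, 'k) mpoly)" by (simp add: mon_def)
    then have "edge x z \<in> keys (Var a * p) \<union> keys (Var b * q)"
      unfolding pq by (rule subsetD[OF Poly_Mapping.keys_add])
    then have "a \<in> keys (edge x z) \<or> b \<in> keys (edge x z)"
      using keys_Var_mult[of "edge x z" a p] keys_Var_mult[of "edge x z" b q] by blast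
    then show False using that by auto
  qed
  show "SCM J"
    unfolding J_def
  proof (rule SCM_multipartiteI)
    show "card (UNIV - (UNIV :: 'v set)) \<le> 1" by simp
    show "c x0 \<noteq> c z0" by fact
    fix k l assume kl: "2 \<le> card (part UNIV c k)" "2 \<le> card (part UNIV c l)"
    obtain x y where xy: "x \<noteq> y" "c x = k" "c y = k" using part_large[OF kl(1)] by blast
    obtain z w where zw: "z \<noteq> w" "c z = l" "c w = l" using part_large[OF kl(2)] by blast
    have notin: "x \<notin> {a, b}" if "x \<noteq> y" "c x = c y" for x y
      using ca[of y] cb[of y] that by auto
    have "x \<notin> {a, b}" "z \<notin> {a, b}" using notin[of x y] notin[of z w] xy zw by simp_all
    then show "k = l" using rest[of x z] xy zw by simp
  qed simp_all
qed

theorem theorem3p8: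
  fixes J :: "('v::finite, 'k::field) mpoly set"
  assumes "matroidal J"
    and "generated_in_degree J 2"
    and "is_gcd J 1"
    and "supp J = range Var"
  shows "SCM J \<longleftrightarrow>
    (\<exists>y :: nat \<Rightarrow> ('v, 'k) mpoly. bij_betw y {1..CARD('v)} (range Var) \<and>
      ((\<exists>P J'.
          monomial_prime P \<and> y 1 \<notin> P \<and> height mpoly_ring P + 1 = enat (CARD('v)) \<and>
          matroidal J' \<and> SCM J' \<and> supp J' = y ` {2..CARD('v)} \<and> is_gcd J' 1 \<and>
          J = (y 1 <#\<^bsub>mpoly_ring\<^esub> P) <+>\<^bsub>mpoly_ring\<^esub> J')
       \<or>
       (\<exists>P Q.
          monomial_prime P \<and> monomial_prime Q \<and>
          y 1 \<notin> P \<and> y 1 \<notin> Q \<and> y 2 \<notin> Q \<and>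
          height mpoly_ring P + 1 = enat (CARD('v)) \<and>
          height mpoly_ring Q + 2 = enat (CARD('v)) \<and>
          J = (y 1 <#\<^bsub>mpoly_ring\<^esub> P) <+>\<^bsub>mpoly_ring\<^esub> (y 2 <#\<^bsub>mpoly_ring\<^esub> Q))))"
    (is "_ \<longleftrightarrow> (\<exists>y. bij_betw y _ _ \<and> (?A y \<or> ?B y))")
proof
  obtain c :: "'v \<Rightarrow> 'v set" where c: "J = multipartite UNIV c"
    using matroidal_is_multipartite[OF assms(1,2,4)] by blast
  note gcd = assms(3)[unfolded c]
  {
    assume "SCM J"
    then show "\<exists>y. bij_betw y {1..CARD('v)} (range Var) \<and> (?A y \<or> ?B y)"
      unfolding c by (rule exists_splitting[OF _ gcd])
  next
    assume "\<exists>y. bij_betw y {1..CARD('v)} (range Var) \<and> (?A y \<or> ?B y)"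
    then obtain y where y: "bij_betw y {1..CARD('v)} (range Var)" and AB: "?A y \<or> ?B y" by (elim exE conjE)
    have img: "y ` {1..CARD('v)} = range Var" and inj: "inj_on y {1..CARD('v)}"
      using y by (simp_all add: bij_betw_def)
    have "y 1 \<in> range Var"
      unfolding img[symmetric] by (rule imageI) (simp add: Suc_leI zero_less_card_finite)
    then obtain a where a: "y 1 = Var a" by blast
    have P_eq: "P = var_ideal (UNIV - {a})"
      if P: "monomial_prime P" "y 1 \<notin> P" "height mpoly_ring P + 1 = enat (CARD('v))" for P
    proof -
      obtain A where A: "P = var_ideal A" using monomial_primeD[OF P(1)] by blast
      have "card A + card {a} = CARD('v)" using P(3) by (simp add: A height_var_ideal one_enat_def)
      moreover have "A \<subseteq> UNIV - {a}" using P(2) unfolding A a by auto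
      ultimately show ?thesis using eq_Diff_if_card[of A "{a}"] A by blast
    qed
    from AB show "SCM J"
    proof
      assume "?A y"
      then obtain P J' where P: "monomial_prime P" "y 1 \<notin> P" "height mpoly_ring P + 1 = enat (CARD('v))"
        and J': "matroidal J'" "SCM J'" "supp J' = y ` {2..CARD('v)}" "is_gcd J' 1"
        and J: "J = (y 1 <#\<^bsub>mpoly_ring\<^esub> P) <+>\<^bsub>mpoly_ring\<^esub> J'" by (elim exE conjE)
      have "{2..CARD('v)} = {1..CARD('v)} - {1}" by auto
      then have "y ` {2..CARD('v)} = y ` {1..CARD('v)} - y ` {1}"
        using inj by (simp only:) (intro inj_on_image_set_diff[of y "{1..CARD('v)}"]; simp)
      also have "\<dots> = range Var - {Var a}" by (simp only: img a image_insert image_empty)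
      also have "\<dots> = Var ` (UNIV - {a})" by (simp only: image_set_diff[OF inj_Var] image_insert image_empty)
      finally have supp: "supp J' = Var ` (UNIV - {a})" using J'(3) by simp
      have "J = {Var a * p + q | p q. p \<in> var_ideal (UNIV - {a}) \<and> q \<in> J'}"
        using J unfolding P_eq[OF P] l_coset_set_add a .
      then show ?thesis
        unfolding c by (rule SCM_if_split_matroidal[OF gcd J'(1,2) supp J'(4)])
    next
      assume "?B y"
      then obtain P Q where P: "monomial_prime P" "y 1 \<notin> P" "height mpoly_ring P + 1 = enat (CARD('v))"
        and Q: "monomial_prime Q" "y 1 \<notin> Q" "y 2 \<notin> Q" "height mpoly_ring Q + 2 = enat (CARD('v))"
        and J: "J = (y 1 <#\<^bsub>mpoly_ring\<^esub> P) <+>\<^bsub>mpoly_ring\<^esub> (y 2 <#\<^bsub>mpoly_ring\<^esub> Q)" by (elim exE conjE)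
      obtain A where A: "Q = var_ideal A" using monomial_primeD[OF Q(1)] by blast
      have cardA: "card A + 2 = CARD('v)"
        using Q(4) by (simp add: A height_var_ideal numeral_eq_enat)
      then have 2: "(2::nat) \<in> {1..CARD('v)}" "(1::nat) \<in> {1..CARD('v)}" by auto
      have "y 2 \<in> range Var" unfolding img[symmetric] by (rule imageI[OF 2(1)])
      then obtain b where b: "y 2 = Var b" by blast
      have ab: "a \<noteq> b"
      proof
        assume "a = b"
        then have "y 2 = y 1" unfolding a b by simp
        from inj_onD[OF inj this 2] show False by simp
      qed
      have "card A + card {a, b} = CARD('v)" using cardA ab by simp
      moreover have "A \<subseteq> UNIV - {a, b}" using Q(2,3) unfolding A a b by auto
      ultimately have "A = UNIV - {a, b}" by (rule eq_Diff_if_card[rotated])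
      then have Q_eq: "Q = var_ideal (UNIV - {a, b})" using A by simp
      have "J = {Var a * p + q | p q. p \<in> var_ideal (UNIV - {a}) \<and>
          q \<in> Var b <#\<^bsub>mpoly_ring\<^esub> var_ideal (UNIV - {a, b})}"
        using J unfolding P_eq[OF P] Q_eq l_coset_set_add a b .
      also have "\<dots> = {Var a * p + Var b * q | p q. p \<in> var_ideal (UNIV - {a}) \<and> q \<in> var_ideal (UNIV - {a, b})}"
        by (auto simp: l_coset_def)
      finally have "multipartite UNIV c =
          {Var a * p + Var b * q | p q. p \<in> var_ideal (UNIV - {a}) \<and> q \<in> (var_ideal (UNIV - {a, b}) :: ('v, 'k) mpoly set)}"
        unfolding c .
      then show ?thesis unfolding c by (rule SCM_if_split_twice[OF gcd ab])
    qed
  }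
qed

end
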